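(* Let $r\ge 3$ and put $n=2r+1$. Let $M$ be a physical invariant of $B_{r,2}$ (the affine algebra $B_r^{(1)}$ at level $2$). Then $M$ equals one of the following: (a) $\mathcal{B}(d,\ell)$ for any divisor $d$ of $n=2r+1$ obeying $n\mid d^2$, and for any integer $0\le \ell<\frac{d^2}{2n}$ obeying $\ell^2\equiv 1 \pmod{\frac{d^2}{n}}$; (b) $\mathcal{B}(d_1,\ell_1|d_2,\ell_2)$ for any divisors $d_i$ of $n$ obeying $n\mid d_i^2$, and for any integers $0\le \ell_i<\frac{d_i^2}{2n}$ obeying $\ell_i^2\equiv 1\pmod{\frac{d_i^2}{n}}$ ($i=1,2$); (c) when $n$ is a perfect square, there are 4 remaining physical invariants: $\mathcal{B}^{\mathrm{i}}$, $\mathcal{B}^{\mathrm{ii}}$, $\mathcal{B}^{\mathrm{iii}}$, and $\mathcal{B}^{\mathrm{iv}}$.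
   Context: **Weights.** For $r\ge 3$, the set $P_+$ of level-$k$ integrable highest weights of $B_r^{(1)}$ consists of all $\lambda=\sum_{i=0}^r\lambda_i\Lambda_i$ with $\lambda_i\in\mathbb{Z}_{\ge 0}$ and $k=\lambda_0+\lambda_1+2\lambda_2+\cdots+2\lambda_{r-1}+\lambda_r$, where $\Lambda_i$ are the fundamental weights. Here $k=2$. The $\Lambda_0$-component is determined by the others and is dropped from the notation; the weight $k\Lambda_0$ is written $0$. Let $\rho=\sum_i\Lambda_i$ be the Weyl vector and $n=k+2r-1=2r+1$. **Kac–Peterson matrices.** With $\bar\lambda=\sum_{i\ge1}\lambda_i\Lambda_i$ and $\bar\rho$ the finite parts, $W$ the finite Weyl group of $B_r$, $\Delta_+$ its positive roots, $h^\vee=2r-1$, and the invariant form normalised so that long roots have norm 2, $$S_{\lambda\mu}=\mathrm{i}^{|\Delta_+|}\,n^{-r/2}\,|P/Q^\vee|^{-1/2}\sum_{w\in W}\det(w)\exp\!\Big[-\tfrac{2\pi \mathrm{i}}{n}\big(w(\bar\lambda+\bar\rho)\,|\,\bar\mu+\bar\rho\big)\Big],\qquad T_{\lambda\mu}=\delta_{\lambda,\mu}\exp\!\Big[\tfrac{\pi \mathrm{i}\,(\bar\lambda+\bar\rho)^2}{n}-\tfrac{\pi \mathrm{i}\,\bar\rho^2}{h^\vee}\Big]$$ for $\lambda,\mu\in P_+$, where $P$ is the weight lattice and $Q^\vee$ the coroot lattice of $B_r$. **Physical invariant.** A matrix $M=(M_{\mu\nu})_{\mu,\nu\in P_+}$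 with $MS=SM$, $MT=TM$, all $M_{\mu\nu}\in\mathbb{Z}_{\ge0}$, and $M_{00}=1$. **Simple current.** $J=J_b$ acts on $P_+$ by $J(\lambda_0,\lambda_1,\lambda_2,\ldots,\lambda_r)=(\lambda_1,\lambda_0,\lambda_2,\ldots,\lambda_r)$. At level 2, $\mathcal{I}[J_b]$ is the matrix $$\mathcal{I}[J_b]_{\mu,\nu}=\sum_{\ell=1}^{2}\delta_{J^\ell\mu,\nu}\,\delta^1\big(\tfrac{\mu_r}{2}+\ell\big),$$ where $\delta^1(x)=1$ if $x\in\mathbb{Z}$ and $0$ otherwise. **Notation for weights at level 2.** $P_+$ has exactly $r+4$ elements: $\gamma^0=0$, $J0=2\Lambda_1$, $\Lambda_r$, $J\Lambda_r=\Lambda_1+\Lambda_r$, $\gamma^i=\Lambda_i$ for $1\le i<r$, and $\gamma^r=2\Lambda_r$. When $n$ is a perfect square (then $4\mid r$): if $8\mid r$ write $\lambda^r=\Lambda_r$, $\mu^r=J\Lambda_r$; otherwise write $\lambda^r=J\Lambda_r$, $\mu^r=\Lambda_r$. Also, in this case, $\mathcal{C}=\{\gamma^a\ne0 : \sqrt n \text{ divides } a\}$. **The matrices.** For $a,b\in\{0,1,\ldots,r\}$ and $i\in\{0,1\}$, $$\mathcal{B}(d,\ell)_{J^i\gamma^a,J^i\gamma^b}=\begin{cases}2&\text{if } d\mid a,\ d\mid b,\text{ and both } a\ne0,\ b\ne0\\ 0&\text{if } n\nmid da \text{ or } b\not\equiv\pm a\ell \pmod d\\ 1&\text{otherwise}\end{cases}\qquad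 \mathcal{B}(d,\ell)_{J^i\Lambda_r,J^i\Lambda_r}=1,$$ and all other entries are 0. Next, $$\mathcal{B}(d_1,\ell_1|d_2,\ell_2)=\tfrac12\big(\mathcal{B}(d_1,\ell_1)+\mathcal{B}(d_2,\ell_2)\big)\,\mathcal{I}[J_b].$$ When $n$ is a perfect square, for all $\gamma,\gamma'\in\mathcal{C}$: $$\mathcal{B}^{\mathrm{i}}_{00}=\mathcal{B}^{\mathrm{i}}_{0\gamma}=\mathcal{B}^{\mathrm{i}}_{\gamma0}=\mathcal{B}^{\mathrm{i}}_{\gamma\gamma'}=\mathcal{B}^{\mathrm{i}}_{\lambda^r\gamma}=\mathcal{B}^{\mathrm{i}}_{\gamma\lambda^r}=\mathcal{B}^{\mathrm{i}}_{\mu^r\mu^r}=\mathcal{B}^{\mathrm{i}}_{\lambda^r,J0}=\mathcal{B}^{\mathrm{i}}_{J0,\lambda^r}=1,$$ $$\mathcal{B}^{\mathrm{ii}}_{00}=\mathcal{B}^{\mathrm{ii}}_{0\gamma}=\mathcal{B}^{\mathrm{ii}}_{\gamma0}=\mathcal{B}^{\mathrm{ii}}_{\gamma\gamma'}=\mathcal{B}^{\mathrm{ii}}_{0\lambda^r}=\mathcal{B}^{\mathrm{ii}}_{\lambda^r0}=\mathcal{B}^{\mathrm{ii}}_{\lambda^r\lambda^r}=\mathcal{B}^{\mathrm{ii}}_{\lambda^r\gamma}=\mathcal{B}^{\mathrm{ii}}_{\gamma\lambda^r}=1,$$ with all other entries 0; and $\mathcal{B}^{\mathrm{iii}}=\mathcal{B}^{\mathrm{i}}\,\mathcal{I}[J_b]$,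 $\mathcal{B}^{\mathrm{iv}}=\mathcal{I}[J_b]\,\mathcal{B}^{\mathrm{i}}$ (matrix products). *)

theory Defs
  imports Complex_Main "HOL-Number_Theory.Cong" "HOL-Algebra.Coset" "HOL-Algebra.Generated_Groups"
    "Jordan_Normal_Form.Determinant"
begin

section \<open>The root system \<open>B\<^sub>r\<close>\<close>

text \<open>
  We use the standard realisation of \<open>B\<^sub>r\<close> in Euclidean \<open>r\<close>-space with orthonormal basis
  \<open>e\<^sub>0, \<dots>, e\<^sub>r\<^sub>-\<^sub>1\<close> (JNF vectors are indexed from \<open>0\<close>): the positive roots are \<open>e\<^sub>i\<close> and
  \<open>e\<^sub>i \<plusminus> e\<^sub>j\<close> for \<open>i < j\<close>.  Long roots have norm \<open>2\<close>, so the invariant form is the standard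
  scalar product.
\<close>

definition pos_roots :: "nat \<Rightarrow> real vec set" where
  "pos_roots r = {unit_vec r i | i. i < r}
     \<union> {unit_vec r i - unit_vec r j | i j. i < j \<and> j < r}
     \<union> {unit_vec r i + unit_vec r j | i j. i < j \<and> j < r}"

definition coroot :: "real vec \<Rightarrow> real vec" where
  "coroot \<alpha> = (2 / (\<alpha> \<bullet> \<alpha>)) \<cdot>\<^sub>v \<alpha>"

text \<open>Matrix of the reflection \<open>v \<mapsto> v - (v | \<alpha>\<^sup>\<or>) \<alpha>\<close>.\<close>

definition reflection :: "nat \<Rightarrow> real vec \<Rightarrow> real mat" where
  "reflection r \<alpha> = 1\<^sub>m r - mat r r (\<lambda>(i, j). \<alpha> $ i * coroot \<alpha> $ j)"

definition weyl_group :: "nat \<Rightarrow> real mat set" where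
  "weyl_group r = generate (units_of (ring_mat TYPE(real) r ())) (reflection r ` pos_roots r)"

text \<open>
  The finite fundamental weights for the simple roots \<open>\<alpha>\<^sub>i = e\<^sub>i\<^sub>-\<^sub>1 - e\<^sub>i\<close> (\<open>1 \<le> i < r\<close>) and
  \<open>\<alpha>\<^sub>r = e\<^sub>r\<^sub>-\<^sub>1\<close>: \<open>\<Lambda>\<^sub>i\<close> is the sum of the first \<open>i\<close> basis vectors for \<open>i < r\<close>, and \<open>\<Lambda>\<^sub>r\<close> is half
  the sum of all of them.
\<close>

definition fund_wt :: "nat \<Rightarrow> nat \<Rightarrow> real vec" where
  "fund_wt r i = vec r (\<lambda>j. if i = r then 1 / 2 else if j < i then 1 else 0)"

definition weight_lattice :: "nat \<Rightarrow> real vec set" where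
  "weight_lattice r = generate (monoid_vec TYPE(real) r) (fund_wt r ` {1..r})"

definition coroot_lattice :: "nat \<Rightarrow> real vec set" where
  "coroot_lattice r = generate (monoid_vec TYPE(real) r) (coroot ` pos_roots r)"

text \<open>The order of \<open>P / Q\<^sup>\<or>\<close>.\<close>

definition P_mod_Q_order :: "nat \<Rightarrow> nat" where
  "P_mod_Q_order r =
     Coset.order ((monoid_vec TYPE(real) r)\<lparr>carrier := weight_lattice r\<rparr> Mod coroot_lattice r)"

section \<open>Integrable weights and the modular matrices\<close>

text \<open>
  An affine weight is given by its Dynkin labels \<open>\<mu>\<^sub>0, \<dots>, \<mu>\<^sub>r\<close>, extended by \<open>0\<close> beyond \<open>r\<close>.
\<close>

type_synonym wt = "nat \<Rightarrow> nat"

type_synonym wmat = "wt \<Rightarrow> wt \<Rightarrow> complex"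

definition P_plus :: "nat \<Rightarrow> nat \<Rightarrow> wt set" where
  "P_plus r k = {\<mu>. (\<forall>i>r. \<mu> i = 0) \<and> k = \<mu> 0 + \<mu> 1 + 2 * (\<Sum>i\<in>{2..<r}. \<mu> i) + \<mu> r}"

text \<open>\<open>fin_part r \<mu>\<close> is the finite part of \<open>\<mu>\<close>; it forgets the label \<open>\<mu>\<^sub>0\<close>.\<close>

definition fin_part :: "nat \<Rightarrow> wt \<Rightarrow> real vec" where
  "fin_part r \<mu> = finsum_vec TYPE(real) r (\<lambda>i. real (\<mu> i) \<cdot>\<^sub>v fund_wt r i) {1..r}"

definition rho :: wt where
  "rho = (\<lambda>_. 1)"

definition dual_coxeter :: "nat \<Rightarrow> nat" where
  "dual_coxeter r = 2 * r - 1"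

definition height :: "nat \<Rightarrow> nat \<Rightarrow> nat" where
  "height r k = k + dual_coxeter r"

definition S_mat :: "nat \<Rightarrow> nat \<Rightarrow> wmat" where
  "S_mat r k = (\<lambda>\<mu> \<nu>.
     \<i> ^ card (pos_roots r)
     * complex_of_real (real (height r k) powr (- real r / 2))
     * complex_of_real (real (P_mod_Q_order r) powr (- 1 / 2))
     * (\<Sum>w\<in>weyl_group r. complex_of_real (det w)
          * exp (- (2 * complex_of_real pi * \<i> / of_nat (height r k))
                 * complex_of_real ((w *\<^sub>v (fin_part r \<mu> + fin_part r rho))
                                    \<bullet> (fin_part r \<nu> + fin_part r rho)))))"

definition T_mat :: "nat \<Rightarrow> nat \<Rightarrow> wmat" where
  "T_mat r k = (\<lambda>\<mu> \<nu>.
     if \<mu> = \<nu>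
     then exp (complex_of_real pi * \<i>
                 * complex_of_real ((fin_part r \<mu> + fin_part r rho) \<bullet> (fin_part r \<mu> + fin_part r rho))
                 / of_nat (height r k)
               - complex_of_real pi * \<i>
                 * complex_of_real (fin_part r rho \<bullet> fin_part r rho)
                 / of_nat (dual_coxeter r))
     else 0)"

text \<open>
  Matrices are indexed by \<open>P\<^sub>+\<close>; values outside \<open>P\<^sub>+ \<times> P\<^sub>+\<close> carry no meaning, and equality of
  matrices is equality of the entries over \<open>P\<^sub>+\<close>.
\<close>

definition wmat_mult :: "nat \<Rightarrow> nat \<Rightarrow> wmat \<Rightarrow> wmat \<Rightarrow> wmat" where
  "wmat_mult r k A B = (\<lambda>\<mu> \<nu>. \<Sum>\<kappa>\<in>P_plus r k. A \<mu> \<kappa> * B \<kappa> \<nu>)"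

definition wmat_eq :: "nat \<Rightarrow> nat \<Rightarrow> wmat \<Rightarrow> wmat \<Rightarrow> bool" where
  "wmat_eq r k A B \<longleftrightarrow> (\<forall>\<mu>\<in>P_plus r k. \<forall>\<nu>\<in>P_plus r k. A \<mu> \<nu> = B \<mu> \<nu>)"

definition vacuum :: "nat \<Rightarrow> wt" where
  "vacuum k = (\<lambda>i. if i = 0 then k else 0)"

definition physical_invariant :: "nat \<Rightarrow> nat \<Rightarrow> wmat \<Rightarrow> bool" where
  "physical_invariant r k M \<longleftrightarrow>
     wmat_eq r k (wmat_mult r k M (S_mat r k)) (wmat_mult r k (S_mat r k) M) \<and>
     wmat_eq r k (wmat_mult r k M (T_mat r k)) (wmat_mult r k (T_mat r k) M) \<and>
     (\<forall>\<mu>\<in>P_plus r k. \<forall>\<nu>\<in>P_plus r k. M \<mu> \<nu> \<in> \<nat>) \<and>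
     M (vacuum k) (vacuum k) = 1"

section \<open>Level 2\<close>

definition simple_current :: "wt \<Rightarrow> wt" where
  "simple_current \<mu> = \<mu>(0 := \<mu> 1, 1 := \<mu> 0)"

definition I_J :: "nat \<Rightarrow> wmat" where
  "I_J r = (\<lambda>\<mu> \<nu>. \<Sum>l\<in>{1..2::nat}.
     (if (simple_current ^^ l) \<mu> = \<nu> then 1 else 0)
     * (if real (\<mu> r) / 2 + real l \<in> \<int> then 1 else 0))"

text \<open>
  \<open>level2_wt r f\<close> is the level-\<open>2\<close> weight with finite labels \<open>f 1, \<dots>, f r\<close>, its label at \<open>0\<close>
  being determined by the level.  It is used only for \<open>f\<close> of level at most \<open>2\<close>, where the
  subtraction does not truncate.
\<close>

definition level2_wt :: "nat \<Rightarrow> (nat \<Rightarrow> nat) \<Rightarrow> wt" where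
  "level2_wt r f = (\<lambda>i.
     if i = 0 then 2 - (f 1 + 2 * (\<Sum>j\<in>{2..<r}. f j) + f r)
     else if i \<le> r then f i else 0)"

definition gamma_wt :: "nat \<Rightarrow> nat \<Rightarrow> wt" where
  "gamma_wt r a = level2_wt r (\<lambda>i. if a = 0 then 0 else if i = a then (if a = r then 2 else 1) else 0)"

definition spinor_wt :: "nat \<Rightarrow> wt" where
  "spinor_wt r = level2_wt r (\<lambda>i. if i = r then 1 else 0)"

definition B_entry :: "nat \<Rightarrow> nat \<Rightarrow> int \<Rightarrow> nat \<Rightarrow> nat \<Rightarrow> complex" where
  "B_entry n d l a b =
     (if d dvd a \<and> d dvd b \<and> a \<noteq> 0 \<and> b \<noteq> 0 then 2
      else if \<not> n dvd d * a
              \<or> \<not> ([int b = int a * l] (mod int d) \<or> [int b = - (int a * l)] (mod int d)) then 0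
      else 1)"

text \<open>
  The index \<open>a \<le> r\<close> of a weight in the \<open>J\<close>-orbit of some \<open>\<gamma>\<^sup>a\<close>.  It is unique for \<open>r \<ge> 3\<close>:
  \<open>J\<close> fixes \<open>\<gamma>\<^sup>a\<close> for \<open>a \<noteq> 0\<close>, so the orbits of distinct \<open>\<gamma>\<^sup>a\<close> are disjoint.
\<close>

definition gamma_index :: "nat \<Rightarrow> wt \<Rightarrow> nat" where
  "gamma_index r \<mu> = (THE a. a \<le> r \<and> (\<exists>i\<in>{0, 1}. \<mu> = (simple_current ^^ i) (gamma_wt r a)))"

definition B_mat :: "nat \<Rightarrow> nat \<Rightarrow> int \<Rightarrow> wmat" where
  "B_mat r d l = (\<lambda>\<mu> \<nu>.
     if \<exists>i\<in>{0, 1}. \<exists>a\<le>r. \<exists>b\<le>r. \<mu> = (simple_current ^^ i) (gamma_wt r a)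
          \<and> \<nu> = (simple_current ^^ i) (gamma_wt r b)
     then B_entry (2 * r + 1) d l (gamma_index r \<mu>) (gamma_index r \<nu>)
     else if \<exists>i\<in>{0, 1}. \<mu> = (simple_current ^^ i) (spinor_wt r)
          \<and> \<nu> = (simple_current ^^ i) (spinor_wt r)
     then 1 else 0)"

definition B2_mat :: "nat \<Rightarrow> nat \<Rightarrow> int \<Rightarrow> nat \<Rightarrow> int \<Rightarrow> wmat" where
  "B2_mat r d\<^sub>1 l\<^sub>1 d\<^sub>2 l\<^sub>2 =
     wmat_mult r 2 (\<lambda>\<mu> \<nu>. (1 / 2) * (B_mat r d\<^sub>1 l\<^sub>1 \<mu> \<nu> + B_mat r d\<^sub>2 l\<^sub>2 \<mu> \<nu>)) (I_J r)"

text \<open>The conditions imposed on the parameters of \<^const>\<open>B_mat\<close>, where \<open>n = 2 r + 1\<close>.\<close>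

definition admissible :: "nat \<Rightarrow> nat \<Rightarrow> int \<Rightarrow> bool" where
  "admissible n d l \<longleftrightarrow> d dvd n \<and> n dvd d\<^sup>2 \<and> 0 \<le> l
     \<and> real_of_int l < (real d)\<^sup>2 / (2 * real n) \<and> [l\<^sup>2 = 1] (mod int (d\<^sup>2 div n))"

definition lambda_r :: "nat \<Rightarrow> wt" where
  "lambda_r r = (if 8 dvd r then spinor_wt r else simple_current (spinor_wt r))"

definition mu_r :: "nat \<Rightarrow> wt" where
  "mu_r r = (if 8 dvd r then simple_current (spinor_wt r) else spinor_wt r)"

definition C_set :: "nat \<Rightarrow> wt set" where
  "C_set r = {gamma_wt r a | a. a \<le> r \<and> gamma_wt r a \<noteq> gamma_wt r 0
     \<and> (\<exists>s. s\<^sup>2 = 2 * r + 1 \<and> s dvd a)}"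

definition B_i :: "nat \<Rightarrow> wmat" where
  "B_i r = (let z = gamma_wt r 0; Jz = simple_current z; la = lambda_r r; mu = mu_r r; C = C_set r in
     (\<lambda>\<mu> \<nu>. if (\<mu>, \<nu>) \<in> {(z, z)} \<union> {z} \<times> C \<union> C \<times> {z} \<union> C \<times> C \<union> {la} \<times> C \<union> C \<times> {la}
                 \<union> {(mu, mu), (la, Jz), (Jz, la)}
       then 1 else 0))"

definition B_ii :: "nat \<Rightarrow> wmat" where
  "B_ii r = (let z = gamma_wt r 0; la = lambda_r r; C = C_set r in
     (\<lambda>\<mu> \<nu>. if (\<mu>, \<nu>) \<in> {(z, z)} \<union> {z} \<times> C \<union> C \<times> {z} \<union> C \<times> C
                 \<union> {(z, la), (la, z), (la, la)} \<union> {la} \<times> C \<union> C \<times> {la}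
       then 1 else 0))"

definition B_iii :: "nat \<Rightarrow> wmat" where
  "B_iii r = wmat_mult r 2 (B_i r) (I_J r)"

definition B_iv :: "nat \<Rightarrow> wmat" where
  "B_iv r = wmat_mult r 2 (I_J r) (B_i r)"

definition family_a :: "nat \<Rightarrow> wmat \<Rightarrow> bool" where
  "family_a r M \<longleftrightarrow> (\<exists>d l. admissible (2 * r + 1) d l \<and> wmat_eq r 2 M (B_mat r d l))"

definition family_b :: "nat \<Rightarrow> wmat \<Rightarrow> bool" where
  "family_b r M \<longleftrightarrow> (\<exists>d\<^sub>1 l\<^sub>1 d\<^sub>2 l\<^sub>2. admissible (2 * r + 1) d\<^sub>1 l\<^sub>1 \<and> admissible (2 * r + 1) d\<^sub>2 l\<^sub>2
     \<and> wmat_eq r 2 M (B2_mat r d\<^sub>1 l\<^sub>1 d\<^sub>2 l\<^sub>2))"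

end

theory Submission
  imports Defs
begin

text \<open>
  The level \<open>2\<close> weights are \<open>0\<close>, \<open>J0\<close>, the \<open>\<gamma>\<^sup>a\<close> with \<open>1 \<le> a \<le> r\<close> and two spinors.  Up to a scalar
  \<open>S\<close> is the cosine transform \<open>cos (2 \<pi> a b / n)\<close> on the nonspinors, and the spinors have entries
  \<open>\<plusminus>\<surd>n\<close> with each other and with \<open>0\<close>, \<open>J0\<close>, and \<open>0\<close> with the \<open>\<gamma>\<^sup>a\<close>.
  Identifying \<open>\<gamma>\<^sup>a\<close> with \<open>\<plusminus>a\<close> and adding the rows and columns of \<open>0\<close> and \<open>J0\<close> turns a physical
  invariant into an even kernel on \<open>\<int> / n\<close> that commutes with the discrete Fourier transform and is
  supported on \<open>x\<^sup>2 \<equiv> y\<^sup>2\<close>.  In the coordinates \<open>x - y\<close>, \<open>x + y\<close>, and after a partial Fourier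
  transform, such kernels are the functions on \<open>(\<int> / n)\<^sup>2\<close> invariant under \<open>SL\<^sub>2\<close>; hence they are
  combinations of the indicators of \<open>g | x - y\<close>, \<open>n / g | x + y\<close> for \<open>g | n\<close>.  As the total
  coefficient is at most \<open>4\<close>, only one or two pairs \<open>{g, n / g}\<close> occur, which gives the two
  families, unless a spinor has the same \<open>T\<close>-eigenvalue as a nonspinor.  That spinor then
  carries an eigenvector of the Fourier transform supported on \<open>x\<^sup>2 \<equiv> 0\<close>; it forces \<open>n\<close> to be a
  square, and the remaining freedom is a system of equations in natural numbers whose solutions
  are the exceptional matrices.
\<close>

section \<open>The Weyl group as signed permutations\<close>

text \<open>The scalar factors of \<open>S\<close> cancel from M S = S M once they are nonzero; for
  the lattice index this means that the quotient is finite. What does not cancel is the sign of the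
  spinor entries relative to the others: orthogonality determines the determinants only up to sign,
  so their positivity has to be proved separately, by polynomials of Chebyshev type. Two facts shape
  the rest. As n is odd, 2 is invertible modulo n, so x - y and x + y are coordinates. And
  commutation with \<open>T\<close> enters only through equality of eigenvalues: between nonspinors
  this is the support condition, which acts as the shear in SL2, while the Fourier transform acts as
  the rotation of order 4; Euclid's algorithm then reduces a pair to its gcd. The bound 4 arises
  because the total coefficient is the sum of the four entries over 0 and J0, which the entry 1 at
  the vacuum and the column and row of the isolated spinor restrict to finitely many values. For the
  converse, every listed matrix is a sum of pieces that commute with \<open>S\<close> one by
  one.\<close>

definition spm :: "nat \<Rightarrow> (nat \<Rightarrow> nat) \<Rightarrow> (nat \<Rightarrow> real) \<Rightarrow> real mat" where
  "spm r p e = mat r r (\<lambda>(i, j). if j = p i then e i else 0)"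

lemma spm_carrier [simp]: "spm r p e \<in> carrier_mat r r"
  by (simp add: spm_def)

lemma spm_cong: "(\<And>i. i < r \<Longrightarrow> p i = q i) \<Longrightarrow> (\<And>i. i < r \<Longrightarrow> e i = f i) \<Longrightarrow> spm r p e = spm r q f"
  by (auto simp: spm_def intro!: eq_matI)

text \<open>Row \<open>i\<close> has its entry in column \<open>p i\<close>, so a product runs
  through \<open>p\<close> before \<open>q\<close>, and the second sign is read at
  \<open>p i\<close>.\<close>

lemma spm_mult:
  assumes "p permutes {0..<r}"
  shows "spm r p e * spm r q f = spm r (q \<circ> p) (\<lambda>i. e i * f (p i))"
proof (rule eq_matI)
  fix i k assume "i < dim_row (spm r (q \<circ> p) (\<lambda>i. e i * f (p i)))" "k < dim_col (spm r (q \<circ> p) (\<lambda>i. e i * f (p i)))"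
  then have ik: "i < r" "k < r" by (auto simp: spm_def)
  then have pi: "p i < r" using assms permutes_in_image[OF assms, of i] by auto
  have "(spm r p e * spm r q f) $$ (i, k)
      = (\<Sum>j = 0..<r. (if j = p i then e i else 0) * (if k = q j then f j else 0))"
    using ik by (simp add: spm_def scalar_prod_def)
  also have "\<dots> = (\<Sum>j = 0..<r. if j = p i then e i * (if k = q (p i) then f (p i) else 0) else 0)"
    by (rule sum.cong) auto
  also have "\<dots> = e i * (if k = q (p i) then f (p i) else 0)" using pi by simp
  finally show "(spm r p e * spm r q f) $$ (i, k) = spm r (q \<circ> p) (\<lambda>i. e i * f (p i)) $$ (i, k)"
    using ik by (auto simp: spm_def)
qed (auto simp: spm_def)

lemma spm_id: "spm r id (\<lambda>_. 1) = 1\<^sub>m r"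
  by (auto simp: spm_def intro!: eq_matI)

lemma reflection_short:
  assumes "i < r"
  shows "reflection r (unit_vec r i) = spm r id (\<lambda>k. if k = i then -1 else 1)"
proof -
  have "coroot (unit_vec r i) = 2 \<cdot>\<^sub>v unit_vec r i"
    using assms by (simp add: coroot_def)
  then show ?thesis
    using assms by (auto simp: reflection_def spm_def unit_vec_def intro!: eq_matI)
qed

lemma long_root_scalar:
  assumes "i < j" "j < r" and c: "c = 1 \<or> c = -1"
  shows "(unit_vec r i + c \<cdot>\<^sub>v unit_vec r j) \<bullet> (unit_vec r i + c \<cdot>\<^sub>v unit_vec r j :: real vec) = 2"
proof -
  have "(unit_vec r i + c \<cdot>\<^sub>v unit_vec r j) \<bullet> (unit_vec r i + c \<cdot>\<^sub>v unit_vec r j :: real vec)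
     = (\<Sum>k = 0..<r. (if k = i then 1 else 0) + (if k = j then 1 else 0))"
    unfolding scalar_prod_def using assms by (auto simp: unit_vec_def intro!: sum.cong)
  also have "\<dots> = 2" using assms by (simp add: sum.distrib)
  finally show ?thesis .
qed

lemma unit_vec_minus: "unit_vec r i - unit_vec r j = unit_vec r i + (-1) \<cdot>\<^sub>v (unit_vec r j :: real vec)"
  and unit_vec_plus: "unit_vec r i + unit_vec r j = unit_vec r i + 1 \<cdot>\<^sub>v (unit_vec r j :: real vec)"
  by auto

lemma reflection_long:
  assumes "i < j" "j < r" and c: "c = 1 \<or> c = -1"
  shows "reflection r (unit_vec r i + c \<cdot>\<^sub>v unit_vec r j)
    = spm r (Transposition.transpose i j) (\<lambda>k. if k = i \<or> k = j then - c else 1)"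
proof -
  have "coroot (unit_vec r i + c \<cdot>\<^sub>v unit_vec r j) = unit_vec r i + c \<cdot>\<^sub>v unit_vec r j"
    unfolding coroot_def using long_root_scalar[OF assms] by simp
  then show ?thesis
    using assms
    by (auto simp: reflection_def spm_def unit_vec_def Transposition.transpose_def intro!: eq_matI)
qed

lemma pos_roots_cases:
  assumes "\<alpha> \<in> pos_roots r"
  obtains i where "i < r" "\<alpha> = unit_vec r i"
    | i j c where "i < j" "j < r" "c = 1 \<or> c = -1" "\<alpha> = unit_vec r i + c \<cdot>\<^sub>v unit_vec r j"
  using assms unfolding pos_roots_def unit_vec_minus unit_vec_plus by blast

definition spms :: "nat \<Rightarrow> real mat set" where
  "spms r = {spm r p e | p e. p permutes {0..<r} \<and> (\<forall>i<r. e i = 1 \<or> e i = -1)}"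

lemma spms_I: "p permutes {0..<r} \<Longrightarrow> (\<And>i. i < r \<Longrightarrow> e i = 1 \<or> e i = -1) \<Longrightarrow> spm r p e \<in> spms r"
  by (auto simp: spms_def)

lemma spms_mult: "A \<in> spms r \<Longrightarrow> B \<in> spms r \<Longrightarrow> A * B \<in> spms r"
proof -
  assume "A \<in> spms r" "B \<in> spms r"
  then obtain p e q f where A: "A = spm r p e" "p permutes {0..<r}" "\<forall>i<r. e i = 1 \<or> e i = -1"
    and B: "B = spm r q f" "q permutes {0..<r}" "\<forall>i<r. f i = 1 \<or> f i = -1"
    by (auto simp: spms_def)
  show ?thesis
    unfolding A(1) B(1) spm_mult[OF A(2)]
  proof (rule spms_I)
    show "q \<circ> p permutes {0..<r}" using A B by (simp add: permutes_compose)
    fix i assume i: "i < r"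
    then have "p i < r" using permutes_in_image[OF A(2), of i] by auto
    then show "e i * f (p i) = 1 \<or> e i * f (p i) = -1" using A(3) B(3) i by fastforce
  qed
qed

lemma reflection_spms: "\<alpha> \<in> pos_roots r \<Longrightarrow> reflection r \<alpha> \<in> spms r"
  by (erule pos_roots_cases)
     (auto simp: reflection_short reflection_long intro!: spms_I permutes_id permutes_swap_id)

lemma reflection_square: "\<alpha> \<in> pos_roots r \<Longrightarrow> reflection r \<alpha> * reflection r \<alpha> = 1\<^sub>m r"
proof (erule pos_roots_cases)
  fix i assume "i < r" "\<alpha> = unit_vec r i"
  then show ?thesis
    by (simp add: reflection_short spm_mult permutes_id spm_id[symmetric] cong: if_cong)
       (rule spm_cong; simp)
next
  fix i j c assume *: "i < j" "j < r" "c = (1::real) \<or> c = -1" "\<alpha> = unit_vec r i + c \<cdot>\<^sub>v unit_vec r j"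
  then have "Transposition.transpose i j permutes {0..<r}" by (intro permutes_swap_id) auto
  with * show ?thesis
    by (simp add: reflection_long spm_mult spm_id[symmetric])
       (rule spm_cong; auto simp: Transposition.transpose_def)
qed

abbreviation mat_units :: "nat \<Rightarrow> real mat monoid" where
  "mat_units r \<equiv> units_of (ring_mat TYPE(real) r ())"

lemma mat_units_group: "group (mat_units r)"
  by (intro monoid.units_group ring.is_monoid ring_mat)

lemma mat_units_simps [simp]:
  "mult (mat_units r) = (*)" "one (mat_units r) = 1\<^sub>m r"
  by (simp_all add: units_of_def ring_mat_simps)

lemma reflection_unit: "\<alpha> \<in> pos_roots r \<Longrightarrow> reflection r \<alpha> \<in> carrier (mat_units r)"
proof -
  assume "\<alpha> \<in> pos_roots r"
  moreover have "reflection r \<alpha> \<in> carrier_mat r r" by (auto simp: reflection_def)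
  ultimately show ?thesis
    using reflection_square[of \<alpha> r]
    by (auto simp: units_of_def Units_def ring_mat_simps)
qed

text \<open>\<open>generate\<close> also adjoins the inverses of the generators; since reflections
  are involutions, that case of the induction is again a reflection.\<close>

lemma reflection_inv: "\<alpha> \<in> pos_roots r \<Longrightarrow> m_inv (mat_units r) (reflection r \<alpha>) = reflection r \<alpha>"
  using group.inv_equality[OF mat_units_group, of r "reflection r \<alpha>" "reflection r \<alpha>"]
    reflection_square[of \<alpha> r] reflection_unit[of \<alpha> r] by simp

lemma weyl_sub: "weyl_group r \<subseteq> spms r"
proof
  fix x assume "x \<in> weyl_group r"
  then show "x \<in> spms r"
    unfolding weyl_group_def
  proof (induction rule: generate.induct)
    case one
    then show ?case by (auto simp: spm_id[symmetric] permutes_id intro!: spms_I)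
  next
    case (incl h)
    then show ?case by (auto intro: reflection_spms)
  next
    case (inv h)
    then show ?case by (auto simp: reflection_inv intro: reflection_spms)
  next
    case (eng h1 h2)
    then show ?case by (simp add: spms_mult)
  qed
qed

lemma weyl_mult: "A \<in> weyl_group r \<Longrightarrow> B \<in> weyl_group r \<Longrightarrow> A * B \<in> weyl_group r"
  using generate.eng[of A "mat_units r" _ B] unfolding weyl_group_def by simp

lemma weyl_one: "1\<^sub>m r \<in> weyl_group r"
  using generate.one[of "mat_units r"] unfolding weyl_group_def by simp

lemma weyl_refl: "\<alpha> \<in> pos_roots r \<Longrightarrow> reflection r \<alpha> \<in> weyl_group r"
  unfolding weyl_group_def by (auto intro: generate.incl)

text \<open>The bound \<open>k\<close> on the positions of the minus signs drives the induction: the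
  reflection in the short root \<open>unit_vec r k\<close> removes a sign at position
  \<open>k\<close>.\<close>

lemma weyl_sign: 
  assumes "\<forall>i<r. e i = (1::real) \<or> e i = -1" "\<forall>i<r. i \<ge> k \<longrightarrow> e i = 1"
  shows "spm r id e \<in> weyl_group r"
  using assms
proof (induction k arbitrary: e)
  case 0
  then have "spm r id e = spm r id (\<lambda>_. 1)" by (intro spm_cong) auto
  then show ?case using weyl_one[of r] by (metis spm_id)
next
  case (Suc k)
  show ?case
  proof (cases "k < r \<and> e k = -1")
    case False
    then have "\<forall>i<r. i \<ge> k \<longrightarrow> e i = 1" using Suc.prems by (metis le_antisym not_less_eq_eq)
    then show ?thesis using Suc by blast
  next
    case True
    have "spm r id (e(k := 1)) \<in> weyl_group r"
      using Suc.prems by (intro Suc.IH) auto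
    moreover have "spm r id (\<lambda>i. if i = k then -1 else 1) \<in> weyl_group r"
      using True weyl_refl[of "unit_vec r k" r] by (auto simp: reflection_short pos_roots_def)
    ultimately have "spm r id (e(k := 1)) * spm r id (\<lambda>i. if i = k then -1 else 1) \<in> weyl_group r"
      by (rule weyl_mult)
    also have "spm r id (e(k := 1)) * spm r id (\<lambda>i. if i = k then -1 else 1) = spm r id e"
      using True by (subst spm_mult) (auto intro!: spm_cong permutes_id)
    finally show ?thesis .
  qed
qed

lemma weyl_transp:
  assumes "i < r" "j < r"
  shows "spm r (Transposition.transpose i j) (\<lambda>_. 1) \<in> weyl_group r"
proof -
  have *: "spm r (Transposition.transpose i j) (\<lambda>_. 1) \<in> weyl_group r" if "i < j" "j < r" for i j
  proof -
    have "reflection r (unit_vec r i - unit_vec r j) \<in> weyl_group r"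
      using that by (intro weyl_refl) (auto simp: pos_roots_def)
    then show ?thesis using that by (simp add: unit_vec_minus reflection_long cong: if_cong)
  qed
  consider "i < j" | "i = j" | "j < i" by linarith
  then show ?thesis
  proof cases
    case 2
    then have "spm r (Transposition.transpose i j) (\<lambda>_. 1) = 1\<^sub>m r"
      unfolding spm_id[symmetric] by (intro spm_cong) auto
    then show ?thesis using weyl_one[of r] by simp
  qed (use * [of i j] *[of j i] assms in \<open>simp_all add: transpose_commute[of i j]\<close>)
qed

lemma weyl_perm:
  assumes "p permutes {0..<r}"
  shows "spm r p (\<lambda>_. 1) \<in> weyl_group r"
  using assms finite_atLeastLessThan[of 0 r]
proof (induction rule: permutes_induct)
  case id
  then show ?case using weyl_one[of r] by (metis spm_id)
next
  case (swap a b p)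
  have "spm r p (\<lambda>_. 1) * spm r (Transposition.transpose a b) (\<lambda>_. 1) \<in> weyl_group r"
    using swap by (intro weyl_mult weyl_transp) auto
  moreover have "spm r p (\<lambda>_. 1) * spm r (Transposition.transpose a b) (\<lambda>_. 1)
      = spm r (Transposition.transpose a b \<circ> p) (\<lambda>_. 1)"
    using swap(4) by (simp only: spm_mult mult_1)
  ultimately show ?case by (simp only:)
qed

text \<open>A signed permutation is a sign matrix, generated by the short root reflections, times a
  permutation matrix, generated by the reflections in differences of two basis vectors.\<close>

lemma weyl_group_eq: "weyl_group r = spms r"
proof (rule equalityI[OF weyl_sub], rule subsetI)
  fix x assume "x \<in> spms r"
  then obtain p e where x: "x = spm r p e" "p permutes {0..<r}" "\<forall>i<r. e i = 1 \<or> e i = -1"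
    by (auto simp: spms_def)
  have "spm r id e * spm r p (\<lambda>_. 1) \<in> weyl_group r"
    using x by (intro weyl_mult weyl_sign[of r e r] weyl_perm) auto
  then show "x \<in> weyl_group r" by (simp add: spm_mult permutes_id x)
qed

lemma det_spm:
  assumes "p permutes {0..<r}"
  shows "det (spm r p e) = of_int (sign p) * (\<Prod>i = 0..<r. e i)"
proof -
  have "det (spm r p e) = (\<Sum>q | q permutes {0..<r}.
      of_int (sign q) * (\<Prod>i = 0..<r. spm r p e $$ (i, q i)))"
    by (rule det_def'[OF spm_carrier])
  also have "\<dots> = (\<Sum>q | q permutes {0..<r}.
      if q = p then of_int (sign p) * (\<Prod>i = 0..<r. e i) else 0)"
  proof (rule sum.cong[OF refl])
    fix q assume "q \<in> {q. q permutes {0..<r}}"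
    then have q: "q permutes {0..<r}" by simp
    show "of_int (sign q) * (\<Prod>i = 0..<r. spm r p e $$ (i, q i))
      = (if q = p then of_int (sign p) * (\<Prod>i = 0..<r. e i) else 0)"
    proof (cases "q = p")
      case True
      have "spm r p e $$ (i, p i) = e i" if "i \<in> {0..<r}" for i
        using that permutes_in_image[OF assms, of i] by (auto simp: spm_def)
      then show ?thesis using True by simp
    next
      case False
      then obtain i where i: "q i \<noteq> p i" by auto
      then have "i \<in> {0..<r}" using q assms by (metis permutes_not_in)
      moreover from this have "spm r p e $$ (i, q i) = 0"
        using i permutes_in_image[OF q, of i] by (auto simp: spm_def)
      ultimately have "(\<Prod>i = 0..<r. spm r p e $$ (i, q i)) = 0" by (intro prod_zero) auto
      then show ?thesis using False by simp
    qed
  qed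
  also have "\<dots> = of_int (sign p) * (\<Prod>i = 0..<r. e i)"
    using assms by (simp add: finite_permutations)
  finally show ?thesis .
qed

lemma spm_form:
  assumes p: "p permutes {0..<r}" and u: "u \<in> carrier_vec r" and v: "v \<in> carrier_vec r"
  shows "(spm r p e *\<^sub>v v) \<bullet> u = (\<Sum>i = 0..<r. e i * v $ p i * u $ i)"
proof -
  have "(spm r p e *\<^sub>v v) $ i = e i * v $ p i" if i: "i < r" for i
  proof -
    have pi: "p i < r" using permutes_in_image[OF p, of i] i by auto
    have "(spm r p e *\<^sub>v v) $ i = (\<Sum>j = 0..<r. (if j = p i then e i else 0) * v $ j)"
      using i v by (simp add: spm_def scalar_prod_def)
    also have "\<dots> = (\<Sum>j = 0..<r. if j = p i then e i * v $ p i else 0)"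
      by (rule sum.cong) auto
    finally show ?thesis using pi by simp
  qed
  then show ?thesis using u by (simp add: scalar_prod_def)
qed

text \<open>Extensional sign functions make the representation unique, so a sum over the Weyl group
  becomes a sum over permutations and independent signs.\<close>

lemma spms_bij:
  "bij_betw (\<lambda>(p, e). spm r p e)
     ({p. p permutes {0..<r}} \<times> PiE {0..<r} (\<lambda>_. {1, -1})) (spms r)"
  unfolding bij_betw_def
proof
  show "inj_on (\<lambda>(p, e). spm r p e) ({p. p permutes {0..<r}} \<times> PiE {0..<r} (\<lambda>_. {1, -1}))"
  proof (rule inj_onI, clarify)
    fix p q :: "nat \<Rightarrow> nat" and e f :: "nat \<Rightarrow> real"
    assume p: "p permutes {0..<r}" and q: "q permutes {0..<r}"
      and e: "e \<in> PiE {0..<r} (\<lambda>_. {1, -1})" and f: "f \<in> PiE {0..<r} (\<lambda>_. {1, -1})"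
      and eq: "spm r p e = spm r q f"
    have *: "p i = q i \<and> e i = f i" if "i < r" for i
    proof -
      have pi: "p i < r" using permutes_in_image[OF p, of i] that by auto
      have "spm r p e $$ (i, p i) = spm r q f $$ (i, p i)" using eq by simp
      then have "e i = (if p i = q i then f i else 0)" using that pi by (simp add: spm_def)
      moreover have "e i \<noteq> 0" using e that by (force simp: PiE_iff)
      ultimately show ?thesis by (auto split: if_splits)
    qed
    have "p = q"
    proof
      fix i show "p i = q i" using * [of i] p q by (cases "i < r") (auto simp: permutes_def)
    qed
    moreover have "e = f" using * e f by (intro PiE_ext[OF e f]) auto
    ultimately show "p = q \<and> e = f" by simp
  qed
  show "(\<lambda>(p, e). spm r p e) ` ({p. p permutes {0..<r}} \<times> PiE {0..<r} (\<lambda>_. {1, -1})) = spms r"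
  proof (intro equalityI subsetI)
    fix x assume "x \<in> spms r"
    then obtain p e where x: "x = spm r p e" "p permutes {0..<r}" "\<forall>i<r. e i = 1 \<or> e i = -1"
      by (auto simp: spms_def)
    have "x = spm r p (restrict e {0..<r})" unfolding x(1) by (rule spm_cong) auto
    moreover have "restrict e {0..<r} \<in> PiE {0..<r} (\<lambda>_. {1, -1})" using x(3) by auto
    ultimately show "x \<in> (\<lambda>(p, e). spm r p e) ` ({p. p permutes {0..<r}} \<times> PiE {0..<r} (\<lambda>_. {1, -1}))"
      using x(2) by (intro image_eqI[of _ _ "(p, restrict e {0..<r})"]) auto
  qed (auto intro!: spms_I simp: PiE_iff)
qed

text \<open>Summing over the sign changes turns each exponential into a sine; the remaining sum over the
  permutations is a Leibniz formula.\<close>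

lemma weyl_sum:
  assumes u: "u \<in> carrier_vec r" and v: "v \<in> carrier_vec r"
  shows "(\<Sum>w\<in>weyl_group r. complex_of_real (det w)
            * exp (- (2 * complex_of_real pi * \<i> / of_nat n) * complex_of_real ((w *\<^sub>v v) \<bullet> u)))
    = (-2 * \<i>) ^ r * complex_of_real (det (mat r r (\<lambda>(i, j). sin (2 * pi * u $ i * v $ j / real n))))"
    (is "?L = _ * complex_of_real (det ?A)")
proof -
  let ?P = "{p. p permutes {0..<r}}" and ?E = "PiE {0..<r} (\<lambda>_. {1, -1::real})"
  define c where "c = - (2 * complex_of_real pi * \<i> / of_nat n)"
  define f where "f p i e = complex_of_real e * exp (c * complex_of_real (e * v $ p i * u $ i))"
    for p :: "nat \<Rightarrow> nat" and i and e :: real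
  have f: "f p i 1 + f p i (-1) = (-2 * \<i>) * complex_of_real (sin (2 * pi * u $ i * v $ p i / real n))" for p i
  proof -
    have "f p i 1 + f p i (-1) = cis (- (2 * pi * u $ i * v $ p i / real n)) - cis (2 * pi * u $ i * v $ p i / real n)"
      by (simp add: f_def c_def cis_conv_exp mult_ac)
    also have "\<dots> = (-2 * \<i>) * complex_of_real (sin (2 * pi * u $ i * v $ p i / real n))"
      by (simp add: complex_eq_iff)
    finally show ?thesis .
  qed
  have "?L = (\<Sum>(p, e)\<in>?P \<times> ?E. complex_of_real (det (spm r p e)) * exp (c * complex_of_real ((spm r p e *\<^sub>v v) \<bullet> u)))"
    unfolding weyl_group_eq c_def[symmetric]
    by (subst sum.reindex_bij_betw[OF spms_bij, symmetric]) (simp add: case_prod_unfold)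
  also have "\<dots> = (\<Sum>(p, e)\<in>?P \<times> ?E. of_int (sign p) * (\<Prod>i = 0..<r. f p i (e i)))"
  proof (rule sum.cong[OF refl], clarify)
    fix p :: "nat \<Rightarrow> nat" and e :: "nat \<Rightarrow> real" assume p: "p permutes {0..<r}"
    show "complex_of_real (det (spm r p e)) * exp (c * complex_of_real ((spm r p e *\<^sub>v v) \<bullet> u))
       = of_int (sign p) * (\<Prod>i = 0..<r. f p i (e i))"
      using p u v by (simp add: det_spm spm_form f_def prod.distrib exp_sum sum_distrib_left)
  qed
  also have "\<dots> = (\<Sum>p\<in>?P. of_int (sign p) * (\<Sum>e\<in>?E. \<Prod>i = 0..<r. f p i (e i)))"
    by (simp add: sum.cartesian_product[symmetric] sum_distrib_left)
  also have "\<dots> = (\<Sum>p\<in>?P. of_int (sign p) * (\<Prod>i = 0..<r. \<Sum>e\<in>{1, -1}. f p i e))"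
    by (subst prod_sum_PiE) auto
  also have "\<dots> = (\<Sum>p\<in>?P. of_int (sign p) * (\<Prod>i = 0..<r. (-2 * \<i>) * complex_of_real (sin (2 * pi * u $ i * v $ p i / real n))))"
    using f by simp
  also have "\<dots> = (-2 * \<i>) ^ r * (\<Sum>p\<in>?P. of_int (sign p) * (\<Prod>i = 0..<r. complex_of_real (sin (2 * pi * u $ i * v $ p i / real n))))"
    unfolding prod.distrib prod_constant sum_distrib_left
    by (rule sum.cong[OF refl]) (simp only: card_atLeastLessThan minus_nat.diff_0 mult.left_commute power_mult_distrib)
  also have "(\<Sum>p\<in>?P. of_int (sign p) * (\<Prod>i = 0..<r. complex_of_real (sin (2 * pi * u $ i * v $ p i / real n))))
      = complex_of_real (det ?A)"
  proof -
    have "det ?A = (\<Sum>p\<in>?P. of_int (sign p) * (\<Prod>i = 0..<r. ?A $$ (i, p i)))"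
      by (rule det_def') simp
    also have "\<dots> = (\<Sum>p\<in>?P. of_int (sign p) * (\<Prod>i = 0..<r. sin (2 * pi * u $ i * v $ p i / real n)))"
    proof (intro sum.cong arg_cong2[where f = "(*)"] prod.cong refl)
      fix p i assume "p \<in> ?P" "i \<in> {0..<r}"
      then show "?A $$ (i, p i) = sin (2 * pi * u $ i * v $ p i / real n)"
        using permutes_in_image[of p "{0..<r}" i] by auto
    qed
    finally show ?thesis by simp
  qed
  finally show ?thesis .
qed

section \<open>The index of the coroot lattice\<close>

abbreviation vec_group :: "nat \<Rightarrow> real vec monoid" where
  "vec_group r \<equiv> monoid_vec TYPE(real) r"

lemma vec_group_group: "group (vec_group r)"
  using comm_group_vec[where 'a = real] by (rule comm_group.axioms(2))

lemma vec_group_inv: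
  assumes "v \<in> carrier_vec r"
  shows "m_inv (vec_group r) v = - v"
  using assms
  by (intro group.inv_equality[OF vec_group_group]) (auto simp: monoid_vec_simps)

lemma fund_wt_carrier [simp]: "fund_wt r i \<in> carrier_vec r"
  by (simp add: fund_wt_def)

lemma weight_lattice_half_integral:
  assumes "v \<in> weight_lattice r"
  shows "v \<in> carrier_vec r \<and> (\<forall>i<r. 2 * v $ i \<in> \<int>)"
  using assms unfolding weight_lattice_def
proof (induction rule: generate.induct)
  case (inv h)
  then have "h \<in> carrier_vec r" by auto
  moreover have "\<forall>i<r. 2 * h $ i \<in> \<int>" using inv by (auto simp: fund_wt_def)
  ultimately show ?case by (simp add: vec_group_inv)
next
  case (eng h1 h2)
  then show ?case by (auto simp: monoid_vec_simps distrib_left)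
qed (auto simp: monoid_vec_simps fund_wt_def)

lemma pos_roots_carrier: "pos_roots r \<subseteq> carrier_vec r"
  by (auto simp: pos_roots_def)

lemma coroot_lattice_subgroup: "subgroup (coroot_lattice r) (vec_group r)"
  unfolding coroot_lattice_def
  using pos_roots_carrier[of r]
  by (intro group.generate_is_subgroup vec_group_group) (auto simp: monoid_vec_simps coroot_def)

lemma coroot_lattice_add: "v \<in> coroot_lattice r \<Longrightarrow> w \<in> coroot_lattice r \<Longrightarrow> v + w \<in> coroot_lattice r"
  using subgroup.m_closed[OF coroot_lattice_subgroup, of v r w] by (simp add: monoid_vec_simps)

lemma coroot_lattice_uminus: "v \<in> coroot_lattice r \<Longrightarrow> - v \<in> coroot_lattice r"
  using subgroup.m_inv_closed[OF coroot_lattice_subgroup, of v r]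
    subgroup.mem_carrier[OF coroot_lattice_subgroup, of v r]
  by (simp add: monoid_vec_simps vec_group_inv)

lemma coroot_lattice_zero: "0\<^sub>v r \<in> coroot_lattice r"
  using subgroup.one_closed[OF coroot_lattice_subgroup, of r] by (simp add: monoid_vec_simps)

lemma coroot_lattice_unit:
  assumes "i < r"
  shows "(2 * real_of_int m) \<cdot>\<^sub>v unit_vec r i \<in> coroot_lattice r"
proof -
  have "coroot (unit_vec r i) = 2 \<cdot>\<^sub>v unit_vec r i" using assms by (simp add: coroot_def)
  moreover have "coroot (unit_vec r i) \<in> coroot_lattice r"
    unfolding coroot_lattice_def using assms by (intro generate.incl) (auto simp: pos_roots_def)
  ultimately have g: "2 \<cdot>\<^sub>v unit_vec r i \<in> coroot_lattice r" by simp
  have nat: "(2 * real k) \<cdot>\<^sub>v unit_vec r i \<in> coroot_lattice r" for k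
  proof (induction k)
    case 0
    have "(2 * real 0) \<cdot>\<^sub>v unit_vec r i = 0\<^sub>v r" by auto
    then show ?case by (simp only: coroot_lattice_zero)
  next
    case (Suc k)
    have "(2 * real (Suc k)) \<cdot>\<^sub>v unit_vec r i = (2 * real k) \<cdot>\<^sub>v unit_vec r i + 2 \<cdot>\<^sub>v unit_vec r i"
      by (auto simp: algebra_simps)
    then show ?case using coroot_lattice_add[OF Suc g] by simp
  qed
  show ?thesis
  proof (cases "m \<ge> 0")
    case True
    then show ?thesis using nat[of "nat m"] by simp
  next
    case False
    have "(2 * real_of_int m) \<cdot>\<^sub>v unit_vec r i = - ((2 * real (nat (- m))) \<cdot>\<^sub>v unit_vec r i)"
      using False by auto
    then show ?thesis using coroot_lattice_uminus[OF nat[of "nat (- m)"]] by simp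
  qed
qed

text \<open>The coroot of a short root is twice a basis vector, so even multiples of basis vectors
  can be split off one coordinate at a time; \<open>k\<close> bounds the support.\<close>

lemma even_vec_in_coroot_lattice:
  assumes "v \<in> carrier_vec r" "\<forall>i<r. \<exists>m. v $ i = 2 * real_of_int m" "\<forall>i<r. k \<le> i \<longrightarrow> v $ i = 0"
  shows "v \<in> coroot_lattice r"
  using assms
proof (induction k arbitrary: v)
  case 0
  then have "v = 0\<^sub>v r" by auto
  then show ?case by (simp add: coroot_lattice_zero)
next
  case (Suc k)
  show ?case
  proof (cases "k < r")
    case False
    with Suc show ?thesis by auto
  next
    case True
    then obtain m where m: "v $ k = 2 * real_of_int m" using Suc by auto
    let ?w = "vec r (\<lambda>i. if i = k then 0 else v $ i)"
    have "\<forall>i<r. \<exists>m. ?w $ i = 2 * real_of_int m" using Suc.prems(2)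
      by (auto intro: exI[of _ 0])
    then have "?w \<in> coroot_lattice r"
      using Suc.prems by (intro Suc.IH) auto
    then have "?w + (2 * real_of_int m) \<cdot>\<^sub>v unit_vec r k \<in> coroot_lattice r"
      by (rule coroot_lattice_add[OF _ coroot_lattice_unit[OF True]])
    moreover have "?w + (2 * real_of_int m) \<cdot>\<^sub>v unit_vec r k = v"
      using Suc.prems True m by (auto intro!: eq_vecI)
    ultimately show ?thesis by (simp only:)
  qed
qed

text \<open>Positivity is finiteness here, since an infinite quotient would have order 0. Weights
  have half-integral coordinates and the coroot lattice contains all even vectors, so a coset is
  determined by the doubled coordinates modulo 4.\<close>

lemma P_mod_Q_order_pos: "P_mod_Q_order r > 0"
proof -
  define G where "G = (vec_group r)\<lparr>carrier := weight_lattice r\<rparr>"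
  define C where "C a = {h + a | h. h \<in> coroot_lattice r}" for a
  have car: "carrier (G Mod coroot_lattice r) = C ` weight_lattice r"
    by (auto simp: G_def FactGroup_def RCOSETS_def r_coset_def monoid_vec_simps C_def)
  define f where "f a = restrict (\<lambda>i. \<lfloor>2 * a $ i\<rfloor> mod 4) {0..<r}" for a :: "real vec"
  have sub: "C a \<subseteq> C b" if a: "a \<in> weight_lattice r" and b: "b \<in> weight_lattice r" and f: "f a = f b" for a b
  proof
    fix x assume "x \<in> C a"
    then obtain h where h: "x = h + a" "h \<in> coroot_lattice r" by (auto simp: C_def)
    have ca: "a \<in> carrier_vec r" "b \<in> carrier_vec r" "h \<in> carrier_vec r"
      using weight_lattice_half_integral a b subgroup.mem_carrier[OF coroot_lattice_subgroup h(2)]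
      by (auto simp: monoid_vec_simps)
    have "\<exists>m. (a - b) $ i = 2 * real_of_int m" if i: "i < r" for i
    proof -
      obtain p q where pq: "2 * a $ i = of_int p" "2 * b $ i = of_int q"
        using weight_lattice_half_integral[OF a] weight_lattice_half_integral[OF b] i
        by (meson Ints_cases)
      have "p mod 4 = q mod 4" using fun_cong[OF f, of i] i by (simp add: f_def pq)
      then have "4 dvd p - q" by (simp add: mod_eq_dvd_iff)
      then obtain m where m: "p - q = 4 * m" ..
      have "2 * a $ i - 2 * b $ i = of_int (p - q)" unfolding pq by simp
      then have "a $ i - b $ i = 2 * of_int m" unfolding m by simp
      then show ?thesis using i ca by (auto intro!: exI[of _ m])
    qed
    then have "a - b \<in> coroot_lattice r"
      using ca by (intro even_vec_in_coroot_lattice[of _ _ r]) auto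
    then have "h + (a - b) \<in> coroot_lattice r" using h coroot_lattice_add by blast
    moreover have "x = h + (a - b) + b" using ca h by auto
    ultimately show "x \<in> C b" by (auto simp: C_def)
  qed
  have "f ` weight_lattice r \<subseteq> PiE {0..<r} (\<lambda>_. {0..<4})" by (auto simp: f_def)
  then have fin: "finite (f ` weight_lattice r)"
    by (rule finite_subset) (auto intro!: finite_PiE)
  \<comment> \<open>All cosets with residues \<open>y\<close> coincide, so their union recovers the
    coset from \<open>f a\<close>, and the set of cosets is the image of a finite set.\<close>
  define g where "g y = (\<Union>b\<in>{b \<in> weight_lattice r. f b = y}. C b)" for y
  have "g (f a) = C a" if "a \<in> weight_lattice r" for a
    unfolding g_def using sub that by blast
  then have "C ` weight_lattice r = g ` f ` weight_lattice r"
    unfolding image_image by (intro image_cong) simp_all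
  then have "finite (C ` weight_lattice r)" using fin by simp
  moreover have "weight_lattice r \<noteq> {}"
    using generate.one[of "vec_group r"] unfolding weight_lattice_def by blast
  ultimately have "card (C ` weight_lattice r) > 0" by (simp add: card_gt_0_iff)
  then show ?thesis
    unfolding P_mod_Q_order_def Coset.order_def G_def[symmetric] car .
qed

section \<open>Trigonometric determinants\<close>

lemma cis_eq_1_iff_int: "cis (2 * pi * real_of_int m / real n) = 1 \<longleftrightarrow> int n dvd m" if "n > 0"
proof
  assume "cis (2 * pi * real_of_int m / real n) = 1"
  then have "cos (2 * pi * real_of_int m / real n) = 1" by (simp add: complex_eq_iff)
  then obtain k :: int where "2 * pi * real_of_int m / real n = of_int k * 2 * pi"
    using cos_one_2pi_int by auto
  then have "real_of_int m = real_of_int (k * int n)" using that by (simp add: field_simps)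
  then have "m = k * int n" by (simp only: of_int_eq_iff)
  then show "int n dvd m" by simp
next
  assume "int n dvd m"
  then obtain k where "m = int n * k" ..
  then have "2 * pi * real_of_int m / real n = 2 * pi * real_of_int k" using that by simp
  then show "cis (2 * pi * real_of_int m / real n) = 1"
    by (simp add: complex_eq_iff cos_int_2pin sin_int_2pin)
qed

lemma character_sum:
  assumes "n > 0"
  shows "(\<Sum>t<n. cis (2 * pi * real_of_int (int t * m) / real n)) = (if int n dvd m then of_nat n else 0)"
proof -
  let ?x = "cis (2 * pi * real_of_int m / real n)"
  have *: "cis (2 * pi * real_of_int (int t * m) / real n) = ?x ^ t" for t
    by (simp add: DeMoivre mult_ac)
  show ?thesis
  proof (cases "int n dvd m")
    case True
    then show ?thesis unfolding * using cis_eq_1_iff_int[OF assms, of m] by simp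
  next
    case False
    then have "?x \<noteq> 1" using cis_eq_1_iff_int[OF assms, of m] by simp
    moreover have "?x ^ n = 1"
    proof -
      have "?x ^ n = cis (2 * pi * real_of_int (int n * m) / real n)" using * [of n] by simp
      then show ?thesis using cis_eq_1_iff_int[OF assms, of "int n * m"] by simp
    qed
    ultimately show ?thesis unfolding * using False by (simp add: geometric_sum)
  qed
qed

lemma sum_odd_symmetric:
  fixes f :: "nat \<Rightarrow> 'a :: comm_monoid_add"
  shows "(\<Sum>y<2 * r + 1. f y) = f 0 + (\<Sum>c = 1..r. f c + f (2 * r + 1 - c))"
proof -
  have "{..<2 * r + 1} = {0} \<union> {1..r} \<union> {r + 1..2 * r}" by auto
  then have "(\<Sum>y<2 * r + 1. f y) = f 0 + (\<Sum>c = 1..r. f c) + (\<Sum>c = r + 1..2 * r. f c)"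
    by (simp add: sum.union_disjoint add.assoc)
  also have "(\<Sum>c = r + 1..2 * r. f c) = (\<Sum>c = 1..r. f (2 * r + 1 - c))"
    by (rule sum.reindex_bij_witness[of _ "\<lambda>c. 2 * r + 1 - c" "\<lambda>c. 2 * r + 1 - c"]) auto
  finally show ?thesis by (simp add: sum.distrib add.assoc)
qed

text \<open>This is the real part of the character sum with the residues c and n - c paired; the
  unpaired residue 0 produces the -1/2.\<close>

lemma cos_sum:
  assumes n: "n = 2 * r + 1"
  shows "(\<Sum>c = 1..r. cos (2 * pi * real_of_int m * real c / real n)) = (if int n dvd m then real r else - 1 / 2)"
proof -
  have "Re (\<Sum>t<n. cis (2 * pi * real_of_int (int t * m) / real n)) = (if int n dvd m then real n else 0)"
    by (subst character_sum) (use n in auto)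
  then have "(\<Sum>t<n. cos (2 * pi * real_of_int m * real t / real n)) = (if int n dvd m then real n else 0)"
    by (simp add: mult_ac)
  moreover have "cos (2 * pi * real_of_int m * real (n - c) / real n) = cos (2 * pi * real_of_int m * real c / real n)"
    if "c \<in> {1..r}" for c
  proof -
    have "2 * pi * real_of_int m * real (n - c) / real n
        = 2 * pi * real_of_int m - 2 * pi * real_of_int m * real c / real n"
      using that n by (simp add: of_nat_diff field_simps)
    then show ?thesis by (simp add: cos_diff cos_int_2pin sin_int_2pin)
  qed
  ultimately have "1 + 2 * (\<Sum>c = 1..r. cos (2 * pi * real_of_int m * real c / real n)) = (if int n dvd m then real n else 0)"
    using sum_odd_symmetric[of "\<lambda>t. cos (2 * pi * real_of_int m * real t / real n)" r]
    unfolding n[symmetric] by (simp add: sum_distrib_left[symmetric])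
  then show ?thesis using n by (auto split: if_splits)
qed

lemma sin_orthogonal:
  assumes n: "n = 2 * r + 1" and "a \<in> {1..r}" "b \<in> {1..r}"
  shows "(\<Sum>c = 1..r. sin (2 * pi * real a * real c / real n) * sin (2 * pi * real b * real c / real n))
    = (if a = b then real n / 4 else 0)"
proof -
  have prod: "sin (2 * pi * real a * real c / real n) * sin (2 * pi * real b * real c / real n)
    = (cos (2 * pi * real_of_int (int a - int b) * real c / real n)
      - cos (2 * pi * real_of_int (int a + int b) * real c / real n)) / 2" for c
    unfolding sin_times_sin by (simp add: algebra_simps diff_divide_distrib add_divide_distrib)
  have A: "int n dvd int a - int b \<longleftrightarrow> a = b"
    using assms zdvd_imp_le[of "int n" "int a - int b"] zdvd_imp_le[of "int n" "int b - int a"]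
    by (cases a b rule: linorder_cases) (auto simp: dvd_diff_commute)
  have B: "\<not> int n dvd int a + int b"
    using assms zdvd_imp_le[of "int n" "int a + int b"] by auto
  have "(\<Sum>c = 1..r. sin (2 * pi * real a * real c / real n) * sin (2 * pi * real b * real c / real n))
    = ((\<Sum>c = 1..r. cos (2 * pi * real_of_int (int a - int b) * real c / real n))
      - (\<Sum>c = 1..r. cos (2 * pi * real_of_int (int a + int b) * real c / real n))) / 2"
    unfolding prod sum_divide_distrib[symmetric] sum_subtractf ..
  then show ?thesis
    unfolding cos_sum[OF n] using A B n by (auto simp: field_simps)
qed

text \<open>The isolated \<open>1 / 2\<close> is the term c = 0 at half weight: a sum over all
  residues meets 0 once and every other class +-c twice.\<close>

lemma cos_orthogonal:
  assumes n: "n = 2 * r + 1" and "a \<le> r" "b \<le> r"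
  shows "1 / 2 + (\<Sum>c = 1..r. cos (2 * pi * real a * real c / real n) * cos (2 * pi * real b * real c / real n))
    = (if a = b then if a = 0 then real n / 2 else real n / 4 else 0)"
proof -
  have prod: "cos (2 * pi * real a * real c / real n) * cos (2 * pi * real b * real c / real n)
    = (cos (2 * pi * real_of_int (int a - int b) * real c / real n)
      + cos (2 * pi * real_of_int (int a + int b) * real c / real n)) / 2" for c
    unfolding cos_times_cos by (simp add: algebra_simps diff_divide_distrib add_divide_distrib)
  have A: "int n dvd int a - int b \<longleftrightarrow> a = b"
    using assms zdvd_imp_le[of "int n" "int a - int b"] zdvd_imp_le[of "int n" "int b - int a"]
    by (cases a b rule: linorder_cases) (auto simp: dvd_diff_commute)
  have B: "int n dvd int a + int b \<longleftrightarrow> a = 0 \<and> b = 0"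
    using assms zdvd_imp_le[of "int n" "int a + int b"] by (cases "a = 0 \<and> b = 0") auto
  have "(\<Sum>c = 1..r. cos (2 * pi * real a * real c / real n) * cos (2 * pi * real b * real c / real n))
    = ((\<Sum>c = 1..r. cos (2 * pi * real_of_int (int a - int b) * real c / real n))
      + (\<Sum>c = 1..r. cos (2 * pi * real_of_int (int a + int b) * real c / real n))) / 2"
    unfolding prod sum_divide_distrib[symmetric] sum.distrib ..
  then show ?thesis
    unfolding cos_sum[OF n] using A B n by (auto simp: field_simps)
qed

section \<open>Signs of sine determinants by polynomials in the cosine\<close>

lemma det_scale:
  fixes f :: "nat \<Rightarrow> nat \<Rightarrow> 'a :: comm_ring_1"
  shows "det (mat m m (\<lambda>(i, j). a i * b j * f i j))
    = (\<Prod>i<m. a i) * (\<Prod>i<m. b i) * det (mat m m (\<lambda>(i, j). f i j))"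
proof -
  have det: "det (mat m m (\<lambda>(i, j). g i j)) = (\<Sum>p | p permutes {0..<m}. of_int (sign p) * (\<Prod>i = 0..<m. g i (p i)))"
    for g :: "nat \<Rightarrow> nat \<Rightarrow> 'a"
  proof -
    have "det (mat m m (\<lambda>(i, j). g i j)) = (\<Sum>p | p permutes {0..<m}. of_int (sign p) * (\<Prod>i = 0..<m. mat m m (\<lambda>(i, j). g i j) $$ (i, p i)))"
      by (rule det_def') simp
    also have "\<dots> = (\<Sum>p | p permutes {0..<m}. of_int (sign p) * (\<Prod>i = 0..<m. g i (p i)))"
    proof (intro sum.cong arg_cong2[where f = "(*)"] prod.cong refl)
      fix p i assume "p \<in> {p. p permutes {0..<m}}" "i \<in> {0..<m}"
      then show "mat m m (\<lambda>(i, j). g i j) $$ (i, p i) = g i (p i)"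
        using permutes_in_image[of p "{0..<m}" i] by auto
    qed
    finally show ?thesis .
  qed
  have "(\<Prod>i = 0..<m. b (p i)) = (\<Prod>i<m. b i)" if "p permutes {0..<m}" for p
    using prod.permute[OF that, of b] by (simp add: lessThan_atLeast0)
  then show ?thesis
    unfolding det by (simp add: prod.distrib sum_distrib_left lessThan_atLeast0 mult_ac)
qed

text \<open>For e = 0 these are the Chebyshev polynomials of the second kind, for e = 1/2 those of
  the fourth kind, sin((k + 1/2)x) / sin(x/2) as a polynomial in cos x. The two cases serve integral
  and half-integral weight coordinates.\<close>

fun sin_poly :: "real \<Rightarrow> nat \<Rightarrow> real poly" where
  "sin_poly e 0 = 1"
| "sin_poly e (Suc 0) = [:2 * e, 2:]"
| "sin_poly e (Suc (Suc k)) = [:0, 2:] * sin_poly e (Suc k) - sin_poly e k"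

lemma sin_poly_degree: "degree (sin_poly e k) \<le> k \<and> coeff (sin_poly e k) k = 2 ^ k"
proof (induction e k rule: sin_poly.induct)
  case (3 e k)
  have "degree ([:0, 2:] * sin_poly e (Suc k)) \<le> 1 + Suc k"
    using 3 by (intro order.trans[OF degree_mult_le] add_mono) auto
  moreover have "coeff (sin_poly e k) (Suc (Suc k)) = 0" using 3 by (intro coeff_eq_0) auto
  ultimately show ?case using 3 by (auto intro!: degree_diff_le)
qed auto

lemma sin_poly_eq:
  assumes e: "e = 0 \<or> e = 1 / 2"
  shows "sin (x * (real k + 1 - e)) = sin (x * (1 - e)) * poly (sin_poly e k) (cos x)"
proof (induction k rule: induct_nat_012)
  case 1
  have "sin (x * 2) = 2 * sin x * cos x" using sin_double[of x] by (simp add: mult_ac)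
  moreover have "sin (x * (3 / 2)) = sin (x / 2) * (1 + 2 * cos x)"
  proof -
    have "sin (x * (3 / 2)) = sin (x + x / 2)" by (rule arg_cong[where f = sin]) simp
    also have "\<dots> = sin (x / 2) * (2 * (cos (x / 2))\<^sup>2) + cos x * sin (x / 2)"
      using sin_double[of "x / 2"] unfolding sin_add by (simp add: power2_eq_square)
    also have "2 * (cos (x / 2))\<^sup>2 = 1 + cos x" using cos_double_cos[of "x / 2"] by simp
    also have "sin (x / 2) * (1 + cos x) + cos x * sin (x / 2) = sin (x / 2) * (1 + 2 * cos x)"
      by (simp add: algebra_simps)
    finally show ?thesis .
  qed
  moreover have "real (Suc 0) + 1 - e = 3 / 2" "1 - e = 1 / 2" "2 * e = 1" if "e = 1 / 2"
    using that by simp_all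
  ultimately show ?case using e by (elim disjE) (simp, simp only:, simp)
next
  case (ge2 k)
  define a where "a = x * (real (Suc k) + 1 - e)"
  have "x * (real (Suc (Suc k)) + 1 - e) = a + x" "x * (real k + 1 - e) = a - x"
    by (simp_all add: a_def algebra_simps)
  then have "sin (x * (real (Suc (Suc k)) + 1 - e)) = 2 * cos x * sin a - sin (x * (real k + 1 - e))"
    by (simp add: sin_add sin_diff)
  also have "\<dots> = sin (x * (1 - e)) * poly (sin_poly e (Suc (Suc k))) (cos x)"
    unfolding ge2 a_def by (simp add: right_diff_distrib mult_ac)
  finally show ?case .
qed (use e in auto)

text \<open>The determinant is a polynomial in the smallest node with the other nodes as its roots.\<close>

lemma poly_det_sign:
  fixes c :: "nat \<Rightarrow> real"
  assumes deg: "\<And>k. degree (P k) \<le> k" and lc: "\<And>k. coeff (P k) k > 0"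
    and c: "\<And>i j. i < j \<Longrightarrow> j < m \<Longrightarrow> c i < c j"
  shows "0 < (-1) ^ (\<Sum>i<m. i) * det (mat m m (\<lambda>(i, j). poly (P (m - 1 - j)) (c i)))"
  using c
proof (induction m arbitrary: c)
  case (Suc m)
  define A where "A = mat (Suc m) (Suc m) (\<lambda>(i, j). poly (P (m - j)) (c i))"
  have A: "A \<in> carrier_mat (Suc m) (Suc m)" by (simp add: A_def)
  define q where "q = (\<Sum>j<Suc m. smult (cofactor A 0 j) (P (m - j)))"
  have q: "poly q (c i) = (if i = 0 then det A else 0)" if "i < Suc m" for i
  proof -
    have "(A * adj_mat A) $$ (i, 0) = (\<Sum>j = 0..<Suc m. A $$ (i, j) * cofactor A 0 j)"
      using that A adj_mat(1)[OF A] by (simp add: scalar_prod_def adj_mat_def)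
    also have "\<dots> = (\<Sum>j<Suc m. cofactor A 0 j * poly (P (m - j)) (c i))"
      using that by (intro sum.cong) (auto simp: A_def)
    also have "\<dots> = poly q (c i)" by (simp add: q_def poly_sum)
    finally show ?thesis using that unfolding adj_mat(2)[OF A] by (cases "i = 0") auto
  qed
  have degq: "degree q \<le> m"
    unfolding q_def
    by (intro degree_sum_le order.trans[OF degree_smult_le] order.trans[OF deg]) auto
  have "coeff q m = (\<Sum>j<Suc m. cofactor A 0 j * coeff (P (m - j)) m)" by (simp add: q_def coeff_sum)
  also have "\<dots> = (\<Sum>j<Suc m. if j = 0 then cofactor A 0 0 * coeff (P m) m else 0)"
  proof (rule sum.cong[OF refl])
    fix j assume "j \<in> {..<Suc m}"
    then show "cofactor A 0 j * coeff (P (m - j)) m = (if j = 0 then cofactor A 0 0 * coeff (P m) m else 0)"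
      using deg[of "m - j"] by (auto intro!: coeff_eq_0)
  qed
  finally have lcq: "coeff q m = cofactor A 0 0 * coeff (P m) m" by simp
  have "mat_delete A 0 0 = mat m m (\<lambda>(i, j). poly (P (m - 1 - j)) (c (Suc i)))"
    by (auto simp: mat_delete_def A_def intro!: eq_matI)
  moreover have "0 < (-1) ^ (\<Sum>i<m. i) * det (mat m m (\<lambda>(i, j). poly (P (m - 1 - j)) (c (Suc i))))"
    by (rule Suc.IH) (simp add: Suc.prems)
  ultimately have cof: "0 < (-1) ^ (\<Sum>i<m. i) * cofactor A 0 0" by (simp add: cofactor_def)
  define R where "R = (\<Prod>i\<in>{1..m}. [:- c i, 1:])"
  have degR: "degree R \<le> m"
    unfolding R_def by (rule order.trans[OF degree_prod_sum_le]) auto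
  have lcR: "coeff R m = 1"
  proof -
    have "degree R = m" unfolding R_def by (subst degree_prod_sum_eq) auto
    moreover have "lead_coeff R = 1" unfolding R_def lead_coeff_prod by simp
    ultimately show ?thesis by simp
  qed
  define p where "p = q - smult (coeff q m) R"
  \<comment> \<open>The leading terms cancel, so a nonzero \<open>p\<close> would have degree below
    \<open>m\<close> and still the \<open>m\<close> distinct roots c 1, ..., c m.\<close>
  have "p = 0"
  proof (rule ccontr)
    assume p: "p \<noteq> 0"
    have "degree p \<le> m"
      unfolding p_def by (intro degree_diff_le degq order.trans[OF degree_smult_le] degR)
    moreover have "coeff p m = 0" by (simp add: p_def lcR)
    ultimately have "degree p < m" using p by (metis le_neq_implies_less leading_coeff_0_iff)
    moreover have "c ` {1..m} \<subseteq> {x. poly p x = 0}"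
    proof clarify
      fix i assume i: "i \<in> {1..m}"
      then have "poly R (c i) = 0" unfolding R_def poly_prod by (intro prod_zero) auto
      then show "poly p (c i) = 0" using i q[of i] by (simp add: p_def)
    qed
    moreover have "card (c ` {1..m}) = m"
    proof -
      have "inj_on c {1..m}"
        by (rule linorder_inj_onI) (use Suc.prems in force)+
      then show ?thesis by (simp add: card_image)
    qed
    ultimately show False
      using card_poly_roots_bound[OF p] card_mono[OF poly_roots_finite[OF p]] by (metis le_trans not_less)
  qed
  then have "q = smult (coeff q m) R" by (simp add: p_def)
  then have "poly q (c 0) = coeff q m * poly R (c 0)" by (metis poly_smult)
  then have "det A = coeff q m * poly R (c 0)" using q[of 0] by simp
  also have "poly R (c 0) = (-1) ^ m * (\<Prod>i\<in>{1..m}. c i - c 0)"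
  proof -
    have "poly R (c 0) = (\<Prod>i\<in>{1..m}. (-1) * (c i - c 0))" unfolding R_def poly_prod by (intro prod.cong) simp_all
    then show ?thesis unfolding prod.distrib by simp
  qed
  finally have "(-1) ^ (\<Sum>i<Suc m. i) * det A
      = ((-1) ^ m * (-1) ^ m) * (((-1) ^ (\<Sum>i<m. i) * cofactor A 0 0) * coeff (P m) m * (\<Prod>i\<in>{1..m}. c i - c 0))"
    unfolding lcq sum.lessThan_Suc power_add by (simp only: mult_ac)
  also have "(-1) ^ m * (-1) ^ m = (1 :: real)" by (simp flip: power_mult_distrib)
  finally have "(-1) ^ (\<Sum>i<Suc m. i) * det A
      = ((-1) ^ (\<Sum>i<m. i) * cofactor A 0 0) * coeff (P m) m * (\<Prod>i\<in>{1..m}. c i - c 0)" by (simp only: mult_1)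
  moreover have "(\<Prod>i\<in>{1..m}. c i - c 0) > 0" using Suc.prems by (intro prod_pos) auto
  ultimately have "0 < (-1) ^ (\<Sum>i<Suc m. i) * det A" using cof lc[of m] by simp
  then show ?case by (simp add: A_def)
qed simp

text \<open>Row \<open>i\<close> carries the positive factor sin(\<phi> i (1 - e)); what remains are
  polynomials with positive leading coefficients at the nodes cos(\<phi> i), which increase because
  the angles decrease in (0, \<pi>).\<close>

lemma sin_det_sign:
  fixes \<phi> :: "nat \<Rightarrow> real"
  assumes e: "e = 0 \<or> e = 1 / 2" and dec: "\<And>i j. i < j \<Longrightarrow> j < m \<Longrightarrow> \<phi> j < \<phi> i"
    and pos: "\<And>i. i < m \<Longrightarrow> 0 < \<phi> i" and lt: "\<And>i. i < m \<Longrightarrow> \<phi> i < pi"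
  shows "0 < (-1) ^ (\<Sum>i<m. i) * det (mat m m (\<lambda>(i, j). sin (\<phi> i * (real m - real j - e))))"
proof -
  have "mat m m (\<lambda>(i, j). sin (\<phi> i * (real m - real j - e)))
     = mat m m (\<lambda>(i, j). sin (\<phi> i * (1 - e)) * 1 * poly (sin_poly e (m - 1 - j)) (cos (\<phi> i)))"
  proof (rule eq_matI, clarsimp)
    fix i j assume "i < m" "j < m"
    then show "sin (\<phi> i * (real m - real j - e)) = sin (\<phi> i * (1 - e)) * poly (sin_poly e (m - Suc j)) (cos (\<phi> i))"
      by (subst sin_poly_eq[OF e, symmetric]) (simp add: of_nat_diff)
  qed auto
  then have D: "det (mat m m (\<lambda>(i, j). sin (\<phi> i * (real m - real j - e))))
     = (\<Prod>i<m. sin (\<phi> i * (1 - e))) * det (mat m m (\<lambda>(i, j). poly (sin_poly e (m - 1 - j)) (cos (\<phi> i))))"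
    by (simp only: det_scale) simp
  have P: "(\<Prod>i<m. sin (\<phi> i * (1 - e))) > 0"
  proof (rule prod_pos, clarify)
    fix i assume "i < m"
    then have "0 < \<phi> i" "\<phi> i < pi" using pos lt by auto
    moreover have "\<phi> i * (1 - e) > 0" "\<phi> i * (1 - e) \<le> \<phi> i" using e \<open>0 < \<phi> i\<close> by auto
    ultimately show "sin (\<phi> i * (1 - e)) > 0" by (intro sin_gt_zero) auto
  qed
  have Q: "0 < (-1) ^ (\<Sum>i<m. i) * det (mat m m (\<lambda>(i, j). poly (sin_poly e (m - 1 - j)) (cos (\<phi> i))))"
  proof (rule poly_det_sign)
    fix k show "degree (sin_poly e k) \<le> k" "coeff (sin_poly e k) k > 0"
      using sin_poly_degree[of e k] by auto
  next
    fix i j assume "i < j" "j < m"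
    then show "cos (\<phi> i) < cos (\<phi> j)"
      using dec[of i j] pos[of j] lt[of i] by (intro cos_monotone_0_pi) auto
  qed
  show ?thesis unfolding D using mult_pos_pos[OF P Q] by (simp only: mult.left_commute)
qed

section \<open>Sine determinants at the shifted weights of level 2\<close>

definition sin_det :: "nat \<Rightarrow> (nat \<Rightarrow> real) \<Rightarrow> (nat \<Rightarrow> real) \<Rightarrow> real" where
  "sin_det r u v = det (mat r r (\<lambda>(i, j). sin (2 * pi * u i * v j / real (2 * r + 1))))"

lemma sin_det_commute: "sin_det r u v = sin_det r v u"
proof -
  have "mat r r (\<lambda>(i, j). sin (2 * pi * u i * v j / real (2 * r + 1)))
      = transpose_mat (mat r r (\<lambda>(i, j). sin (2 * pi * v i * u j / real (2 * r + 1))))"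
    by (intro eq_matI) (auto simp: mult_ac)
  then show ?thesis unfolding sin_det_def using det_transpose[of _ r] by (metis mat_carrier)
qed

text \<open>The coordinates of \<gamma>^a + \<rho> are the half-integers n/2 - p for p = 0, ..., r
  with p = a left out. The r + 1 weights thus correspond to deleting one of r + 1 nodes, and
  \<open>insert_index\<close> enumerates the nodes that stay.\<close>

definition gam_coord :: "nat \<Rightarrow> nat \<Rightarrow> nat \<Rightarrow> real" where
  "gam_coord r a j = real (2 * r + 1) / 2 - real (insert_index a j)"

definition spin_coord :: "nat \<Rightarrow> nat \<Rightarrow> real" where
  "spin_coord r j = real r - real j"

text \<open>This is the sine matrix on all r + 1 nodes n/2 - p, rewritten with cosines. Its minors
  of size r are the sine determinants of pairs \<gamma>^a, \<gamma>^b.\<close>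

definition big_mat :: "nat \<Rightarrow> real mat" where
  "big_mat r = mat (Suc r) (Suc r) (\<lambda>(p, q). (-1) ^ (p + q + r) * cos (2 * pi * real p * real q / real (2 * r + 1)))"

lemma sin_shift:
  fixes n :: real
  assumes n: "n = real (2 * r + 1)"
  shows "sin (2 * pi * (n / 2 - real p) * (n / 2 - real q) / n)
    = (-1) ^ (p + q + r) * cos (2 * pi * real p * real q / n)"
proof -
  have n0: "n \<noteq> 0" using n by simp
  have "2 * pi * (n / 2 - real p) * (n / 2 - real q) / n
     = 2 * pi * real p * real q / n + pi / 2 + real r * pi - real (p + q) * pi"
    using n0 by (simp add: field_simps) (simp add: n algebra_simps)
  also have "sin \<dots> = (-1) ^ (p + q) * ((-1) ^ r * cos (2 * pi * real p * real q / n))"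
    by (simp only: sin_diff sin_add cos_add sin_npi cos_npi) simp
  finally show ?thesis by (simp add: power_add mult_ac)
qed

lemma sin_det_gam:
  assumes "a \<le> r" "b \<le> r"
  shows "sin_det r (gam_coord r a) (gam_coord r b) = det (mat_delete (big_mat r) a b)"
proof -
  have "mat r r (\<lambda>(i, j). sin (2 * pi * gam_coord r a i * gam_coord r b j / real (2 * r + 1))) = mat_delete (big_mat r) a b"
  proof (rule eq_matI)
    fix i j assume "i < dim_row (mat_delete (big_mat r) a b)" "j < dim_col (mat_delete (big_mat r) a b)"
    then have ij: "i < r" "j < r" by (simp_all add: big_mat_def)
    have A: "big_mat r \<in> carrier_mat (Suc r) (Suc r)" by (simp add: big_mat_def)
    have lt: "insert_index a i < Suc r" "insert_index b j < Suc r"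
      using ij by (auto simp: insert_index_def)
    have "mat_delete (big_mat r) a b $$ (i, j) = big_mat r $$ (insert_index a i, insert_index b j)"
      using mat_delete_index[OF A, of a b i j] assms ij by simp
    then show "mat r r (\<lambda>(i, j). sin (2 * pi * gam_coord r a i * gam_coord r b j / real (2 * r + 1))) $$ (i, j)
       = mat_delete (big_mat r) a b $$ (i, j)"
      using ij lt sin_shift[OF refl, of r "insert_index a i" "insert_index b j"]
      by (simp add: big_mat_def gam_coord_def)
  qed (simp_all add: big_mat_def)
  then show ?thesis by (simp add: sin_det_def)
qed

definition half_wt :: "nat \<Rightarrow> real" where
  "half_wt a = (if a = 0 then 1 / 2 else 1)"

text \<open>The inverse of \<open>big_mat\<close>, read off from the orthogonality of the discrete
  cosine transform; index 0 receives half weight because it is its own negative.\<close>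

definition big_inv :: "nat \<Rightarrow> real mat" where
  "big_inv r = mat (Suc r) (Suc r) (\<lambda>(p, q). (4 / real (2 * r + 1) * half_wt p) * half_wt q * big_mat r $$ (p, q))"

lemma big_mat_inverse: "big_mat r * big_inv r = 1\<^sub>m (Suc r)"
proof (rule eq_matI)
  fix a b assume "a < dim_row (1\<^sub>m (Suc r) :: real mat)" "b < dim_col (1\<^sub>m (Suc r) :: real mat)"
  then have ab: "a \<le> r" "b \<le> r" by auto
  define n where "n = 2 * r + 1"
  let ?f = "\<lambda>c. cos (2 * pi * real a * real c / real n) * cos (2 * pi * real b * real c / real n)"
  have sq: "(-1) ^ (a + c + r) * ((-1) ^ (c + b + r)) = ((-1) ^ (a + b) :: real)" for c
  proof -
    have "(-1) ^ (a + c + r) * ((-1) ^ (c + b + r)) = ((-1) ^ (a + b) * ((-1) ^ (c + r)) ^ 2 :: real)"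
      by (simp add: power_add power2_eq_square mult_ac)
    also have "((-1) ^ (c + r)) ^ 2 = (1::real)" by (simp flip: power_mult)
    finally show ?thesis by simp
  qed
  have "(big_mat r * big_inv r) $$ (a, b) = (\<Sum>c = 0..r. big_mat r $$ (a, c) * big_inv r $$ (c, b))"
    using ab by (simp add: big_mat_def big_inv_def scalar_prod_def atLeastLessThanSuc_atLeastAtMost)
  also have "\<dots> = (\<Sum>c = 0..r. (-1) ^ (a + b) * (4 / real n * half_wt b) * (half_wt c * ?f c))"
  proof (rule sum.cong[OF refl])
    fix c assume "c \<in> {0..r}"
    then have "big_mat r $$ (a, c) * big_inv r $$ (c, b)
      = ((-1) ^ (a + c + r) * ((-1) ^ (c + b + r))) * (4 / real n * half_wt b) * (half_wt c * ?f c)"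
      using ab by (simp add: big_mat_def big_inv_def n_def mult_ac)
    then show "big_mat r $$ (a, c) * big_inv r $$ (c, b) = (-1) ^ (a + b) * (4 / real n * half_wt b) * (half_wt c * ?f c)"
      unfolding sq .
  qed
  also have "\<dots> = (-1) ^ (a + b) * (4 / real n * half_wt b) * (\<Sum>c = 0..r. half_wt c * ?f c)"
    by (simp only: sum_distrib_left)
  also have "(\<Sum>c = 0..r. half_wt c * ?f c) = 1 / 2 + (\<Sum>c = 1..r. ?f c)"
    by (subst sum.atLeast_Suc_atMost) (simp_all add: half_wt_def)
  also have "\<dots> = (if a = b then if a = 0 then real n / 2 else real n / 4 else 0)"
    by (rule cos_orthogonal) (use ab in \<open>auto simp: n_def\<close>)
  finally show "(big_mat r * big_inv r) $$ (a, b) = 1\<^sub>m (Suc r) $$ (a, b)"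
    using ab by (simp add: half_wt_def n_def)
qed (simp_all add: big_mat_def big_inv_def)

lemma prod_half_wt: "(\<Prod>i<Suc r. half_wt i) = 1 / 2"
  by (simp add: prod.lessThan_Suc_shift half_wt_def del: prod.lessThan_Suc)

text \<open>The inverse is the matrix itself with rows and columns rescaled, so the product of the
  two determinants being 1 fixes the square. The factor 4 comes from the half weight at index 0,
  once for rows and once for columns.\<close>

lemma det_big_mat:
  "det (big_mat r) \<noteq> 0"
  "(det (big_mat r))\<^sup>2 = 4 * (real (2 * r + 1) / 4) ^ Suc r"
proof -
  have eq: "mat (Suc r) (Suc r) (\<lambda>(p, q). big_mat r $$ (p, q)) = big_mat r"
    by (intro eq_matI) (auto simp: big_mat_def)
  have "det (big_inv r) = (\<Prod>i<Suc r. 4 / real (2 * r + 1) * half_wt i) * (\<Prod>i<Suc r. half_wt i) * det (big_mat r)"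
    unfolding big_inv_def det_scale eq ..
  also have "\<dots> = (4 / real (2 * r + 1)) ^ Suc r / 4 * det (big_mat r)"
    unfolding prod.distrib prod_half_wt by simp
  finally have "det (big_inv r) = (4 / real (2 * r + 1)) ^ Suc r / 4 * det (big_mat r)" .
  then have "(det (big_mat r))\<^sup>2 * ((4 / real (2 * r + 1)) ^ Suc r / 4) = det (big_mat r) * det (big_inv r)"
    by (simp only: power2_eq_square mult_ac)
  also have "det (big_mat r) * det (big_inv r) = 1"
    by (subst det_mult[symmetric, of _ "Suc r"]) (simp_all add: big_mat_inverse, simp_all add: big_mat_def big_inv_def)
  finally have *: "(det (big_mat r))\<^sup>2 * ((4 / real (2 * r + 1)) ^ Suc r / 4) = 1" .
  then show "det (big_mat r) \<noteq> 0" by auto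
  have "(4 / real (2 * r + 1)) ^ Suc r \<noteq> 0" by simp
  with * show "(det (big_mat r))\<^sup>2 = 4 * (real (2 * r + 1) / 4) ^ Suc r"
    by (simp add: power_divide field_simps del: power_Suc of_nat_Suc of_nat_add of_nat_mult)
qed

text \<open>By Cramer's rule a minor is the determinant times an entry of the inverse, and the
  inverse is known. All pairs of nonspinors are thereby treated at once, with a common
  factor.\<close>

lemma sin_det_gam_value:
  assumes ab: "a \<le> r" "b \<le> r"
  shows "sin_det r (gam_coord r a) (gam_coord r b)
    = 4 * half_wt a * half_wt b * cos (2 * pi * real a * real b / real (2 * r + 1)) * ((-1) ^ r * det (big_mat r) / real (2 * r + 1))"
proof -
  have A: "big_mat r \<in> carrier_mat (Suc r) (Suc r)" by (simp add: big_mat_def)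
  have B: "big_inv r \<in> carrier_mat (Suc r) (Suc r)" by (simp add: big_inv_def)
  have "adj_mat (big_mat r) = adj_mat (big_mat r) * (big_mat r * big_inv r)"
    using adj_mat(1)[OF A] by (simp add: big_mat_inverse)
  also have "\<dots> = (adj_mat (big_mat r) * big_mat r) * big_inv r"
    using adj_mat(1)[OF A] A B by (simp add: assoc_mult_mat)
  also have "\<dots> = det (big_mat r) \<cdot>\<^sub>m big_inv r"
    unfolding adj_mat(3)[OF A] using B by (subst mult_smult_assoc_mat[of _ "Suc r" "Suc r"]) auto
  finally have "adj_mat (big_mat r) $$ (b, a) = det (big_mat r) * big_inv r $$ (b, a)"
    using ab B by simp
  then have "(-1) ^ (a + b) * det (mat_delete (big_mat r) a b) = det (big_mat r) * big_inv r $$ (b, a)"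
    using ab A by (simp add: adj_mat_def cofactor_def)
  then have "(-1) ^ (a + b) * ((-1) ^ (a + b) * det (mat_delete (big_mat r) a b)) = (-1) ^ (a + b) * (det (big_mat r) * big_inv r $$ (b, a))"
    by simp
  moreover have "(-1) ^ (a + b) * ((-1) ^ (a + b) * x) = x" for x :: real
    by (simp flip: power_mult_distrib mult.assoc)
  ultimately have "det (mat_delete (big_mat r) a b) = (-1) ^ (a + b) * (det (big_mat r) * big_inv r $$ (b, a))"
    by simp
  also have "big_inv r $$ (b, a) = (4 / real (2 * r + 1) * half_wt b) * half_wt a * ((-1) ^ (b + a + r) * cos (2 * pi * real b * real a / real (2 * r + 1)))"
    using ab by (simp add: big_inv_def big_mat_def)
  also have "(-1) ^ (b + a + r) = (-1) ^ (a + b) * ((-1) ^ r :: real)" by (simp add: power_add)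
  finally show ?thesis
    unfolding sin_det_gam[OF ab] by (simp add: mult_ac flip: power_mult_distrib) 
qed

lemma sin_int_pi_minus: "sin (real a * pi - x) = - ((-1) ^ a * sin x)"
  by (simp add: sin_diff)

lemma sum_rev_index: "(\<Sum>k = 0..<r. f (r - k)) = (\<Sum>c = 1..r. f c)" for f :: "nat \<Rightarrow> 'a :: comm_monoid_add"
  by (rule sum.reindex_bij_witness[of _ "\<lambda>c. r - c" "\<lambda>k. r - k"]) auto

lemma det_square_of_orthogonal:
  fixes A :: "real mat"
  assumes A: "A \<in> carrier_mat r r"
    and orth: "\<And>i j. i < r \<Longrightarrow> j < r \<Longrightarrow> (\<Sum>k = 0..<r. A $$ (i, k) * A $$ (j, k)) = (if i = j then c else 0)"
  shows "(det A)\<^sup>2 = c ^ r"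
proof -
  have "A * A\<^sup>T = c \<cdot>\<^sub>m 1\<^sub>m r"
    using A orth by (intro eq_matI) (auto simp: scalar_prod_def)
  then have "det A * det A\<^sup>T = c ^ r"
    using A by (subst det_mult[symmetric, of _ r]) auto
  then show ?thesis using det_transpose[OF A] by (simp add: power2_eq_square)
qed

lemma sin_det_spin_square:
  "(sin_det r (spin_coord r) (spin_coord r))\<^sup>2 = (real (2 * r + 1) / 4) ^ r"
  unfolding sin_det_def
proof (rule det_square_of_orthogonal)
  fix i j assume ij: "i < r" "j < r"
  let ?s = "\<lambda>a c. sin (2 * pi * real a * real c / real (2 * r + 1))"
  have "(\<Sum>k = 0..<r. mat r r (\<lambda>(i, j). sin (2 * pi * spin_coord r i * spin_coord r j / real (2 * r + 1))) $$ (i, k)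
        * mat r r (\<lambda>(i, j). sin (2 * pi * spin_coord r i * spin_coord r j / real (2 * r + 1))) $$ (j, k))
     = (\<Sum>k = 0..<r. ?s (r - i) (r - k) * ?s (r - j) (r - k))"
    using ij by (intro sum.cong) (auto simp: spin_coord_def of_nat_diff)
  also have "\<dots> = (\<Sum>c = 1..r. ?s (r - i) c * ?s (r - j) c)" by (rule sum_rev_index)
  also have "\<dots> = (if r - i = r - j then real (2 * r + 1) / 4 else 0)"
    by (rule sin_orthogonal) (use ij in auto)
  finally show "(\<Sum>k = 0..<r. mat r r (\<lambda>(i, j). sin (2 * pi * spin_coord r i * spin_coord r j / real (2 * r + 1))) $$ (i, k)
        * mat r r (\<lambda>(i, j). sin (2 * pi * spin_coord r i * spin_coord r j / real (2 * r + 1))) $$ (j, k))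
     = (if i = j then real (2 * r + 1) / 4 else 0)" using ij by auto
qed simp

text \<open>The summand n/2 in the half-integral coordinates shifts each angle by a multiple of
  \<pi>, so the matrix is the integral sine matrix with signs attached to its rows.\<close>

lemma sin_det_spin_gam_square:
  "(sin_det r (spin_coord r) (gam_coord r 0))\<^sup>2 = (real (2 * r + 1) / 4) ^ r"
  unfolding sin_det_def
proof (rule det_square_of_orthogonal)
  fix i j assume ij: "i < r" "j < r"
  let ?n = "real (2 * r + 1)"
  let ?A = "mat r r (\<lambda>(i, j). sin (2 * pi * spin_coord r i * gam_coord r 0 j / ?n))"
  let ?s = "\<lambda>a c. sin (2 * pi * real a * real c / ?n)"
  have entry: "?A $$ (i, k) = - ((-1) ^ (r - i) * ?s (r - i) (Suc k))" if "i < r" "k < r" for i k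
  proof -
    have "2 * pi * spin_coord r i * gam_coord r 0 k / ?n = real (r - i) * pi - 2 * pi * real (r - i) * real (Suc k) / ?n"
      using that by (simp add: spin_coord_def gam_coord_def insert_index_def of_nat_diff field_simps)
    then show ?thesis using that by (simp only: index_mat split sin_int_pi_minus)
  qed
  have "(\<Sum>k = 0..<r. ?A $$ (i, k) * ?A $$ (j, k)) = (\<Sum>k = 0..<r. (-1) ^ (r - i) * (-1) ^ (r - j) * (?s (r - i) (Suc k) * ?s (r - j) (Suc k)))"
    using ij by (intro sum.cong refl) (simp only: entry atLeastLessThan_iff, simp)
  also have "\<dots> = (-1) ^ (r - i) * (-1) ^ (r - j) * (\<Sum>k = 0..<r. ?s (r - i) (Suc k) * ?s (r - j) (Suc k))"
    by (simp only: sum_distrib_left)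
  also have "(\<Sum>k = 0..<r. ?s (r - i) (Suc k) * ?s (r - j) (Suc k)) = (\<Sum>c = 1..r. ?s (r - i) c * ?s (r - j) c)"
    by (rule sum.reindex_bij_witness[of _ "\<lambda>c. c - 1" Suc]) auto
  also have "\<dots> = (if r - i = r - j then ?n / 4 else 0)"
    by (rule sin_orthogonal) (use ij in auto)
  finally show "(\<Sum>k = 0..<r. ?A $$ (i, k) * ?A $$ (j, k)) = (if i = j then ?n / 4 else 0)"
    using ij by (auto simp flip: power_mult_distrib)
qed simp

text \<open>For b > 0 the node 0 is kept, so the first coordinate is n/2; against the integral
  spinor coordinates it gives multiples of \<pi>, and the first column vanishes.\<close>

lemma sin_det_spin_gam_zero:
  assumes "0 < b" "b \<le> r"
  shows "sin_det r (spin_coord r) (gam_coord r b) = 0"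
proof -
  let ?A = "mat r r (\<lambda>(i, j). sin (2 * pi * spin_coord r i * gam_coord r b j / real (2 * r + 1)))"
  have "?A $$ (i, 0) = 0" if "i < r" for i
  proof -
    have "2 * pi * spin_coord r i * gam_coord r b 0 / real (2 * r + 1) = real (r - i) * pi"
      using that assms by (simp add: spin_coord_def gam_coord_def insert_index_def of_nat_diff)
    then show ?thesis using that assms by (simp only: index_mat split sin_npi)
  qed
  moreover have "det ?A = (\<Sum>i<r. ?A $$ (i, 0) * cofactor ?A i 0)"
    by (rule laplace_expansion_column) (use assms in auto)
  ultimately show ?thesis by (simp add: sin_det_def)
qed

text \<open>Orthogonality gives the squares only. All three determinants have the sign (-1)^(0 + 1 +
  ... + (r - 1)), by the case e = 1/2 when the columns are half-integral and e = 0 when they are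
  integral; so the ratios are the positive root of n.\<close>

lemma sin_det_spin_values:
  "sin_det r (gam_coord r 0) (gam_coord r 0) \<noteq> 0"
  "sin_det r (spin_coord r) (gam_coord r 0) = sqrt (real (2 * r + 1)) * sin_det r (gam_coord r 0) (gam_coord r 0)"
  "sin_det r (spin_coord r) (spin_coord r) = sqrt (real (2 * r + 1)) * sin_det r (gam_coord r 0) (gam_coord r 0)"
proof -
  define n where "n = real (2 * r + 1)"
  define s :: real where "s = (-1) ^ (\<Sum>i<r. i)"
  have n: "n > 0" by (simp add: n_def)
  have s2: "s * s = 1" by (simp add: s_def flip: power_mult_distrib)
  have mat: "sin_det r u v = det (mat r r (\<lambda>(i, j). sin (2 * pi * u i / n * (real r - real j - e))))"
    if "\<And>j. j < r \<Longrightarrow> v j = real r - real j - e" for u v e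
    unfolding sin_det_def n_def[symmetric] using that
    by (intro arg_cong[where f = det] eq_matI) auto
  have g: "gam_coord r 0 j = real r - real j - 1 / 2" for j
    by (simp add: gam_coord_def insert_index_def field_simps)
  have dec: "2 * pi * x / n < 2 * pi * y / n" if "x < y" for x y
    using that n by (intro divide_strict_right_mono mult_strict_left_mono) auto
  have lt: "2 * pi * x / n < pi" if "x \<le> real r" for x
  proof -
    have "pi * (2 * x) < pi * n" using that by (intro mult_strict_left_mono) (auto simp: n_def)
    then show ?thesis using n by (simp add: field_simps)
  qed
  have a: "0 < s * sin_det r (gam_coord r 0) (gam_coord r 0)"
    unfolding s_def by (subst mat[of _ "1 / 2"], simp add: g, intro sin_det_sign dec lt divide_pos_pos n) (auto simp: g)
  have b: "0 < s * sin_det r (spin_coord r) (gam_coord r 0)"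
    unfolding s_def by (subst mat[of _ "1 / 2"], simp add: g, intro sin_det_sign dec lt divide_pos_pos n) (auto simp: spin_coord_def)
  have c: "0 < s * sin_det r (spin_coord r) (spin_coord r)"
    unfolding s_def by (subst mat[of _ 0], simp add: spin_coord_def, intro sin_det_sign dec lt divide_pos_pos n) (auto simp: spin_coord_def)
  have sq: "(s * x)\<^sup>2 = x\<^sup>2" for x using s2 by (simp add: power2_eq_square mult.left_commute mult.assoc)
  have "(sin_det r (gam_coord r 0) (gam_coord r 0))\<^sup>2 = (det (big_mat r))\<^sup>2 / n\<^sup>2"
    by (subst sin_det_gam_value) (simp_all add: half_wt_def n_def power_divide power_mult_distrib flip: power_mult)
  also have "\<dots> = (n / 4) ^ r / n"
    unfolding det_big_mat(2) n_def[symmetric] using n by (simp add: power2_eq_square field_simps)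
  finally have "n * (sin_det r (gam_coord r 0) (gam_coord r 0))\<^sup>2 = (n / 4) ^ r" using n by simp
  then have r0: "(sqrt n * (s * sin_det r (gam_coord r 0) (gam_coord r 0)))\<^sup>2 = (n / 4) ^ r"
    unfolding power_mult_distrib[of "sqrt n"] sq using n by simp
  have eq: "x = y" if "x\<^sup>2 = (n / 4) ^ r" "y\<^sup>2 = (n / 4) ^ r" "0 < x" "0 < y" for x y
    using that by (metis power2_eq_iff_nonneg less_imp_le)
  have pos: "0 < sqrt n * (s * sin_det r (gam_coord r 0) (gam_coord r 0))" using a n by simp
  have cancel: "x = y" if "s * x = s * y" for x y using that s2 by auto
  show "sin_det r (gam_coord r 0) (gam_coord r 0) \<noteq> 0" using a by auto
  have "s * sin_det r (spin_coord r) (gam_coord r 0) = sqrt n * (s * sin_det r (gam_coord r 0) (gam_coord r 0))"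
    by (rule eq[OF _ r0 b pos]) (simp only: sq sin_det_spin_gam_square n_def)
  then have "s * sin_det r (spin_coord r) (gam_coord r 0) = s * (sqrt n * sin_det r (gam_coord r 0) (gam_coord r 0))"
    by (simp only: mult.left_commute)
  then show "sin_det r (spin_coord r) (gam_coord r 0) = sqrt (real (2 * r + 1)) * sin_det r (gam_coord r 0) (gam_coord r 0)"
    unfolding n_def[symmetric] by (rule cancel)
  have "s * sin_det r (spin_coord r) (spin_coord r) = sqrt n * (s * sin_det r (gam_coord r 0) (gam_coord r 0))"
    by (rule eq[OF _ r0 c pos]) (simp only: sq sin_det_spin_square n_def)
  then have "s * sin_det r (spin_coord r) (spin_coord r) = s * (sqrt n * sin_det r (gam_coord r 0) (gam_coord r 0))"
    by (simp only: mult.left_commute)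
  then show "sin_det r (spin_coord r) (spin_coord r) = sqrt (real (2 * r + 1)) * sin_det r (gam_coord r 0) (gam_coord r 0)"
    unfolding n_def[symmetric] by (rule cancel)
qed

section \<open>The modular matrices at level 2\<close>

definition wt_coord :: "nat \<Rightarrow> wt \<Rightarrow> nat \<Rightarrow> real" where
  "wt_coord r \<mu> j = (fin_part r \<mu> + fin_part r rho) $ j"

lemma fin_part_carrier [simp]: "fin_part r \<mu> \<in> carrier_vec r"
  unfolding fin_part_def by (intro finsum_vec_closed) auto

lemma fin_part_index:
  assumes "j < r"
  shows "fin_part r \<mu> $ j = (\<Sum>i\<in>{1..r}. real (\<mu> i) * fund_wt r i $ j)"
proof -
  have "finsum_vec TYPE(real) r (\<lambda>i. real (\<mu> i) \<cdot>\<^sub>v fund_wt r i) A $ j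
      = (\<Sum>i\<in>A. real (\<mu> i) * fund_wt r i $ j)" if "finite A" for A
    using that
  proof (induction A rule: finite_induct)
    case empty
    then show ?case using assms by (simp add: finsum_vec_empty)
  next
    case (insert x F)
    moreover have "finsum_vec TYPE(real) r (\<lambda>i. real (\<mu> i) \<cdot>\<^sub>v fund_wt r i) F \<in> carrier_vec r"
      by (intro finsum_vec_closed) auto
    ultimately show ?case using assms
      by (subst finsum_vec_insert) (auto simp: fund_wt_def)
  qed
  then show ?thesis by (simp add: fin_part_def)
qed

lemma wt_coord_eq:
  assumes "j < r"
  shows "wt_coord r \<mu> j = (\<Sum>i = Suc j..<r. real (\<mu> i)) + real (\<mu> r) / 2 + (real r - real j - 1 / 2)"
proof -
  have *: "(\<Sum>i\<in>{1..r}. f i * fund_wt r i $ j) = (\<Sum>i = Suc j..<r. f i) + f r / 2" for f :: "nat \<Rightarrow> real"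
  proof -
    have "(\<Sum>i\<in>{1..r}. f i * fund_wt r i $ j) = (\<Sum>i\<in>{Suc j..r}. f i * fund_wt r i $ j)"
      using assms by (intro sum.mono_neutral_right) (auto simp: fund_wt_def)
    also have "{Suc j..r} = insert r {Suc j..<r}" using assms by auto
    also have "(\<Sum>i\<in>insert r {Suc j..<r}. f i * fund_wt r i $ j) = f r / 2 + (\<Sum>i = Suc j..<r. f i * fund_wt r i $ j)"
      using assms by (simp add: fund_wt_def)
    also have "(\<Sum>i = Suc j..<r. f i * fund_wt r i $ j) = (\<Sum>i = Suc j..<r. f i)"
      using assms by (intro sum.cong) (auto simp: fund_wt_def)
    finally show ?thesis by simp
  qed
  have "wt_coord r \<mu> j = fin_part r \<mu> $ j + fin_part r rho $ j"
    unfolding wt_coord_def using assms by (simp add: carrier_vecD[OF fin_part_carrier])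
  also have "\<dots> = (\<Sum>i = Suc j..<r. real (\<mu> i)) + real (\<mu> r) / 2 + (real (r - Suc j) + 1 / 2)"
    using assms * [of "\<lambda>i. real (\<mu> i)"] * [of "\<lambda>i. 1"] by (simp add: fin_part_index rho_def)
  finally show ?thesis using assms by (simp add: of_nat_diff)
qed

text \<open>Exchanging the labels 0 and 1 is an affine reflection: the level equation turns it into
  v -> n - v on the first coordinate, the only one that involves the label 1.\<close>

lemma wt_coord_current:
  assumes r: "r \<ge> 2" and \<mu>: "\<mu> \<in> P_plus r 2" and j: "j < r"
  shows "wt_coord r (simple_current \<mu>) j = (if j = 0 then real (2 * r + 1) - wt_coord r \<mu> 0 else wt_coord r \<mu> j)"
proof (cases "j = 0")
  case True
  have *: "(\<Sum>i = Suc 0..<r. real (\<nu> i)) = real (\<nu> 1) + (\<Sum>i = 2..<r. real (\<nu> i))" for \<nu> :: wt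
    using r by (subst sum.atLeast_Suc_lessThan) (auto simp: numeral_2_eq_2)
  have "real (\<mu> 0) + real (\<mu> 1) + 2 * (\<Sum>i = 2..<r. real (\<mu> i)) + real (\<mu> r) = real (\<mu> 0 + \<mu> 1 + 2 * (\<Sum>i\<in>{2..<r}. \<mu> i) + \<mu> r)"
    by simp
  also have "\<dots> = 2" using \<mu> by (simp add: P_plus_def)
  finally show ?thesis
    using True j r by (simp add: wt_coord_eq * simple_current_def)
next
  case False
  then show ?thesis using j r by (simp add: wt_coord_eq simple_current_def)
qed

text \<open>Gathers the scalars in front of the determinant, including the factor that the sign
  changes of the Weyl group contribute. Being nonzero, it cancels from the commutation
  relation.\<close>

definition S_const :: "nat \<Rightarrow> complex" where
  "S_const r = \<i> ^ card (pos_roots r)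
     * complex_of_real (real (2 * r + 1) powr (- real r / 2))
     * complex_of_real (real (P_mod_Q_order r) powr (- 1 / 2)) * (-2 * \<i>) ^ r"

lemma S_const_nonzero: "S_const r \<noteq> 0"
  using P_mod_Q_order_pos[of r] by (simp add: S_const_def)

lemma height_2: "r \<ge> 1 \<Longrightarrow> height r 2 = 2 * r + 1"
  by (simp add: height_def dual_coxeter_def)

lemma S_mat_eq:
  assumes "r \<ge> 1"
  shows "S_mat r 2 \<mu> \<nu> = S_const r * complex_of_real (sin_det r (wt_coord r \<mu>) (wt_coord r \<nu>))"
proof -
  have "S_mat r 2 \<mu> \<nu> = S_const r * complex_of_real (sin_det r (wt_coord r \<nu>) (wt_coord r \<mu>))"
    unfolding S_mat_def height_2[OF assms] S_const_def sin_det_def wt_coord_def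
    by (subst weyl_sum) (auto simp: mult.assoc)
  then show ?thesis by (simp add: sin_det_commute)
qed

lemma sin_int_shift: "sin (2 * pi * real_of_int m - x) = - sin x" "sin (pi * (2 * real_of_int m + 1) - x) = sin x"
proof -
  show "sin (2 * pi * real_of_int m - x) = - sin x" by (simp add: sin_diff cos_int_2pin sin_int_2pin)
  have "sin (pi * (2 * real_of_int m + 1) - x) = sin (2 * pi * real_of_int m + (pi - x))" by (simp add: algebra_simps)
  then show "sin (pi * (2 * real_of_int m + 1) - x) = sin x" by (simp add: sin_add cos_int_2pin sin_int_2pin)
qed

text \<open>Replacing the first coordinate \<open>v\<close> by \<open>n - v\<close> multiplies the first row by a sign, as the
  coordinates of the other weight are all integers or all half-integers.\<close>

lemma S_mat_current:
  assumes r: "r \<ge> 2" and \<mu>: "\<mu> \<in> P_plus r 2"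
  shows "S_mat r 2 (simple_current \<mu>) \<nu> = (-1) ^ \<nu> r * S_mat r 2 \<mu> \<nu>"
proof -
  define n where "n = real (2 * r + 1)"
  have n: "n > 0" by (simp add: n_def)
  have coord: "\<exists>m::int. wt_coord r \<nu> j = real_of_int m + (real (\<nu> r) + 1) / 2" if "j < r" for j
  proof
    show "wt_coord r \<nu> j = real_of_int (int (\<Sum>i = Suc j..<r. \<nu> i) + int r - int j - 1) + (real (\<nu> r) + 1) / 2"
      using that by (simp add: wt_coord_eq field_simps)
  qed
  have sin: "sin (2 * pi * (n - v) * wt_coord r \<nu> j / n) = (-1) ^ \<nu> r * sin (2 * pi * v * wt_coord r \<nu> j / n)"
    if j: "j < r" for v j
  proof -
    obtain m where m: "wt_coord r \<nu> j = real_of_int m + (real (\<nu> r) + 1) / 2" using coord[OF j] ..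
    have "2 * pi * (n - v) * wt_coord r \<nu> j / n = 2 * pi * wt_coord r \<nu> j - 2 * pi * v * wt_coord r \<nu> j / n"
      using n by (simp add: field_simps)
    moreover have "2 * pi * wt_coord r \<nu> j = (if even (\<nu> r) then pi * (2 * real_of_int (m + int (\<nu> r div 2)) + 1) else 2 * pi * real_of_int (m + int (\<nu> r div 2) + 1))"
      unfolding m by (auto elim!: evenE oddE simp: algebra_simps)
    ultimately show ?thesis by (simp only: sin_int_shift split: if_split) simp
  qed
  define s :: "nat \<Rightarrow> real" where "s i = (if i = 0 then (-1) ^ \<nu> r else 1)" for i
  have "mat r r (\<lambda>(i, j). sin (2 * pi * wt_coord r (simple_current \<mu>) i * wt_coord r \<nu> j / n))
    = mat r r (\<lambda>(i, j). s i * 1 * sin (2 * pi * wt_coord r \<mu> i * wt_coord r \<nu> j / n))"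
    using r by (intro eq_matI) (auto simp: wt_coord_current[OF r \<mu>, folded n_def] s_def sin)
  then have "sin_det r (wt_coord r (simple_current \<mu>)) (wt_coord r \<nu>) = (\<Prod>i<r. s i) * sin_det r (wt_coord r \<mu>) (wt_coord r \<nu>)"
    unfolding sin_det_def n_def[symmetric] by (simp only: det_scale) simp
  moreover have "(\<Prod>i<r. s i) = (-1) ^ \<nu> r"
    using r by (simp add: s_def)
  ultimately show ?thesis using r by (simp add: S_mat_eq)
qed

lemma S_mat_commute: "r \<ge> 1 \<Longrightarrow> S_mat r 2 \<mu> \<nu> = S_mat r 2 \<nu> \<mu>"
  by (simp add: S_mat_eq sin_det_commute)

section \<open>Labels for the r + 4 weights, and the entries of S\<close>

datatype idx = Vac | VacJ | Spin | SpinJ | Gam nat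

definition idxs :: "nat \<Rightarrow> idx set" where
  "idxs r = {Vac, VacJ, Spin, SpinJ} \<union> Gam ` {1..r}"

fun wt_of :: "nat \<Rightarrow> idx \<Rightarrow> wt" where
  "wt_of r Vac = gamma_wt r 0"
| "wt_of r VacJ = simple_current (gamma_wt r 0)"
| "wt_of r Spin = spinor_wt r"
| "wt_of r SpinJ = simple_current (spinor_wt r)"
| "wt_of r (Gam a) = gamma_wt r a"

text \<open>\<open>Gam\<close> is meant for 1, ..., r only; \<gamma>^0 has its own constructor since
  J does not fix it. The case a = 1 is separate because \<Lambda>_1 has level 1 and leaves a label 1
  at position 0, and a = r because \<gamma>^r is twice a fundamental weight.\<close>

fun labels :: "nat \<Rightarrow> idx \<Rightarrow> wt" where
  "labels r Vac = (\<lambda>i. if i = 0 then 2 else 0)"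
| "labels r VacJ = (\<lambda>i. if i = 1 then 2 else 0)"
| "labels r Spin = (\<lambda>i. if i = 0 \<or> i = r then 1 else 0)"
| "labels r SpinJ = (\<lambda>i. if i = 1 \<or> i = r then 1 else 0)"
| "labels r (Gam a) = (\<lambda>i. if a = 1 then (if i = 0 \<or> i = 1 then 1 else 0)
      else if a = r then (if i = r then 2 else 0) else if i = a then 1 else 0)"

lemma wt_of_labels:
  assumes "r \<ge> 3" "x \<in> idxs r"
  shows "wt_of r x = labels r x"
proof -
  have "gamma_wt r 0 = labels r Vac" "spinor_wt r = labels r Spin"
    using assms by (auto simp: gamma_wt_def spinor_wt_def level2_wt_def)
  moreover have "gamma_wt r a = labels r (Gam a)" if a: "a \<in> {1..r}" for a
  proof -
    have "(\<Sum>j = 2..<r. if j = a then if a = r then 2 else 1 else 0 :: nat)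
       = (if a \<in> {2..<r} then 1 else 0)" using a by (auto simp: sum.delta)
    then show ?thesis
      using assms a by (auto simp: gamma_wt_def level2_wt_def fun_eq_iff)
  qed
  ultimately show ?thesis
    using assms by (cases x) (auto simp: simple_current_def idxs_def fun_eq_iff)
qed

lemma labels_inj: assumes "r \<ge> 3" shows "inj_on (labels r) (idxs r)"
proof (rule inj_onI)
  fix x y assume xy: "x \<in> idxs r" "y \<in> idxs r" "labels r x = labels r y"
  have *: "x = y"
    if xy: "x \<in> idxs r" "y \<in> idxs r" "labels r x = labels r y" and x: "x \<in> {Vac, VacJ, Spin, SpinJ}" for x y
  proof -
    have "labels r x 0 = labels r y 0" "labels r x 1 = labels r y 1" "labels r x r = labels r y r"
      using xy by simp_all
    then show ?thesis
      using x assms by (cases y) (auto split: if_splits)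
  qed
  show "x = y"
  proof (cases "x \<in> {Vac, VacJ, Spin, SpinJ} \<or> y \<in> {Vac, VacJ, Spin, SpinJ}")
    case True
    then show ?thesis using * [OF xy] * [OF xy(2,1) xy(3)[symmetric]] by metis
  next
    case False
    then obtain a b where ab: "x = Gam a" "y = Gam b" "a \<ge> 1" "b \<ge> 1" using xy(1,2) by (auto simp: idxs_def)
    have "labels r (Gam a) a = labels r (Gam b) a" "labels r (Gam a) b = labels r (Gam b) b"
      using xy(3) ab by simp_all
    then show ?thesis using ab assms by (auto split: if_splits)
  qed
qed

lemma sum_eq_2_cases:
  fixes a b c :: nat
  assumes "a + b + c = 2"
  shows "a = 2 \<and> b = 0 \<and> c = 0 \<or> a = 0 \<and> b = 2 \<and> c = 0 \<or> a = 0 \<and> b = 0 \<and> c = 2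
    \<or> a = 1 \<and> b = 1 \<and> c = 0 \<or> a = 1 \<and> b = 0 \<and> c = 1 \<or> a = 0 \<and> b = 1 \<and> c = 1"
  using assms by (cases "a = 0"; cases "a = 1"; cases "b = 0"; cases "b = 1") auto

text \<open>Labels strictly between 1 and r cost 2 in the level. Either one of them equals 1 and
  exhausts the level, or all vanish and the labels at 0, 1 and r sum to 2, which has six
  solutions.\<close>

lemma labels_P_plus: assumes "r \<ge> 3" shows "labels r ` idxs r = P_plus r 2"
proof (intro equalityI subsetI)
  fix \<mu> assume "\<mu> \<in> labels r ` idxs r"
  then obtain x where x: "\<mu> = labels r x" "x \<in> idxs r" by auto
  show "\<mu> \<in> P_plus r 2"
  proof (cases x)
    case (Gam a)
    have "(\<Sum>j = 2..<r. labels r (Gam a) j) = (\<Sum>j = 2..<r. if j = a then 1 else 0)"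
      using assms by (intro sum.cong) auto
    then show ?thesis using x Gam assms by (auto simp: P_plus_def idxs_def)
  qed (use x assms in \<open>auto simp: P_plus_def\<close>)
next
  fix \<mu> assume \<mu>: "\<mu> \<in> P_plus r 2"
  then have z: "\<And>i. i > r \<Longrightarrow> \<mu> i = 0" and lev: "2 = \<mu> 0 + \<mu> 1 + 2 * (\<Sum>i\<in>{2..<r}. \<mu> i) + \<mu> r"
    by (auto simp: P_plus_def)
  show "\<mu> \<in> labels r ` idxs r"
  proof (cases "(\<Sum>i\<in>{2..<r}. \<mu> i) = 0")
    case False
    then have "(\<Sum>i\<in>{2..<r}. \<mu> i) = Suc 0" and e: "\<mu> 0 = 0" "\<mu> 1 = 0" "\<mu> r = 0" using lev by linarith+
    then obtain a where a: "a \<in> {2..<r}" "\<mu> a = 1" "\<forall>b\<in>{2..<r}. a \<noteq> b \<longrightarrow> \<mu> b = 0"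
      by (subst (asm) sum_eq_Suc0_iff) auto
    have "\<mu> i = labels r (Gam a) i" for i
    proof -
      consider "i = 0" | "i = 1" | "i \<in> {2..<r}" | "i = r" | "i > r" by fastforce
      then show ?thesis using a e z assms by cases auto
    qed
    then show ?thesis using a by (intro image_eqI[of _ _ "Gam a"]) (auto simp: idxs_def)
  next
    case True
    then have b: "\<forall>i\<in>{2..<r}. \<mu> i = 0" by simp
    have eq: "\<mu> = \<nu>" if "\<mu> 0 = \<nu> 0" "\<mu> 1 = \<nu> 1" "\<mu> r = \<nu> r" "\<And>i. i > 1 \<Longrightarrow> i \<noteq> r \<Longrightarrow> \<nu> i = 0" for \<nu>
    proof
      fix i
      consider "i = 0" | "i = 1" | "i \<in> {2..<r}" | "i = r" | "i > r" by fastforce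
      then show "\<mu> i = \<nu> i" using that b z assms by cases auto
    qed
    have "\<mu> 0 + \<mu> 1 + \<mu> r = 2" using lev True by simp
    from sum_eq_2_cases[OF this] show ?thesis
    proof (elim disjE conjE, goal_cases)
      case 1
      then show ?case using assms by (intro image_eqI[of _ _ Vac, OF eq]) (auto simp: idxs_def)
    next
      case 2
      then show ?case using assms by (intro image_eqI[of _ _ VacJ, OF eq]) (auto simp: idxs_def)
    next
      case 3
      then show ?case using assms by (intro image_eqI[of _ _ "Gam r", OF eq]) (auto simp: idxs_def)
    next
      case 4
      then show ?case using assms by (intro image_eqI[of _ _ "Gam 1", OF eq]) (auto simp: idxs_def)
    next
      case 5
      then show ?case using assms by (intro image_eqI[of _ _ Spin, OF eq]) (auto simp: idxs_def)
    next
      case 6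
      then show ?case using assms by (intro image_eqI[of _ _ SpinJ, OF eq]) (auto simp: idxs_def)
    qed
  qed
qed

lemma wt_of_bij:
  assumes "r \<ge> 3"
  shows "bij_betw (wt_of r) (idxs r) (P_plus r 2)"
proof -
  have "bij_betw (labels r) (idxs r) (P_plus r 2)"
    using labels_inj[OF assms] labels_P_plus[OF assms] by (simp add: bij_betw_def)
  then show ?thesis using wt_of_labels[OF assms] by (subst bij_betw_cong) auto
qed

lemma sum_idxs:
  fixes f :: "idx \<Rightarrow> 'a :: comm_monoid_add"
  shows "(\<Sum>k\<in>idxs r. f k) = f Vac + f VacJ + f Spin + f SpinJ + (\<Sum>a = 1..r. f (Gam a))"
proof -
  have "(\<Sum>k\<in>idxs r. f k) = (\<Sum>k\<in>{Vac, VacJ, Spin, SpinJ}. f k) + (\<Sum>k\<in>Gam ` {1..r}. f k)"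
    unfolding idxs_def by (intro sum.union_disjoint) auto
  also have "(\<Sum>k\<in>Gam ` {1..r}. f k) = (\<Sum>a = 1..r. f (Gam a))"
    by (subst sum.reindex) (auto intro: inj_onI)
  finally show ?thesis by (simp add: add.assoc)
qed

lemma gamma_wt_coord:
  assumes "r \<ge> 3" "a \<le> r" "j < r"
  shows "wt_coord r (gamma_wt r a) j = gam_coord r a j"
proof (cases "a = 0")
  case True
  have "(\<Sum>i = Suc j..<r. real (labels r Vac i)) = 0" by (intro sum.neutral) auto
  then show ?thesis
    using assms True wt_of_labels[of r Vac]
    by (simp add: wt_coord_eq gam_coord_def idxs_def field_simps)
next
  case False
  have "(\<Sum>i = Suc j..<r. real (labels r (Gam a) i)) = (\<Sum>i = Suc j..<r. if i = a then 1 else 0)"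
    using assms by (intro sum.cong) auto
  then show ?thesis
    using assms False wt_of_labels[of r "Gam a"]
    by (auto simp: wt_coord_eq gam_coord_def idxs_def insert_index_def field_simps)
qed

lemma spinor_wt_coord:
  assumes "r \<ge> 3" "j < r"
  shows "wt_coord r (spinor_wt r) j = spin_coord r j"
proof -
  have "(\<Sum>i = Suc j..<r. real (labels r Spin i)) = 0" by (intro sum.neutral) auto
  then show ?thesis
    using assms wt_of_labels[of r Spin] by (simp add: wt_coord_eq spin_coord_def idxs_def)
qed

fun index_of :: "idx \<Rightarrow> nat" where
  "index_of (Gam a) = a" | "index_of _ = 0"

fun spinor :: "idx \<Rightarrow> bool" where
  "spinor Spin = True" | "spinor SpinJ = True" | "spinor _ = False"

text \<open>The coupling to the spinors: antisymmetric under J on the pair 0, J0 and on the two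
  spinors, and zero on the J-fixed weights.\<close>

fun charge :: "idx \<Rightarrow> real" where
  "charge Vac = 1" | "charge VacJ = -1" | "charge Spin = 1" | "charge SpinJ = -1" | "charge (Gam a) = 0"

fun mult_of :: "idx \<Rightarrow> real" where
  "mult_of (Gam a) = 2" | "mult_of _ = 1"

definition S_idx :: "nat \<Rightarrow> idx \<Rightarrow> idx \<Rightarrow> real" where
  "S_idx r i j =
    (if spinor i then (if spinor j then charge i * charge j else charge j) * sqrt (real (2 * r + 1))
     else if spinor j then charge i * sqrt (real (2 * r + 1))
     else mult_of i * mult_of j * cos (2 * pi * real (index_of i) * real (index_of j) / real (2 * r + 1)))"

lemma S_idx_commute: "S_idx r i j = S_idx r j i"
  by (simp add: S_idx_def mult_ac)

lemma wt_of_P_plus: "r \<ge> 3 \<Longrightarrow> x \<in> idxs r \<Longrightarrow> wt_of r x \<in> P_plus r 2"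
  using wt_of_bij[of r] by (auto simp: bij_betw_def)

lemma sin_det_cong: "(\<And>j. j < r \<Longrightarrow> u j = u' j) \<Longrightarrow> (\<And>j. j < r \<Longrightarrow> v j = v' j) \<Longrightarrow> sin_det r u v = sin_det r u' v'"
  unfolding sin_det_def by (intro arg_cong[where f = det] eq_matI) auto

definition S_norm :: "nat \<Rightarrow> complex" where
  "S_norm r = S_const r * complex_of_real (sin_det r (gam_coord r 0) (gam_coord r 0))"

lemma S_norm_nonzero: "S_norm r \<noteq> 0"
  using S_const_nonzero sin_det_spin_values(1) by (simp add: S_norm_def)

text \<open>Determinants are evaluated only for \<open>Vac\<close>, \<open>Spin\<close> and the
  \<open>Gam a\<close>; symmetry of S and the sign rule for the simple current yield the rows and
  columns of \<open>VacJ\<close> and \<open>SpinJ\<close>.\<close>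

lemma S_mat_idx:
  assumes r: "r \<ge> 3" and ij: "i \<in> idxs r" "j \<in> idxs r"
  shows "S_mat r 2 (wt_of r i) (wt_of r j) = S_norm r * complex_of_real (S_idx r i j)"
proof -
  let ?W = "wt_of r"
  define S0 where "S0 i j = (S_mat r 2 (?W i) (?W j) = S_norm r * complex_of_real (S_idx r i j))" for i j
  have sym: "S0 i j \<Longrightarrow> S0 j i" for i j
    using r S_mat_commute[of r "?W i" "?W j"] S_idx_commute[of r i j] by (simp add: S0_def)
  have gg: "S0 i j"
    if "i = Vac \<and> a = 0 \<or> i = Gam a \<and> a \<in> {1..r}" "j = Vac \<and> b = 0 \<or> j = Gam b \<and> b \<in> {1..r}" for i j a b
  proof -
    have W: "?W i = gamma_wt r a" "?W j = gamma_wt r b" and ab: "a \<le> r" "b \<le> r" using that by auto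
    have "sin_det r (wt_coord r (gamma_wt r a)) (wt_coord r (gamma_wt r b)) = sin_det r (gam_coord r a) (gam_coord r b)"
      using r ab by (intro sin_det_cong gamma_wt_coord)
    also have "\<dots> = S_idx r i j * sin_det r (gam_coord r 0) (gam_coord r 0)"
      using that by (auto simp: sin_det_gam_value S_idx_def half_wt_def)
    finally show ?thesis using r by (simp add: S0_def W S_mat_eq S_norm_def)
  qed
  have sg: "S0 Spin j" if "j = Vac \<and> b = 0 \<or> j = Gam b \<and> b \<in> {1..r}" for j b
  proof -
    have W: "?W j = gamma_wt r b" and b: "b \<le> r" using that by auto
    have "sin_det r (wt_coord r (spinor_wt r)) (wt_coord r (gamma_wt r b)) = sin_det r (spin_coord r) (gam_coord r b)"
      using r b by (intro sin_det_cong gamma_wt_coord spinor_wt_coord)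
    also have "\<dots> = S_idx r Spin j * sin_det r (gam_coord r 0) (gam_coord r 0)"
      using that by (auto simp: sin_det_spin_values sin_det_spin_gam_zero S_idx_def)
    finally show ?thesis using r by (simp add: S0_def W S_mat_eq S_norm_def)
  qed
  have ss: "S0 Spin Spin"
  proof -
    have "sin_det r (wt_coord r (spinor_wt r)) (wt_coord r (spinor_wt r)) = sin_det r (spin_coord r) (spin_coord r)"
      using r by (intro sin_det_cong spinor_wt_coord)
    then show ?thesis using r by (simp add: S0_def S_mat_eq S_norm_def S_idx_def sin_det_spin_values)
  qed
  have "labels r x r = (if spinor x then 1 else if x = Gam r then 2 else 0)" if "x \<in> idxs r" for x
    using that r by (cases x) (auto simp: idxs_def)
  then have sgn: "(-1) ^ wt_of r x r = (if spinor x then -1 else 1 :: complex)" if "x \<in> idxs r" for x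
    using that r by (simp add: wt_of_labels)
  have J: "S0 VacJ j" if j: "S0 Vac j" "j \<in> idxs r" for j
  proof -
    have "S_mat r 2 (?W VacJ) (?W j) = (if spinor j then -1 else 1) * S_mat r 2 (?W Vac) (?W j)"
      unfolding sgn[OF j(2), symmetric] wt_of.simps(2,4)
      using r wt_of_P_plus[of r Vac] by (subst S_mat_current) (auto simp: idxs_def)
    also have "\<dots> = S_norm r * complex_of_real ((if spinor j then -1 else 1) * S_idx r Vac j)"
      using j(1) by (simp add: S0_def del: wt_of.simps)
    also have "(if spinor j then -1 else 1) * S_idx r Vac j = S_idx r VacJ j"
      by (cases j) (simp_all add: S_idx_def)
    finally show ?thesis by (simp add: S0_def)
  qed
  have J': "S0 SpinJ j" if j: "S0 Spin j" "j \<in> idxs r" for j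
  proof -
    have "S_mat r 2 (?W SpinJ) (?W j) = (if spinor j then -1 else 1) * S_mat r 2 (?W Spin) (?W j)"
      unfolding sgn[OF j(2), symmetric] wt_of.simps(2,4)
      using r wt_of_P_plus[of r Spin] by (subst S_mat_current) (auto simp: idxs_def)
    also have "\<dots> = S_norm r * complex_of_real ((if spinor j then -1 else 1) * S_idx r Spin j)"
      using j(1) by (simp add: S0_def del: wt_of.simps)
    also have "(if spinor j then -1 else 1) * S_idx r Spin j = S_idx r SpinJ j"
      by (cases j) (simp_all add: S_idx_def)
    finally show ?thesis by (simp add: S0_def)
  qed
  have base: "S0 i j" if "i \<in> {Vac, Spin} \<union> Gam ` {1..r}" "j \<in> {Vac, Spin} \<union> Gam ` {1..r}" for i j
  proof -
    have ex: "\<exists>a. x = Vac \<and> a = 0 \<or> x = Gam a \<and> a \<in> {1..r}" if "x \<in> {Vac, Spin} \<union> Gam ` {1..r}" "x \<noteq> Spin" for x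
      using that by auto
    consider "i = Spin" "j = Spin" | "i = Spin" "j \<noteq> Spin" | "i \<noteq> Spin" "j = Spin" | "i \<noteq> Spin" "j \<noteq> Spin"
      by auto
    then show ?thesis
    proof cases
      case 1
      then show ?thesis using ss by simp
    next
      case 2
      then show ?thesis using ex[OF that(2)] sg by metis
    next
      case 3
      then show ?thesis using ex[OF that(1)] sg sym by metis
    next
      case 4
      then show ?thesis using ex[OF that(1)] ex[OF that(2)] gg by metis
    qed
  qed
  have all: "S0 i j" if i: "i \<in> {Vac, Spin} \<union> Gam ` {1..r}" and j: "j \<in> idxs r" for i j
  proof -
    have i': "i \<in> idxs r" using i by (auto simp: idxs_def)
    show ?thesis
    proof (cases "j \<in> {Vac, Spin} \<union> Gam ` {1..r}")
      case False
      then have "j = VacJ \<or> j = SpinJ" using j by (auto simp: idxs_def)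
      then show ?thesis using base[OF i] i' J J' sym by auto
    qed (use base i in auto)
  qed
  have "S0 i j"
  proof (cases "i \<in> {Vac, Spin} \<union> Gam ` {1..r}")
    case False
    then have "i = VacJ \<or> i = SpinJ" using ij by (auto simp: idxs_def)
    then show ?thesis using all[OF _ ij(2)] ij J J' by auto
  qed (use all ij in auto)
  then show ?thesis by (simp add: S0_def)
qed

section \<open>Eigenvalues of T relative to the vacuum\<close>

fun T_idx :: "nat \<Rightarrow> idx \<Rightarrow> complex" where
  "T_idx r Spin = cis (pi * real r / 4)"
| "T_idx r SpinJ = - cis (pi * real r / 4)"
| "T_idx r (Gam a) = cis (pi * real (a * (2 * r + 1 - a)) / real (2 * r + 1))"
| "T_idx r _ = 1"

definition norm_sq :: "nat \<Rightarrow> (nat \<Rightarrow> real) \<Rightarrow> real" where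
  "norm_sq r v = (\<Sum>j<r. (v j)\<^sup>2)"

lemma T_mat_eq:
  assumes "r \<ge> 1"
  shows "T_mat r 2 \<mu> \<mu> = cis (pi * norm_sq r (wt_coord r \<mu>) / real (2 * r + 1))
    * exp (- (complex_of_real pi * \<i> * complex_of_real (fin_part r rho \<bullet> fin_part r rho) / of_nat (dual_coxeter r)))"
proof -
  have "(fin_part r \<mu> + fin_part r rho) \<bullet> (fin_part r \<mu> + fin_part r rho) = norm_sq r (wt_coord r \<mu>)"
    unfolding norm_sq_def wt_coord_def scalar_prod_def
    by (simp add: carrier_vecD[OF fin_part_carrier] power2_eq_square lessThan_atLeast0)
  then show ?thesis
    using height_2[OF assms] by (simp add: T_mat_def cis_conv_exp exp_diff exp_minus divide_inverse mult_ac)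
qed

definition T_norm :: "nat \<Rightarrow> complex" where
  "T_norm r = T_mat r 2 (wt_of r Vac) (wt_of r Vac)"

lemma T_norm_nonzero: "r \<ge> 1 \<Longrightarrow> T_norm r \<noteq> 0"
  by (simp add: T_norm_def T_mat_eq)

lemma sum_insert_index: "a \<le> r \<Longrightarrow> (\<Sum>j<r. f (insert_index a j)) + f a = (\<Sum>p\<le>r. f p)" for f :: "nat \<Rightarrow> real"
proof (induction r)
  case (Suc r)
  show ?case
  proof (cases "a = Suc r")
    case True
    have "(\<Sum>j<Suc r. f (insert_index a j)) = (\<Sum>j<Suc r. f j)" using True by (intro sum.cong) auto
    then show ?thesis using True by (simp add: lessThan_Suc_atMost)
  next
    case False
    then show ?thesis using Suc by simp
  qed
qed simp

text \<open>Both sets of coordinates together with their omitted node exhaust the same r + 1 nodes,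
  so the difference is (n/2)^2 - (n/2 - a)^2.\<close>

lemma norm_sq_gam:
  assumes "a \<le> r"
  shows "norm_sq r (gam_coord r a) - norm_sq r (gam_coord r 0) = real (a * (2 * r + 1 - a))"
proof -
  have "norm_sq r (gam_coord r a) + (real (2 * r + 1) / 2 - real a)\<^sup>2 = norm_sq r (gam_coord r 0) + (real (2 * r + 1) / 2 - real 0)\<^sup>2"
    unfolding norm_sq_def gam_coord_def
    using sum_insert_index[OF assms, of "\<lambda>p. (real (2 * r + 1) / 2 - real p)\<^sup>2"]
      sum_insert_index[of 0 r "\<lambda>p. (real (2 * r + 1) / 2 - real p)\<^sup>2"] by simp
  moreover have "real (a * (2 * r + 1 - a)) = real a * (real (2 * r + 1) - real a)"
    using assms unfolding of_nat_mult by (subst of_nat_diff) auto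
  ultimately show ?thesis by (simp add: power2_eq_square algebra_simps)
qed

lemma norm_sq_spin: "norm_sq r (spin_coord r) - norm_sq r (gam_coord r 0) = real r * real (2 * r + 1) / 4"
proof -
  have "norm_sq r (spin_coord r) - norm_sq r (gam_coord r 0) = (\<Sum>j<r. real (r - j) - 1 / 4)"
    unfolding norm_sq_def sum_subtractf[symmetric] spin_coord_def gam_coord_def
    by (intro sum.cong) (auto simp: of_nat_diff power2_eq_square algebra_simps)
  also have "\<dots> = (\<Sum>c = 1..r. real c) - real r / 4"
    using sum_rev_index[of real r] by (simp add: sum_subtractf lessThan_atLeast0)
  also have "(\<Sum>c = 1..r. real c) = real r * (real r + 1) / 2"
    by (induction r) (simp_all add: field_simps)
  finally show ?thesis by (simp add: field_simps)
qed

lemma norm_sq_current: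
  assumes r: "r \<ge> 2" and \<mu>: "\<mu> \<in> P_plus r 2"
  shows "norm_sq r (wt_coord r (simple_current \<mu>)) - norm_sq r (wt_coord r \<mu>)
    = real (2 * r + 1) * (real (2 * r + 1) - 2 * wt_coord r \<mu> 0)"
proof -
  obtain q where q: "r = Suc q" using r by (cases r) auto
  have "(\<Sum>j<r. f j) = f 0 + (\<Sum>j<q. f (Suc j))" for f :: "nat \<Rightarrow> real"
    unfolding q by (rule sum.lessThan_Suc_shift)
  moreover have "(\<Sum>j<q. (wt_coord r (simple_current \<mu>) (Suc j))\<^sup>2) = (\<Sum>j<q. (wt_coord r \<mu> (Suc j))\<^sup>2)"
    using wt_coord_current[OF assms] q by (intro sum.cong) auto
  moreover have "wt_coord r (simple_current \<mu>) 0 = real (2 * r + 1) - wt_coord r \<mu> 0"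
    using wt_coord_current[OF assms, of 0] r by simp
  ultimately have "norm_sq r (wt_coord r (simple_current \<mu>)) - norm_sq r (wt_coord r \<mu>)
      = (real (2 * r + 1) - wt_coord r \<mu> 0)\<^sup>2 - (wt_coord r \<mu> 0)\<^sup>2"
    unfolding norm_sq_def by simp
  then show ?thesis by (simp add: power2_eq_square algebra_simps)
qed

lemma norm_sq_cong: "(\<And>j. j < r \<Longrightarrow> u j = v j) \<Longrightarrow> norm_sq r u = norm_sq r v"
  by (simp add: norm_sq_def)

text \<open>J changes the squared norm by n(n - 2v) with v the first coordinate. This is 2n at 0,
  invisible in the exponential, and n at the spinor, whence the opposite eigenvalues of the two
  spinors.\<close>

lemma T_mat_idx:
  assumes r: "r \<ge> 3" and i: "i \<in> idxs r"
  shows "T_mat r 2 (wt_of r i) (wt_of r i) = T_norm r * T_idx r i"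
proof -
  define n where "n = real (2 * r + 1)"
  have n: "n > 0" by (simp add: n_def)
  define d where "d \<mu> = norm_sq r (wt_coord r \<mu>)" for \<mu>
  have T: "T_mat r 2 \<mu> \<mu> = T_norm r * cis (pi * (d \<mu> - d (gamma_wt r 0)) / n)" for \<mu>
    using r unfolding T_norm_def n_def d_def
    by (simp add: T_mat_eq right_diff_distrib diff_divide_distrib flip: cis_mult cis_divide)
  have g: "d (gamma_wt r a) = norm_sq r (gam_coord r a)" if "a \<le> r" for a
    unfolding d_def using r that by (intro norm_sq_cong gamma_wt_coord)
  have s: "d (spinor_wt r) = norm_sq r (spin_coord r)"
    unfolding d_def using r by (intro norm_sq_cong spinor_wt_coord)
  have J: "d (simple_current \<mu>) - d \<mu> = n * (n - 2 * wt_coord r \<mu> 0)" if "\<mu> \<in> P_plus r 2" for \<mu>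
    unfolding d_def n_def using r that by (intro norm_sq_current) auto
  have "cis (pi * (d (wt_of r i) - d (gamma_wt r 0)) / n) = T_idx r i"
  proof (cases i)
    case Spin
    have e: "d (spinor_wt r) - d (gamma_wt r 0) = real r * n / 4"
      using norm_sq_spin[of r] by (simp add: g s n_def)
    show ?thesis using n unfolding Spin wt_of.simps e by simp
  next
    case SpinJ
    have P: "spinor_wt r \<in> P_plus r 2" using wt_of_P_plus[of r Spin] r by (simp add: idxs_def)
    have c: "wt_coord r (spinor_wt r) 0 = spin_coord r 0" using spinor_wt_coord[of r 0] r by simp
    have "d (simple_current (spinor_wt r)) - d (spinor_wt r) = n * (n - 2 * spin_coord r 0)"
      using J[OF P] by (simp only: c)
    also have "n - 2 * spin_coord r 0 = 1" by (simp add: n_def spin_coord_def)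
    finally have "d (simple_current (spinor_wt r)) - d (spinor_wt r) = n" by simp
    moreover have "d (spinor_wt r) - d (gamma_wt r 0) = real r * n / 4"
      using norm_sq_spin[of r] by (simp add: g s n_def)
    ultimately have e: "d (simple_current (spinor_wt r)) - d (gamma_wt r 0) = real r * n / 4 + n" by linarith
    have "pi * (real r * n / 4 + n) / n = pi * real r / 4 + pi" using n by (simp add: field_simps)
    then show ?thesis unfolding SpinJ wt_of.simps e by (simp add: cis_mult[symmetric])
  next
    case VacJ
    have "d (wt_of r i) - d (gamma_wt r 0) = n * (n - 2 * gam_coord r 0 0)"
      using J[of "gamma_wt r 0"] wt_of_P_plus[of r Vac] gamma_wt_coord[of r 0 0] r VacJ by (simp add: idxs_def)
    also have "n - 2 * gam_coord r 0 0 = 2" by (simp add: n_def gam_coord_def field_simps)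
    finally show ?thesis using VacJ n by (simp add: complex_eq_iff mult.commute)
  next
    case (Gam a)
    then have "a \<le> r" using i by (auto simp: idxs_def)
    then show ?thesis using Gam norm_sq_gam[of a r] by (simp add: g n_def)
  qed simp
  then show ?thesis unfolding T by simp
qed

section \<open>Periodic kernels commuting with the Fourier transform\<close>

definition om :: "nat \<Rightarrow> int \<Rightarrow> complex" where
  "om n m = cis (2 * pi * real_of_int m / real n)"

lemma om_add: "om n (a + b) = om n a * om n b"
  by (simp add: om_def cis_mult distrib_left add_divide_distrib)

lemma om_0 [simp]: "om n 0 = 1"
  by (simp add: om_def)

lemma om_eq_1: "n > 0 \<Longrightarrow> int n dvd m \<Longrightarrow> om n m = 1"
  by (simp add: om_def cis_eq_1_iff_int)

lemma om_cong: "n > 0 \<Longrightarrow> int n dvd a - b \<Longrightarrow> om n a = om n b"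
  using om_add[of n "a - b" b] om_eq_1[of n "a - b"] by simp

lemma om_sum:
  assumes "n > 0"
  shows "(\<Sum>z\<in>{0..<int n}. om n (z * m)) = (if int n dvd m then of_nat n else 0)"
proof -
  have "{0..<int n} = int ` {..<n}" by (simp add: lessThan_atLeast0 image_int_atLeastLessThan)
  then have "(\<Sum>z\<in>{0..<int n}. om n (z * m)) = (\<Sum>t<n. om n (int t * m))"
    by (simp add: sum.reindex)
  then show ?thesis unfolding om_def character_sum[OF assms] .
qed

lemma sum_rotate: "(\<Sum>z\<in>A. \<Sum>p\<in>B. \<Sum>q\<in>C. f z p q) = (\<Sum>p\<in>B. \<Sum>q\<in>C. \<Sum>z\<in>A. f z p q)"
  for f :: "'a \<Rightarrow> 'b \<Rightarrow> 'c \<Rightarrow> 'd :: comm_monoid_add"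
  by (subst sum.swap) (rule sum.cong[OF refl], rule sum.swap)

definition per :: "nat \<Rightarrow> (int \<Rightarrow> 'a) \<Rightarrow> bool" where
  "per n f \<longleftrightarrow> (\<forall>x y. int n dvd x - y \<longrightarrow> f x = f y)"

lemma perD: "per n f \<Longrightarrow> int n dvd x - y \<Longrightarrow> f x = f y"
  by (auto simp: per_def)

lemma per_mod: "per n f \<Longrightarrow> f (x mod int n) = f x"
  by (erule perD) (simp add: mod_eq_dvd_iff[symmetric])

lemma sum_shift:
  fixes f :: "int \<Rightarrow> 'a :: comm_monoid_add"
  assumes "n > 0" "per n f"
  shows "(\<Sum>x\<in>{0..<int n}. f (x + c)) = (\<Sum>x\<in>{0..<int n}. f x)"
  using assms
  by (intro sum.reindex_bij_witness[of _ "\<lambda>y. (y - c) mod int n" "\<lambda>x. (x + c) mod int n"])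
     (auto simp: per_mod mod_simps)

lemma sum_delta_mod:
  fixes f :: "int \<Rightarrow> complex"
  assumes "n > 0" "per n f"
  shows "(\<Sum>q\<in>{0..<int n}. if int n dvd q - a then f q else 0) = f a"
proof -
  have "int n dvd q - a \<longleftrightarrow> q = a mod int n" if "q \<in> {0..<int n}" for q
    using that by (auto simp: mod_eq_dvd_iff[symmetric])
  then have "(\<Sum>q\<in>{0..<int n}. if int n dvd q - a then f q else 0) = (\<Sum>q\<in>{0..<int n}. if q = a mod int n then f q else 0)"
    by (intro sum.cong) auto
  then show ?thesis using assms by (simp add: per_mod)
qed

section \<open>Operators on the integers modulo n and their Heisenberg coefficients\<close>

definition kernel :: "nat \<Rightarrow> (int \<Rightarrow> int \<Rightarrow> complex) \<Rightarrow> bool" where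
  "kernel n L \<longleftrightarrow> (\<forall>x. per n (L x)) \<and> (\<forall>y. per n (\<lambda>x. L x y))"

lemma kernelD:
  assumes "kernel n L" "int n dvd x - x'" "int n dvd y - y'"
  shows "L x y = L x' y'"
  using assms perD[of n "L x" y y'] perD[of n "\<lambda>x. L x y'" x x'] by (simp add: kernel_def)

text \<open>A discrete ambiguity function: the half-difference \<open>u\<close> is kept and the
  half-sum \<open>z\<close> is Fourier transformed. Up to normalisation these are the coefficients
  of the operator \<open>L\<close> with respect to the shifts and modulations of the Heisenberg
  group, on which SL2 acts linearly.\<close>

definition htrans :: "nat \<Rightarrow> (int \<Rightarrow> int \<Rightarrow> complex) \<Rightarrow> int \<Rightarrow> int \<Rightarrow> complex" where
  "htrans n L u w = (\<Sum>z\<in>{0..<int n}. L (z + u) (z - u) * om n (2 * z * w))"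

text \<open>The kernel of F L F^(-1), where F is the Fourier transform; the division by n accounts
  for F and its adjoint being unnormalised.\<close>

definition fconj :: "nat \<Rightarrow> (int \<Rightarrow> int \<Rightarrow> complex) \<Rightarrow> int \<Rightarrow> int \<Rightarrow> complex" where
  "fconj n L x y = (\<Sum>p\<in>{0..<int n}. \<Sum>q\<in>{0..<int n}. om n (x * p - q * y) * L p q) / of_nat n"

lemma fconj_kernel: assumes "n > 0" shows "kernel n (fconj n L)"
proof -
  have "om n (x * p - q * y) = om n (x' * p - q * y')" if "int n dvd x - x'" "int n dvd y - y'" for x x' y y' p q
  proof (rule om_cong[OF assms])
    have "x * p - q * y - (x' * p - q * y') = (x - x') * p - q * (y - y')" by (simp add: algebra_simps)
    then show "int n dvd x * p - q * y - (x' * p - q * y')" using that by simp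
  qed
  then show ?thesis
    unfolding kernel_def per_def fconj_def
    by (intro conjI allI impI arg_cong2[where f = "(/)"] arg_cong2[where f = "(*)"] sum.cong refl) simp_all
qed

text \<open>Conjugation by the Fourier transform rotates phase space. The sum over \<open>z\<close>
  forces q = p + 2w, and shifting \<open>p\<close> by \<open>w\<close> restores the form of the
  transform with the arguments exchanged.\<close>

lemma htrans_fconj:
  assumes n: "n > 0" and L: "kernel n L"
  shows "htrans n (fconj n L) u w = htrans n L (- w) u"
proof -
  let ?Z = "{0..<int n}"
  have "htrans n (fconj n L) u w
      = (\<Sum>z\<in>?Z. \<Sum>p\<in>?Z. \<Sum>q\<in>?Z. om n (z * (p - q + 2 * w)) * (om n (u * (p + q)) * L p q / of_nat n))"
    unfolding htrans_def fconj_def sum_divide_distrib sum_distrib_right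
  proof (intro sum.cong refl)
    fix z p q
    have "om n ((z + u) * p - q * (z - u)) * om n (2 * z * w) = om n (z * (p - q + 2 * w)) * om n (u * (p + q))"
      unfolding om_add[symmetric] by (simp add: algebra_simps)
    then show "om n ((z + u) * p - q * (z - u)) * L p q / of_nat n * om n (2 * z * w)
      = om n (z * (p - q + 2 * w)) * (om n (u * (p + q)) * L p q / of_nat n)"
      by (simp add: field_simps)
  qed
  also have "\<dots> = (\<Sum>p\<in>?Z. \<Sum>q\<in>?Z. (\<Sum>z\<in>?Z. om n (z * (p - q + 2 * w))) * (om n (u * (p + q)) * L p q / of_nat n))"
    by (subst sum_rotate) (simp only: sum_distrib_right)
  also have "\<dots> = (\<Sum>p\<in>?Z. \<Sum>q\<in>?Z. if int n dvd q - (p + 2 * w) then om n (u * (p + q)) * L p q else 0)"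
  proof (intro sum.cong refl)
    fix p q
    have "int n dvd p - q + 2 * w \<longleftrightarrow> int n dvd q - (p + 2 * w)"
      using dvd_diff_commute[of "int n" "p + 2 * w" q] by (simp add: algebra_simps)
    then show "(\<Sum>z\<in>?Z. om n (z * (p - q + 2 * w))) * (om n (u * (p + q)) * L p q / of_nat n)
      = (if int n dvd q - (p + 2 * w) then om n (u * (p + q)) * L p q else 0)"
      using n by (simp add: om_sum)
  qed
  also have "\<dots> = (\<Sum>p\<in>?Z. om n (u * (p + (p + 2 * w))) * L p (p + 2 * w))"
  proof (rule sum.cong[OF refl], rule sum_delta_mod[OF n])
    fix p show "per n (\<lambda>q. om n (u * (p + q)) * L p q)"
      unfolding per_def
    proof (intro allI impI arg_cong2[where f = "(*)"])
      fix x y assume xy: "int n dvd x - y"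
      show "L p x = L p y" using kernelD[OF L, of p p x y] xy by simp
      have "u * (p + x) - u * (p + y) = u * (x - y)" by (simp add: algebra_simps)
      then show "om n (u * (p + x)) = om n (u * (p + y))" using xy by (intro om_cong[OF n]) simp
    qed
  qed
  also have "\<dots> = (\<Sum>p\<in>?Z. (\<lambda>z. L (z + - w) (z - - w) * om n (2 * z * u)) (p + w))"
  proof (rule sum.cong[OF refl])
    fix p
    have "u * (p + (p + 2 * w)) = 2 * (p + w) * u" "p + w - - w = p + 2 * w" "p + w + - w = p" by (simp_all add: algebra_simps)
    then show "om n (u * (p + (p + 2 * w))) * L p (p + 2 * w) = (\<lambda>z. L (z + - w) (z - - w) * om n (2 * z * u)) (p + w)"
      by (simp only: mult.commute[of "om n _"])
  qed
  also have "\<dots> = htrans n L (- w) u"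
    unfolding htrans_def
  proof (rule sum_shift[OF n])
    show "per n (\<lambda>z. L (z + - w) (z - - w) * om n (2 * z * u))"
      unfolding per_def
    proof (intro allI impI arg_cong2[where f = "(*)"])
      fix x y assume xy: "int n dvd x - y"
      show "L (x + - w) (x - - w) = L (y + - w) (y - - w)" using xy by (intro kernelD[OF L]) (simp_all add: algebra_simps)
      have "2 * x * u - 2 * y * u = 2 * u * (x - y)" by (simp add: algebra_simps)
      then show "om n (2 * x * u) = om n (2 * y * u)" using xy by (intro om_cong[OF n]) simp
    qed
  qed
  finally show ?thesis .
qed

lemma odd_dvd_2_mult: "odd g \<Longrightarrow> int g dvd 2 * m \<longleftrightarrow> int g dvd m"
  by (rule coprime_dvd_mult_right_iff) simp

lemma htrans_inverse:
  assumes n: "odd n" and L: "kernel n L"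
  shows "(\<Sum>w\<in>{0..<int n}. htrans n L u w * om n (- (2 * t * w))) = of_nat n * L (t + u) (t - u)"
proof -
  let ?Z = "{0..<int n}"
  have n0: "n > 0" using n by (rule odd_pos)
  have "(\<Sum>w\<in>?Z. htrans n L u w * om n (- (2 * t * w))) = (\<Sum>w\<in>?Z. \<Sum>z\<in>?Z. om n (w * (2 * (z - t))) * L (z + u) (z - u))"
    unfolding htrans_def sum_distrib_right
  proof (intro sum.cong refl)
    fix w z
    have "om n (2 * z * w) * om n (- (2 * t * w)) = om n (w * (2 * (z - t)))"
      unfolding om_add[symmetric] by (simp add: algebra_simps)
    then show "L (z + u) (z - u) * om n (2 * z * w) * om n (- (2 * t * w)) = om n (w * (2 * (z - t))) * L (z + u) (z - u)"
      by (simp add: mult_ac)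
  qed
  also have "\<dots> = (\<Sum>z\<in>?Z. (\<Sum>w\<in>?Z. om n (w * (2 * (z - t)))) * L (z + u) (z - u))"
    by (subst sum.swap) (simp add: sum_distrib_right)
  also have "\<dots> = (\<Sum>z\<in>?Z. if int n dvd z - t then of_nat n * L (z + u) (z - u) else 0)"
    by (intro sum.cong refl) (simp only: om_sum[OF n0] odd_dvd_2_mult[OF n] if_distrib[of "\<lambda>c. c * _"] mult_zero_left)
  also have "\<dots> = of_nat n * L (t + u) (t - u)"
  proof (rule sum_delta_mod[OF n0])
    show "per n (\<lambda>z. of_nat n * L (z + u) (z - u))"
      unfolding per_def
    proof (intro allI impI)
      fix x y assume "int n dvd x - y"
      then have "L (x + u) (x - u) = L (y + u) (y - u)" by (intro kernelD[OF L]) simp_all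
      then show "of_nat n * L (x + u) (x - u) = of_nat n * L (y + u) (y - u)" by simp
    qed
  qed
  finally show ?thesis .
qed

lemma htrans_inj:
  assumes n: "odd n" and L: "kernel n L" "kernel n L'" and eq: "\<And>u w. htrans n L u w = htrans n L' u w"
  shows "L x y = L' x y"
proof -
  obtain r where r: "n = 2 * r + 1" using n by (elim oddE)
  \<comment> \<open>The half-sum and half-difference of \<open>x\<close> and \<open>y\<close>: r + 1
    is the inverse of 2 modulo 2r + 1.\<close>
  define t u where "t = (x + y) * (int r + 1)" and "u = (x - y) * (int r + 1)"
  have "of_nat n * L (t + u) (t - u) = of_nat n * L' (t + u) (t - u)"
    by (simp only: htrans_inverse[OF n L(1), symmetric] htrans_inverse[OF n L(2), symmetric] eq)
  then have "L (t + u) (t - u) = L' (t + u) (t - u)" using odd_pos[OF n] by simp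
  moreover have "t + u - x = int n * x" "t - u - y = int n * y" unfolding t_def u_def r by (simp_all add: algebra_simps)
  then have "int n dvd t + u - x" "int n dvd t - u - y" by simp_all
  then have "L (t + u) (t - u) = L x y" "L' (t + u) (t - u) = L' x y"
    using kernelD[OF L(1)] kernelD[OF L(2)] by blast+
  ultimately show ?thesis by simp
qed

definition fourier_comm :: "nat \<Rightarrow> (int \<Rightarrow> int \<Rightarrow> complex) \<Rightarrow> bool" where
  "fourier_comm n L \<longleftrightarrow>
    (\<forall>x z. (\<Sum>y\<in>{0..<int n}. L x y * om n (y * z)) = (\<Sum>y\<in>{0..<int n}. om n (x * y) * L y z))"

text \<open>Moving one Fourier transform across \<open>L\<close> leaves F applied twice, which is n
  times the reflection x -> -x. Evenness of \<open>L\<close> in both variables absorbs the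
  reflections.\<close>

lemma fconj_comm:
  assumes n: "n > 0" and L: "kernel n L" and even: "\<And>x y. L (- x) y = L x y" "\<And>x y. L x (- y) = L x y"
    and comm: "fourier_comm n L"
  shows "fconj n L x y = L x y"
proof -
  let ?Z = "{0..<int n}"
  have "fconj n L x y = (\<Sum>p\<in>?Z. om n (x * p) * (\<Sum>q\<in>?Z. L p q * om n (q * - y))) / of_nat n"
    unfolding fconj_def sum_distrib_left
    by (intro arg_cong2[where f = "(/)"] sum.cong refl) (simp add: om_add[symmetric] mult_ac diff_conv_add_uminus del: add_uminus_conv_diff)
  also have "\<dots> = (\<Sum>p\<in>?Z. om n (x * p) * (\<Sum>q\<in>?Z. om n (p * q) * L q y)) / of_nat n"
    using comm by (simp add: fourier_comm_def even(2) del: mult_minus_right)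
  also have "(\<Sum>p\<in>?Z. om n (x * p) * (\<Sum>q\<in>?Z. om n (p * q) * L q y)) = (\<Sum>q\<in>?Z. \<Sum>p\<in>?Z. om n (p * (x + q)) * L q y)"
    by (subst sum.swap) (simp add: sum_distrib_left distrib_left om_add mult_ac)
  also have "\<dots> = (\<Sum>q\<in>?Z. if int n dvd q - - x then of_nat n * L q y else 0)"
    unfolding sum_distrib_right[symmetric] by (intro sum.cong refl) (simp add: om_sum[OF n] add.commute)
  also have "\<dots> = of_nat n * L (- x) y"
  proof (rule sum_delta_mod[OF n])
    show "per n (\<lambda>q. of_nat n * L q y)"
      using L by (auto simp: kernel_def per_def)
  qed
  finally show ?thesis using n even(1) by simp
qed

text \<open>Multiplying F L F^(-1) = L by F on the right; the character sum over \<open>y\<close>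
  carries out the cancellation.\<close>

lemma comm_of_fconj:
  assumes n: "n > 0" and L: "kernel n L" and eq: "\<And>x y. fconj n L x y = L x y"
  shows "fourier_comm n L"
  unfolding fourier_comm_def
proof (intro allI)
  fix x z
  let ?Z = "{0..<int n}"
  have "(\<Sum>y\<in>?Z. L x y * om n (y * z)) = (\<Sum>y\<in>?Z. fconj n L x y * om n (y * z))" by (simp add: eq)
  also have "\<dots> = (\<Sum>y\<in>?Z. \<Sum>p\<in>?Z. \<Sum>q\<in>?Z. om n (y * (z - q)) * (om n (x * p) * L p q / of_nat n))"
    unfolding fconj_def sum_divide_distrib sum_distrib_right
  proof (intro sum.cong refl)
    fix y p q
    have "om n (x * p - q * y) * om n (y * z) = om n (y * (z - q)) * om n (x * p)"
      unfolding om_add[symmetric] by (simp add: algebra_simps)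
    then show "om n (x * p - q * y) * L p q / of_nat n * om n (y * z) = om n (y * (z - q)) * (om n (x * p) * L p q / of_nat n)"
      by (simp add: field_simps)
  qed
  also have "\<dots> = (\<Sum>p\<in>?Z. \<Sum>q\<in>?Z. (\<Sum>y\<in>?Z. om n (y * (z - q))) * (om n (x * p) * L p q / of_nat n))"
    by (subst sum_rotate) (simp only: sum_distrib_right)
  also have "\<dots> = (\<Sum>p\<in>?Z. \<Sum>q\<in>?Z. if int n dvd q - z then om n (x * p) * L p q else 0)"
    using n by (intro sum.cong refl) (simp add: om_sum dvd_diff_commute)
  also have "\<dots> = (\<Sum>p\<in>?Z. om n (x * p) * L p z)"
  proof (rule sum.cong[OF refl], rule sum_delta_mod[OF n])
    fix p show "per n (\<lambda>q. om n (x * p) * L p q)"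
      using L by (auto simp: kernel_def per_def)
  qed
  finally show "(\<Sum>y\<in>?Z. L x y * om n (y * z)) = (\<Sum>y\<in>?Z. om n (x * y) * L y z)" .
qed

text \<open>The shear and the rotation generate SL2 over the integers, and the steps of Euclid's
  algorithm are among the resulting moves, so (u, w) can be carried to (gcd, 0).\<close>

lemma sl2_invariant:
  fixes H :: "int \<Rightarrow> int \<Rightarrow> 'a"
  assumes T: "\<And>u w. H u (w + u) = H u w" and S: "\<And>u w. H (- w) u = H u w"
    and per: "\<And>u. per n (H u)" "\<And>w. per n (\<lambda>u. H u w)" and n: "n > 0"
  shows "H u w = H (gcd (gcd u w) (int n)) 0"
proof -
  have T': "H (u + w) w = H u w" for u w
    using T[of "- w" "u + w"] S[of w u] S[of w "u + w"] by simp
  have neg: "H (- u) (- w) = H u w" for u w using S[of u "- w"] S[of w u] S[of "u" "w"] S by metis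
  have *: "a \<ge> 0 \<Longrightarrow> b \<ge> 0 \<Longrightarrow> H a b = H (gcd a b) 0" for a b
  proof (induction "nat (a + b)" arbitrary: a b rule: less_induct)
    case less
    consider "b = 0" | "a = 0" | "b > 0" "a \<ge> b" | "a > 0" "b > a" using less.prems by linarith
    then show ?case
    proof cases
      case 1
      then show ?thesis using less.prems by simp
    next
      case 2
      then show ?thesis using less.prems S[of b 0] neg[of b 0] by simp
    next
      case 3
      then have "H (a - b) b = H (gcd (a - b) b) 0" by (intro less.hyps) auto
      then show ?thesis using T'[of "a - b" b] by (simp add: gcd_diff1)
    next
      case 4
      then have "H a (b - a) = H (gcd a (b - a)) 0" by (intro less.hyps) auto
      moreover have "gcd a (b - a) = gcd a b" by (metis gcd.commute gcd_diff1)
      ultimately show ?thesis using T[of a "b - a"] by simp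
    qed
  qed
  have "H u w = H u (w mod int n)" by (rule per_mod[OF per(1), symmetric])
  also have "\<dots> = H (u mod int n) (w mod int n)" by (rule per_mod[OF per(2), symmetric])
  also have "\<dots> = H (gcd (u mod int n) (w mod int n)) 0" using n by (intro *) auto
  \<comment> \<open>Periodicity replaces the argument 0 by n; a second run of Euclid's algorithm
    then brings n into the gcd.\<close>
  also have "\<dots> = H (gcd (u mod int n) (w mod int n)) (int n)" by (rule perD[OF per(1)]) simp
  also have "\<dots> = H (gcd (gcd (u mod int n) (w mod int n)) (int n)) 0" using n by (intro *) auto
  also have "gcd (gcd (u mod int n) (w mod int n)) (int n) = gcd (gcd u w) (int n)"
    by (metis gcd.assoc gcd.commute gcd_red_int)
  finally show ?thesis .
qed

text \<open>Moebius inversion as an existence statement: the value of \<open>\<psi>\<close> at each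
  new number is chosen to correct the sum over its proper divisors.\<close>

lemma divisor_sum_inversion:
  fixes \<phi> :: "nat \<Rightarrow> complex"
  shows "\<exists>\<psi>. \<forall>k\<in>{1..N}. \<phi> k = (\<Sum>g | g dvd k. \<psi> g)"
proof (induction N)
  case (Suc N)
  then obtain \<psi> where \<psi>: "\<forall>k\<in>{1..N}. \<phi> k = (\<Sum>g | g dvd k. \<psi> g)" by blast
  define \<psi>' where "\<psi>' = \<psi>(Suc N := \<phi> (Suc N) - (\<Sum>g\<in>{g. g dvd Suc N} - {Suc N}. \<psi> g))"
  have "\<phi> k = (\<Sum>g | g dvd k. \<psi>' g)" if k: "k \<in> {1..Suc N}" for k
  proof (cases "k = Suc N")
    case True
    have "(\<Sum>g | g dvd Suc N. \<psi>' g) = \<psi>' (Suc N) + (\<Sum>g\<in>{g. g dvd Suc N} - {Suc N}. \<psi>' g)"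
      by (rule sum.remove) auto
    also have "(\<Sum>g\<in>{g. g dvd Suc N} - {Suc N}. \<psi>' g) = (\<Sum>g\<in>{g. g dvd Suc N} - {Suc N}. \<psi> g)"
      by (intro sum.cong) (auto simp: \<psi>'_def)
    finally show ?thesis using True by (simp add: \<psi>'_def)
  next
    case False
    then have k: "k \<in> {1..N}" using k by auto
    then have "g \<noteq> Suc N" if "g dvd k" for g using dvd_imp_le[OF that] by auto
    then have "(\<Sum>g | g dvd k. \<psi>' g) = (\<Sum>g | g dvd k. \<psi> g)" by (intro sum.cong) (auto simp: \<psi>'_def)
    then show ?thesis using \<psi> k by simp
  qed
  then show ?case by blast
qed simp

text \<open>For odd n and g | n the pairs counted here form a Lagrangian subgroup of (Z/n)^2 for the
  form x^2 - y^2: it has n elements modulo n, and (x - y)(x + y) is divisible by n on it.\<close>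

definition lag :: "nat \<Rightarrow> nat \<Rightarrow> int \<Rightarrow> int \<Rightarrow> complex" where
  "lag n g x y = (if int g dvd x - y \<and> int (n div g) dvd x + y then 1 else 0)"

lemma lag_kernel:
  assumes "g dvd n"
  shows "kernel n (lag n g)"
proof -
  have *: "int g dvd x - y \<longleftrightarrow> int g dvd x' - y'" "int (n div g) dvd x + y \<longleftrightarrow> int (n div g) dvd x' + y'"
    if "int n dvd x - x'" "int n dvd y - y'" for x x' y y'
  proof -
    have d: "int g dvd int n" "int (n div g) dvd int n" using assms by (auto simp: div_dvd_iff_mult)
    have g: "int g dvd x - x'" "int g dvd y - y'" "int (n div g) dvd x - x'" "int (n div g) dvd y - y'"
      using that d dvd_trans by blast+
    have e: "x - y = (x' - y') + ((x - x') - (y - y'))" "x + y = (x' + y') + ((x - x') + (y - y'))" by simp_all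
    show "int g dvd x - y \<longleftrightarrow> int g dvd x' - y'"
      by (subst e(1)) (intro dvd_add_left_iff dvd_diff g)
    show "int (n div g) dvd x + y \<longleftrightarrow> int (n div g) dvd x' + y'"
      by (subst e(2)) (intro dvd_add_left_iff dvd_add g)
  qed
  show ?thesis
    unfolding kernel_def per_def lag_def
  proof (intro conjI allI impI)
    fix x y y' assume "int n dvd y - y'"
    then show "(if int g dvd x - y \<and> int (n div g) dvd x + y then 1 else 0 :: complex)
      = (if int g dvd x - y' \<and> int (n div g) dvd x + y' then 1 else 0)"
      using * [of x x y y'] by simp
  next
    fix y x x' assume "int n dvd x - x'"
    then show "(if int g dvd x - y \<and> int (n div g) dvd x + y then 1 else 0 :: complex)
      = (if int g dvd x' - y \<and> int (n div g) dvd x' + y then 1 else 0)"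
      using * [of x x' y y] by simp
  qed
qed

text \<open>In these coordinates the invariance under SL2 is visible, since g | u and g | w depends
  only on the gcd. The sum runs over the multiples of n/g, a group of order g.\<close>

lemma htrans_lag:
  assumes n: "odd n" and g: "g dvd n"
  shows "htrans n (lag n g) u w = (if int g dvd u \<and> int g dvd w then of_nat g else 0)"
proof -
  obtain k where nk: "n = g * k" using g ..
  have odd: "odd g" "odd k" and pos: "g > 0" "k > 0" "n > 0" using n nk by (auto intro: odd_pos)
  have kg: "n div g = k" using nk pos by simp
  have "htrans n (lag n g) u w = (\<Sum>z\<in>{0..<int n}. if int g dvd u \<and> int k dvd z then om n (2 * z * w) else 0)"
    unfolding htrans_def
  proof (intro sum.cong refl)
    fix z
    have "z + u - (z - u) = 2 * u" "z + u + (z - u) = 2 * z" by simp_all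
    then have "int g dvd z + u - (z - u) \<longleftrightarrow> int g dvd u" "int k dvd z + u + (z - u) \<longleftrightarrow> int k dvd z"
      by (simp_all only: odd_dvd_2_mult[OF odd(1)] odd_dvd_2_mult[OF odd(2)])
    then show "lag n g (z + u) (z - u) * om n (2 * z * w) = (if int g dvd u \<and> int k dvd z then om n (2 * z * w) else 0)"
      by (simp add: lag_def kg)
  qed
  also have "\<dots> = (if int g dvd u then (\<Sum>z\<in>{0..<int n}. if int k dvd z then om n (2 * z * w) else 0) else 0)"
    by simp
  also have "(\<Sum>z\<in>{0..<int n}. if int k dvd z then om n (2 * z * w) else 0) = (\<Sum>z\<in>{z\<in>{0..<int n}. int k dvd z}. om n (2 * z * w))"
    by (subst sum.inter_filter) auto
  \<comment> \<open>Writing z = k t turns the character modulo n into one modulo g.\<close>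
  also have "\<dots> = (\<Sum>t\<in>{0..<int g}. om g (t * (2 * w)))"
  proof (rule sum.reindex_bij_witness[of _ "\<lambda>t. int k * t" "\<lambda>z. z div int k"])
    fix z assume z: "z \<in> {z\<in>{0..<int n}. int k dvd z}"
    then obtain t where t: "z = int k * t" by auto
    show "int k * (z div int k) = z" using z by auto
    show "z div int k \<in> {0..<int g}" using z pos t by (simp add: nk zero_le_mult_iff)
    have "z div int k = t" using t pos by simp
    moreover have "2 * pi * real_of_int (t * (2 * w)) / real g = 2 * pi * real_of_int (2 * z * w) / real n"
      using pos by (simp add: t nk field_simps)
    ultimately show "om g (z div int k * (2 * w)) = om n (2 * z * w)" by (simp only: om_def)
  next
    fix t assume t: "t \<in> {0..<int g}"
    then show "int k * t div int k = t" using pos by simp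
    show "int k * t \<in> {z\<in>{0..<int n}. int k dvd z}" using t pos mult_strict_left_mono[of t "int g" "int k"] by (simp add: nk mult.commute)
  qed
  also have "\<dots> = (if int g dvd w then of_nat g else 0)"
    by (simp add: om_sum[OF pos(1)] odd_dvd_2_mult[OF odd(1)])
  finally show ?thesis by simp
qed

lemma kernel_sum: "(\<And>g. g \<in> G \<Longrightarrow> kernel n (L g)) \<Longrightarrow> kernel n (\<lambda>x y. \<Sum>g\<in>G. c g * L g x y)"
  unfolding kernel_def per_def by (intro conjI allI impI sum.cong refl arg_cong2[where f = "(*)"]) simp_all

lemma htrans_sum: "htrans n (\<lambda>x y. \<Sum>g\<in>G. c g * L g x y) u w = (\<Sum>g\<in>G. c g * htrans n (L g) u w)"
  unfolding htrans_def sum_distrib_left sum_distrib_right by (subst sum.swap) (simp add: mult.assoc)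

text \<open>The transform is unchanged by the rotation (u, w) -> (-w, u), so injectivity of the
  transform identifies the kernel with its Fourier conjugate.\<close>

lemma lag_comm:
  assumes n: "odd n" and g: "g dvd n"
  shows "fourier_comm n (lag n g)"
proof (rule comm_of_fconj)
  show n0: "n > 0" using n by (rule odd_pos)
  show k: "kernel n (lag n g)" by (rule lag_kernel[OF g])
  show "fconj n (lag n g) x y = lag n g x y" for x y
    by (rule htrans_inj[OF n fconj_kernel[OF n0] k]) (auto simp: htrans_fconj[OF n0 k] htrans_lag[OF n g])
qed

text \<open>The kernels commuting with the Fourier transform and supported on \<open>x\<^sup>2 \<equiv> y\<^sup>2\<close> correspond
  to the functions invariant under \<open>SL\<^sub>2\<close>, and these depend only on the gcd of their arguments.\<close>

theorem commutant:
  assumes n: "odd n" and L: "kernel n L"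
    and even: "\<And>x y. L (- x) y = L x y" "\<And>x y. L x (- y) = L x y"
    and comm: "fourier_comm n L"
    and supp: "\<And>x y. L x y \<noteq> 0 \<Longrightarrow> int n dvd x\<^sup>2 - y\<^sup>2"
  obtains c where "\<And>x y. L x y = (\<Sum>g | g dvd n. c g * lag n g x y)"
proof -
  have n0: "n > 0" using n by (rule odd_pos)
  have H: "htrans n L u w = htrans n L (gcd (gcd u w) (int n)) 0" for u w
  proof (rule sl2_invariant[OF _ _ _ _ n0])
    fix u w
    \<comment> \<open>Shear invariance is the support condition: (z + u)^2 - (z - u)^2 = 4zu, so n
      divides zu wherever the kernel is nonzero, and the extra phase is 1.\<close>
    show "htrans n L u (w + u) = htrans n L u w"
      unfolding htrans_def
    proof (rule sum.cong[OF refl])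
      fix z
      show "L (z + u) (z - u) * om n (2 * z * (w + u)) = L (z + u) (z - u) * om n (2 * z * w)"
      proof (cases "L (z + u) (z - u) = 0")
        case False
        have "(z + u)\<^sup>2 - (z - u)\<^sup>2 = 2 * (2 * (z * u))" by (simp add: power2_eq_square algebra_simps)
        then have "int n dvd z * u" using supp[OF False] by (simp only: odd_dvd_2_mult[OF n])
        moreover have "2 * z * (w + u) - 2 * z * w = z * u * 2" by (simp add: algebra_simps)
        ultimately have "om n (2 * z * (w + u)) = om n (2 * z * w)"
          by (intro om_cong[OF n0]) (simp only: dvd_mult2)
        then show ?thesis by simp
      qed simp
    qed
    have "htrans n L (- w) u = htrans n (fconj n L) u w" by (rule htrans_fconj[OF n0 L, symmetric])
    also have "fconj n L = L" using fconj_comm[OF n0 L even comm] by blast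
    finally show "htrans n L (- w) u = htrans n L u w" .
    show "per n (htrans n L u)"
      unfolding per_def htrans_def
    proof (intro allI impI sum.cong refl arg_cong2[where f = "(*)"] om_cong[OF n0])
      fix x y z assume "int n dvd x - y"
      then show "int n dvd 2 * z * x - 2 * z * y" by (simp flip: right_diff_distrib)
    qed
    show "per n (\<lambda>u. htrans n L u w)"
      unfolding per_def htrans_def
    proof (intro allI impI sum.cong refl arg_cong2[where f = "(*)"] kernelD[OF L])
      fix x y z assume xy: "int n dvd x - y"
      then show "int n dvd z + x - (z + y)" by simp
      show "int n dvd z - x - (z - y)" using xy by (simp add: dvd_diff_commute)
    qed
  qed
  obtain \<psi> where \<psi>: "\<forall>k\<in>{1..n}. htrans n L (int k) 0 = (\<Sum>g | g dvd k. \<psi> g)"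
    using divisor_sum_inversion[of n "\<lambda>k. htrans n L (int k) 0"] by blast
  have hL: "htrans n L u w = (\<Sum>g | g dvd n. if int g dvd u \<and> int g dvd w then \<psi> g else 0)" for u w
  proof -
    define k where "k = nat (gcd (gcd u w) (int n))"
    have k: "int k = gcd (gcd u w) (int n)" by (simp add: k_def)
    have kn: "int k dvd int n" by (simp add: k)
    then have "k dvd n" by simp
    then have "k \<in> {1..n}" using n0 dvd_imp_le[of k n] by (auto intro: Nat.gr0I)
    then have "htrans n L u w = (\<Sum>g | g dvd k. \<psi> g)" using \<psi> H[of u w, folded k] by (metis (no_types, lifting))
    also have "{g. g dvd k} = {g. g dvd n \<and> int g dvd u \<and> int g dvd w}"
    proof -
      have "g dvd k \<longleftrightarrow> int g dvd gcd (gcd u w) (int n)" for g unfolding k[symmetric] by simp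
      then have "g dvd k \<longleftrightarrow> g dvd n \<and> int g dvd u \<and> int g dvd w" for g by (simp add: conj_commute)
      then show ?thesis by (simp only:)
    qed
    also have "(\<Sum>g | g dvd n \<and> int g dvd u \<and> int g dvd w. \<psi> g) = (\<Sum>g\<in>{g. g dvd n}. if int g dvd u \<and> int g dvd w then \<psi> g else 0)"
      using n0 by (subst sum.inter_filter[symmetric]) auto
    finally show ?thesis .
  qed
  \<comment> \<open>Dividing by g compensates the value g that the transform of
    \<open>lag n g\<close> takes on its support.\<close>
  define c where "c g = \<psi> g / of_nat g" for g
  have "L x y = (\<Sum>g | g dvd n. c g * lag n g x y)" for x y
  proof (rule htrans_inj[OF n L])
    show "kernel n (\<lambda>x y. \<Sum>g | g dvd n. c g * lag n g x y)"
      by (rule kernel_sum) (simp add: lag_kernel)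
    fix u w
    show "htrans n L u w = htrans n (\<lambda>x y. \<Sum>g | g dvd n. c g * lag n g x y) u w"
      unfolding htrans_sum hL
    proof (rule sum.cong[OF refl])
      fix g assume "g \<in> {g. g dvd n}"
      then have g: "g dvd n" "g > 0" using n0 by (auto intro: Nat.gr0I)
      show "(if int g dvd u \<and> int g dvd w then \<psi> g else 0) = c g * htrans n (lag n g) u w"
        using g by (simp add: htrans_lag[OF n g(1)] c_def)
    qed
  qed
  then show thesis using that by blast
qed

section \<open>Coefficients of the divisor kernels\<close>

lemma codivisor:
  fixes n :: nat
  assumes "n > 0" "g dvd n"
  shows "n = g * (n div g)" "g > 0" "n div g > 0" "n div (n div g) = g" "n div g dvd n"
proof -
  obtain k where k: "n = g * k" using assms(2) ..
  then have "g > 0" "k > 0" using assms(1) by auto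
  then show "n = g * (n div g)" "g > 0" "n div g > 0" "n div (n div g) = g" "n div g dvd n" using k by simp_all
qed

text \<open>At such a point another divisor g' contributes only if g' | g and n/g' | n/g; both
  products being n, this forces g' = g. A single value of the kernel thus isolates one
  coefficient.\<close>

lemma lag_coefficient:
  assumes n: "odd n" and g: "g dvd n" and xy: "x - y = int g" "x + y = int (n div g)"
  shows "(\<Sum>g' | g' dvd n. c g' * lag n g' x y) = c g"
proof -
  have n0: "n > 0" using n by (rule odd_pos)
  have "lag n g' x y = (if g' = g then 1 else 0)" if g': "g' dvd n" for g'
  proof -
    have "g' dvd g \<and> n div g' dvd n div g \<longleftrightarrow> g' = g"
    proof
      assume d: "g' dvd g \<and> n div g' dvd n div g"
      define k k' where "k = n div g" and "k' = n div g'"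
      have k: "n = g * k" "n = g' * k'" "k > 0" "k' > 0" "g > 0"
        using codivisor[OF n0 g] codivisor[OF n0 g'] by (simp_all add: k_def k'_def)
      have "k' \<le> k" "g' \<le> g" using d k by (auto simp: k_def[symmetric] k'_def[symmetric] intro: dvd_imp_le)
      show "g' = g"
      proof (rule ccontr)
        assume "g' \<noteq> g"
        then have "g' * k' < g * k" using \<open>k' \<le> k\<close> \<open>g' \<le> g\<close> k by (intro mult_less_le_imp_less) auto
        then show False using k by simp
      qed
    qed auto
    then show ?thesis by (simp add: lag_def xy)
  qed
  then have "(\<Sum>g' | g' dvd n. c g' * lag n g' x y) = (\<Sum>g' | g' dvd n. if g' = g then c g else 0)"
    by (intro sum.cong) auto
  then show ?thesis using g n0 by simp
qed

lemma half_sum: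
  assumes n: "odd n" and g: "g dvd n"
  obtains x y where "x - y = int g" "x + y = int (n div g)"
proof -
  have "odd (g * (n div g))" using n codivisor(1)[OF odd_pos[OF n] g] by simp
  then have "odd g" "odd (n div g)" by simp_all
  then have *: "even (int g + int (n div g))" "even (int (n div g) - int g)" by auto
  obtain x where "int g + int (n div g) = 2 * x" using *(1) ..
  moreover obtain y where "int (n div g) - int g = 2 * y" using *(2) ..
  ultimately show thesis using that[of x y] by linarith
qed

text \<open>Reflecting one variable exchanges x - y and x + y up to sign, and with them g and
  n/g.\<close>

lemma lag_neg:
  assumes "n > 0" "g dvd n"
  shows "lag n g x (- y) = lag n (n div g) x y" "lag n g (- x) y = lag n (n div g) x y"
proof -
  have "- x - y = - (x + y)" "- x + y = - (x - y)" by simp_all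
  then have "int m dvd - x - y \<longleftrightarrow> int m dvd x + y" "int m dvd - x + y \<longleftrightarrow> int m dvd x - y" for m
    by (simp_all only: dvd_minus_iff)
  then show "lag n g x (- y) = lag n (n div g) x y" "lag n g (- x) y = lag n (n div g) x y"
    unfolding lag_def codivisor(4)[OF assms] by auto
qed

lemma lag_supp: assumes "g dvd n" "lag n g x y \<noteq> 0" shows "int n dvd x\<^sup>2 - y\<^sup>2"
proof -
  have "int g dvd x - y" "int (n div g) dvd x + y" using assms by (auto simp: lag_def split: if_splits)
  then have "int g * int (n div g) dvd (x - y) * (x + y)" by (rule mult_dvd_mono)
  moreover have "int g * int (n div g) = int n" using assms by (simp flip: of_nat_mult)
  moreover have "(x - y) * (x + y) = x\<^sup>2 - y\<^sup>2" by (simp add: algebra_simps power2_eq_square)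
  ultimately show ?thesis by simp
qed

text \<open>Symmetric coefficients with an even sum split into pairs \<open>{g, n / g}\<close>; only \<open>g = n / g\<close>,
  that is \<open>g\<^sup>2 = n\<close>, can pair with itself.\<close>

lemma pair_step:
  fixes n :: nat
  assumes n: "n > 0" and sym: "\<And>g. g dvd n \<Longrightarrow> c (n div g) = c g"
    and total: "(\<Sum>g | g dvd n. c g) = 2 * Suc m"
  obtains g c' where "g dvd n" "\<And>g. g dvd n \<Longrightarrow> c' (n div g) = (c' g :: nat)" "(\<Sum>g | g dvd n. c' g) = 2 * m"
    "\<And>h. h dvd n \<Longrightarrow> c h = c' h + (if h = g then 1 else 0) + (if h = n div g then 1 else 0)"
proof -
  have dd: "n div (n div g) = g" "n div g dvd n" if "g dvd n" for g using codivisor[OF n that] by auto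
  have fin: "finite {g. g dvd n}" using n by simp
  have "\<exists>g. g dvd n \<and> c g > 0 \<and> (g = n div g \<longrightarrow> c g \<ge> 2)"
  proof (cases "\<exists>g. g dvd n \<and> c g > 0 \<and> g \<noteq> n div g")
    case False
    have "\<exists>s. s dvd n \<and> c s > 0"
    proof (rule ccontr)
      assume "\<not> ?thesis"
      then have "(\<Sum>g | g dvd n. c g) = 0" by simp
      then show False using total by simp
    qed
    then obtain s where s: "s dvd n" "c s > 0" by blast
    then have ss: "s = n div s" using False by blast
    have "c h = 0" if h: "h dvd n" "h \<noteq> s" for h
    proof (rule ccontr)
      assume "c h \<noteq> 0"
      then have hh: "h = n div h" using False h by blast
      have "s * s = n" "h * h = n" using ss hh s h by (metis dvd_mult_div_cancel)+
      then show False using h power2_eq_imp_eq[of s h] by (simp add: power2_eq_square)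
    qed
    then have "(\<Sum>g | g dvd n. c g) = (\<Sum>g | g dvd n. if g = s then c s else 0)" by (intro sum.cong) auto
    then have "c s = 2 * Suc m" using total s fin by simp
    then show ?thesis using s by auto
  qed auto
  then obtain g where g: "g dvd n" "c g > 0" "g = n div g \<longrightarrow> c g \<ge> 2" by blast
  \<comment> \<open>The multiplicity function of the pair: it takes the value 2 when g = n/g, which
    is why \<open>c g\<close> was required to be at least 2 in that case.\<close>
  define e where "e h = (if h = g then 1 else 0) + (if h = n div g then 1 else 0 :: nat)" for h
  define c' where "c' h = c h - e h" for h
  have le: "e h \<le> c h" for h using g sym[OF g(1)] by (auto simp: e_def)
  have esym: "e (n div h) = e h" if "h dvd n" for h
    using dd[OF that] dd[OF g(1)] unfolding e_def by (auto split: if_splits)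
  have "(\<Sum>h | h dvd n. e h) = 2" using g dd[OF g(1)] fin by (simp add: e_def sum.distrib)
  moreover have "(\<Sum>h | h dvd n. c h) = (\<Sum>h | h dvd n. c' h) + (\<Sum>h | h dvd n. e h)"
    unfolding sum.distrib[symmetric] using le by (intro sum.cong) (auto simp: c'_def)
  ultimately have "(\<Sum>h | h dvd n. c' h) = 2 * m" using total by simp
  moreover have "c h = c' h + (if h = g then 1 else 0) + (if h = n div g then 1 else 0)" for h
    using le[of h] by (simp add: c'_def e_def)
  moreover have "c' (n div h) = c' h" if "h dvd n" for h using sym[OF that] esym[OF that] by (simp add: c'_def)
  ultimately show thesis using that[OF g(1), of c'] by blast
qed

text \<open>The even kernel of a pair {g, n/g}. For g^2 = n both summands coincide and the kernel is
  twice an indicator.\<close>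

definition lag2 :: "nat \<Rightarrow> nat \<Rightarrow> int \<Rightarrow> int \<Rightarrow> complex" where
  "lag2 n g x y = lag n g x y + lag n (n div g) x y"

lemma pair_step_lag:
  assumes n: "n > 0" and sym: "\<And>g. g dvd n \<Longrightarrow> c (n div g) = c g"
    and total: "(\<Sum>g | g dvd n. c g) = 2 * Suc m"
  shows "\<exists>g c'. g dvd n \<and> (\<forall>g. g dvd n \<longrightarrow> c' (n div g) = (c' g :: nat)) \<and> (\<Sum>g | g dvd n. c' g) = 2 * m
    \<and> (\<forall>x y. (\<Sum>h | h dvd n. of_nat (c h) * lag n h x y) = (\<Sum>h | h dvd n. of_nat (c' h) * lag n h x y) + lag2 n g x y)"
proof -
  obtain g c' where g: "g dvd n" and c': "\<And>g. g dvd n \<Longrightarrow> c' (n div g) = c' g" "(\<Sum>g | g dvd n. c' g) = 2 * m"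
    and c: "\<And>h. h dvd n \<Longrightarrow> c h = c' h + (if h = g then 1 else 0) + (if h = n div g then 1 else 0)"
    using pair_step[OF n sym total] by metis
  have gd: "n div g dvd n" using codivisor[OF n g] by simp
  have "(\<Sum>h | h dvd n. of_nat (c h) * lag n h x y) = (\<Sum>h | h dvd n. of_nat (c' h) * lag n h x y) + lag2 n g x y" for x y
  proof -
    have "(\<Sum>h | h dvd n. of_nat (c h) * lag n h x y)
      = (\<Sum>h | h dvd n. of_nat (c' h) * lag n h x y + (if h = g then lag n g x y else 0) + (if h = n div g then lag n (n div g) x y else 0))"
      by (intro sum.cong) (auto simp: c distrib_right)
    also have "\<dots> = (\<Sum>h | h dvd n. of_nat (c' h) * lag n h x y) + lag n g x y + lag n (n div g) x y"
      unfolding sum.distrib using g gd n by simp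
    finally show ?thesis by (simp add: lag2_def)
  qed
  with g c' show ?thesis by (intro exI[of _ g] exI[of _ c'] conjI allI impI)
qed

text \<open>Each coefficient is a value of the kernel at the point with x - y = g, x + y = n/g,
  hence a natural number; reflecting \<open>y\<close> moves that point to the one of n/g, which
  gives the symmetry.\<close>

lemma lag_coefficients_nat:
  assumes n: "odd n" and L: "\<And>x y. L x y = (\<Sum>g | g dvd n. c g * lag n g x y)"
    and nat: "\<And>x y. L x y \<in> \<nat>" and even: "\<And>x y. L x (- y) = L x y"
  obtains d :: "nat \<Rightarrow> nat" where "\<And>x y. L x y = (\<Sum>g | g dvd n. of_nat (d g) * lag n g x y)"
    "\<And>g. g dvd n \<Longrightarrow> d (n div g) = d g" "L 0 0 = of_nat (\<Sum>g | g dvd n. d g)"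
proof -
  have n0: "n > 0" using n by (rule odd_pos)
  have c: "c g \<in> \<nat>" "c (n div g) = c g" if g: "g dvd n" for g
  proof -
    obtain x y where xy: "x - y = int g" "x + y = int (n div g)" using half_sum[OF n g] .
    have gd: "n div g dvd n" "n div (n div g) = g" using codivisor[OF n0 g] by simp_all
    have Lg: "L x y = c g" unfolding L by (rule lag_coefficient[OF n g xy])
    then show "c g \<in> \<nat>" using nat[of x y] by simp
    have "L x (- y) = c (n div g)" unfolding L by (rule lag_coefficient[OF n gd(1)]) (simp_all add: xy gd)
    then show "c (n div g) = c g" using Lg even by simp
  qed
  define d where "d g = (SOME k. c g = of_nat k)" for g
  have d: "c g = of_nat (d g)" if "g dvd n" for g
    unfolding d_def by (rule someI_ex) (use c(1)[OF that] in \<open>auto elim: Nats_cases\<close>)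
  have Ld: "L x y = (\<Sum>g | g dvd n. of_nat (d g) * lag n g x y)" for x y
    unfolding L by (intro sum.cong) (auto simp: d)
  moreover have "d (n div g) = d g" if g: "g dvd n" for g
  proof -
    have "n div g dvd n" using codivisor[OF n0 g] by simp
    then have "of_nat (d (n div g)) = (of_nat (d g) :: complex)" using c(2)[OF g] d g by simp
    then show ?thesis by simp
  qed
  moreover have "L 0 0 = of_nat (\<Sum>g | g dvd n. d g)" unfolding Ld by (simp add: lag_def)
  ultimately show thesis using that by blast
qed

text \<open>The hypotheses give gk | g^2 + k^2. After removal of the gcd, each of two coprime
  numbers divides the square of the other, so both are 1.\<close>

lemma square_of_divisor_sum:
  assumes n: "odd n" and nk: "n = g * k" and dvd: "int n dvd x\<^sup>2" "int n dvd y\<^sup>2" and xy: "x - y = int g" "x + y = int k"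
  shows "g = k"
proof -
  have n0: "n > 0" using n by (rule odd_pos)
  then have gk0: "g > 0" "k > 0" using nk by auto
  have "(int g)\<^sup>2 + (int k)\<^sup>2 = 2 * (x\<^sup>2 + y\<^sup>2)"
    unfolding xy[symmetric] by (simp add: power2_eq_square algebra_simps)
  then have "int n dvd int (g\<^sup>2 + k\<^sup>2)" using dvd by simp
  then have *: "g * k dvd g\<^sup>2 + k\<^sup>2" unfolding int_dvd_int_iff nk .
  define D where "D = gcd g k"
  have D: "D > 0" using gk0 by (simp add: D_def)
  obtain g1 k1 where g1: "g = g1 * D" "k = k1 * D" "coprime g1 k1"
    unfolding D_def using gcd_coprime_exists[of g k] gk0 by auto
  have "g1 * k1 * (D * D) dvd (g1\<^sup>2 + k1\<^sup>2) * (D * D)"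
    using * unfolding g1 by (simp add: power2_eq_square algebra_simps)
  then have "g1 * k1 dvd g1\<^sup>2 + k1\<^sup>2" using D by simp
  then have a: "g1 dvd g1\<^sup>2 + k1\<^sup>2" "k1 dvd g1\<^sup>2 + k1\<^sup>2" using dvd_mult_left dvd_mult_right by blast+
  have "g1 dvd k1\<^sup>2" using a(1) by (subst (asm) dvd_add_right_iff) (simp_all add: power2_eq_square)
  then have "g1 = 1" using g1(3) by (metis coprime_common_divisor_nat coprime_power_right_iff dvd_refl)
  have "k1 dvd g1\<^sup>2" using a(2) by (subst (asm) dvd_add_left_iff) (simp_all add: power2_eq_square)
  then have "k1 = 1" using \<open>g1 = 1\<close> by simp
  then show ?thesis using g1 \<open>g1 = 1\<close> by simp
qed

text \<open>The rank one kernel \<open>f(x) f(y)\<close> lies in the commutant, so it is a combination of the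
  \<open>lag n g\<close>, and the support condition leaves only \<open>g\<^sup>2 = n\<close>.\<close>

lemma fourier_eigenvector:
  fixes f :: "int \<Rightarrow> complex"
  assumes n: "odd n" and f: "per n f" and even: "\<And>x. f (- x) = f x" and supp: "\<And>x. f x \<noteq> 0 \<Longrightarrow> int n dvd x\<^sup>2"
    and eig: "\<And>z. (\<Sum>y\<in>{0..<int n}. f y * om n (y * z)) = a * f z" and nz: "f x0 \<noteq> 0"
  obtains s where "s\<^sup>2 = n" "\<And>x. f x = (if int s dvd x then f 0 else 0)"
proof -
  have n0: "n > 0" using n by (rule odd_pos)
  define L where "L x y = f x * f y" for x y
  obtain c where c: "\<And>x y. L x y = (\<Sum>g | g dvd n. c g * lag n g x y)"
  proof (rule commutant[OF n])
    show "kernel n L" using f by (auto simp: kernel_def per_def L_def)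
    show "L (- x) y = L x y" "L x (- y) = L x y" for x y by (simp_all add: L_def even)
    show "fourier_comm n L"
      unfolding fourier_comm_def L_def
    proof (intro allI)
      fix x z
      have "(\<Sum>y\<in>{0..<int n}. f x * f y * om n (y * z)) = f x * (a * f z)"
        unfolding eig[symmetric] by (simp add: sum_distrib_left mult.assoc)
      moreover have "(\<Sum>y\<in>{0..<int n}. om n (x * y) * (f y * f z)) = (a * f x) * f z"
        unfolding eig[symmetric] sum_distrib_right
        by (intro sum.cong refl) (simp only: mult.assoc mult.commute[of x] mult.left_commute[of "om n _"])
      ultimately show "(\<Sum>y\<in>{0..<int n}. f x * f y * om n (y * z)) = (\<Sum>y\<in>{0..<int n}. om n (x * y) * (f y * f z))"
        by simp
    qed
    show "L x y \<noteq> 0 \<Longrightarrow> int n dvd x\<^sup>2 - y\<^sup>2" for x y by (auto simp: L_def intro!: dvd_diff supp)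
  qed blast
  have sq: "g\<^sup>2 = n" if g: "g dvd n" "c g \<noteq> 0" for g
  proof -
    obtain x y where xy: "x - y = int g" "x + y = int (n div g)" using half_sum[OF n g(1)] .
    have "L x y = c g" unfolding c by (rule lag_coefficient[OF n g(1) xy])
    then have "f x \<noteq> 0" "f y \<noteq> 0" using g by (auto simp: L_def)
    then have "g = n div g" using square_of_divisor_sum[OF n _ supp supp xy] g by simp
    then show ?thesis using g by (metis dvd_mult_div_cancel power2_eq_square)
  qed
  have "\<exists>s. s dvd n \<and> c s \<noteq> 0"
  proof (rule ccontr)
    assume "\<not> ?thesis"
    then have "L x0 x0 = 0" unfolding c by (intro sum.neutral) auto
    then show False using nz by (simp add: L_def)
  qed
  then obtain s where s: "s dvd n" "c s \<noteq> 0" by blast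
  have s2: "s\<^sup>2 = n" using sq s by blast
  have "c g = 0" if "g dvd n" "g \<noteq> s" for g
    using sq[OF that(1)] s2 that(2) by (metis power2_eq_iff_nonneg zero_le)
  then have "L x y = (\<Sum>g | g dvd n. if g = s then c s * lag n s x y else 0)" for x y
    unfolding c by (intro sum.cong) auto
  then have Ls: "L x y = c s * lag n s x y" for x y using s n0 by simp
  have ns: "n div s = s" using s2 n0 by (auto simp: power2_eq_square)
  have c0: "f 0 * f 0 = c s" using Ls[of 0 0] by (simp add: L_def lag_def)
  then have f0: "f 0 \<noteq> 0" using s(2) by auto
  have "f x = (if int s dvd x then f 0 else 0)" for x
  proof -
    have "f x * f 0 = (if int s dvd x then f 0 else 0) * f 0"
      using Ls[of x 0] c0 by (auto simp: L_def lag_def ns)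
    then show ?thesis using f0 by (simp only: mult_cancel_right) simp
  qed
  then show thesis using that s2 by blast
qed

section \<open>Physical invariants as matrices over labels\<close>

abbreviation S_c :: "nat \<Rightarrow> idx \<Rightarrow> idx \<Rightarrow> complex" where
  "S_c r i j \<equiv> complex_of_real (S_idx r i j)"

text \<open>T is diagonal, so commuting with it means that nonzero entries join equal eigenvalues;
  \<open>S_c\<close> is S with a common nonzero scalar divided out.\<close>

definition phys_idx :: "nat \<Rightarrow> (idx \<Rightarrow> idx \<Rightarrow> complex) \<Rightarrow> bool" where
  "phys_idx r N \<longleftrightarrow>
     (\<forall>i\<in>idxs r. \<forall>j\<in>idxs r. (\<Sum>k\<in>idxs r. N i k * S_c r k j) = (\<Sum>k\<in>idxs r. S_c r i k * N k j)) \<and>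
     (\<forall>i\<in>idxs r. \<forall>j\<in>idxs r. N i j \<noteq> 0 \<longrightarrow> T_idx r i = T_idx r j) \<and>
     (\<forall>i\<in>idxs r. \<forall>j\<in>idxs r. N i j \<in> \<nat>) \<and> N Vac Vac = 1"

lemma idxs_simps [simp]: "Vac \<in> idxs r" "VacJ \<in> idxs r" "Spin \<in> idxs r" "SpinJ \<in> idxs r" "Gam a \<in> idxs r \<longleftrightarrow> 1 \<le> a \<and> a \<le> r"
  by (auto simp: idxs_def)

lemma finite_idxs [simp]: "finite (idxs r)"
  by (simp add: idxs_def)

lemma vacuum_eq: "r \<ge> 3 \<Longrightarrow> vacuum 2 = wt_of r Vac"
  using wt_of_labels[of r Vac] by (auto simp: vacuum_def)

lemma wmat_eq_idx:
  assumes "r \<ge> 3"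
  shows "wmat_eq r 2 A B \<longleftrightarrow> (\<forall>i\<in>idxs r. \<forall>j\<in>idxs r. A (wt_of r i) (wt_of r j) = B (wt_of r i) (wt_of r j))"
  unfolding wmat_eq_def bij_betw_imp_surj_on[OF wt_of_bij[OF assms], symmetric] by simp

lemma wmat_mult_idx:
  assumes "r \<ge> 3"
  shows "wmat_mult r 2 A B \<mu> \<nu> = (\<Sum>k\<in>idxs r. A \<mu> (wt_of r k) * B (wt_of r k) \<nu>)"
  unfolding wmat_mult_def
  by (rule sum.reindex_bij_betw[OF wt_of_bij[OF assms], of "\<lambda>\<kappa>. A \<mu> \<kappa> * B \<kappa> \<nu>", symmetric])

lemma physical_invariant_idx:
  assumes r: "r \<ge> 3"
  shows "physical_invariant r 2 M \<longleftrightarrow> phys_idx r (\<lambda>i j. M (wt_of r i) (wt_of r j))"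
proof -
  let ?W = "wt_of r" and ?N = "\<lambda>i j. M (wt_of r i) (wt_of r j)"
  have inj: "?W i = ?W j \<longleftrightarrow> i = j" if "i \<in> idxs r" "j \<in> idxs r" for i j
    using wt_of_bij[OF r] that by (auto simp: bij_betw_def inj_on_def)
  have S: "wmat_eq r 2 (wmat_mult r 2 M (S_mat r 2)) (wmat_mult r 2 (S_mat r 2) M) \<longleftrightarrow>
     (\<forall>i\<in>idxs r. \<forall>j\<in>idxs r. (\<Sum>k\<in>idxs r. ?N i k * S_c r k j) = (\<Sum>k\<in>idxs r. S_c r i k * ?N k j))"
  proof -
    have "(wmat_mult r 2 M (S_mat r 2) (?W i) (?W j) = wmat_mult r 2 (S_mat r 2) M (?W i) (?W j))
      \<longleftrightarrow> (\<Sum>k\<in>idxs r. ?N i k * S_c r k j) = (\<Sum>k\<in>idxs r. S_c r i k * ?N k j)"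
      if ij: "i \<in> idxs r" "j \<in> idxs r" for i j
    proof -
      have "wmat_mult r 2 M (S_mat r 2) (?W i) (?W j) = S_norm r * (\<Sum>k\<in>idxs r. ?N i k * S_c r k j)"
        unfolding wmat_mult_idx[OF r] sum_distrib_left
        by (intro sum.cong refl) (simp add: S_mat_idx[OF r _ ij(2)])
      moreover have "wmat_mult r 2 (S_mat r 2) M (?W i) (?W j) = S_norm r * (\<Sum>k\<in>idxs r. S_c r i k * ?N k j)"
        unfolding wmat_mult_idx[OF r] sum_distrib_left
        by (intro sum.cong refl) (simp add: S_mat_idx[OF r ij(1)])
      ultimately show ?thesis using S_norm_nonzero[of r] by simp
    qed
    then show ?thesis unfolding wmat_eq_idx[OF r] by simp
  qed
  have T: "wmat_eq r 2 (wmat_mult r 2 M (T_mat r 2)) (wmat_mult r 2 (T_mat r 2) M) \<longleftrightarrow>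
     (\<forall>i\<in>idxs r. \<forall>j\<in>idxs r. ?N i j \<noteq> 0 \<longrightarrow> T_idx r i = T_idx r j)"
  proof -
    have "(wmat_mult r 2 M (T_mat r 2) (?W i) (?W j) = wmat_mult r 2 (T_mat r 2) M (?W i) (?W j))
      \<longleftrightarrow> (?N i j \<noteq> 0 \<longrightarrow> T_idx r i = T_idx r j)"
      if ij: "i \<in> idxs r" "j \<in> idxs r" for i j
    proof -
      have Te: "T_mat r 2 (?W i) (?W j) = (if i = j then T_norm r * T_idx r i else 0)"
        if "i \<in> idxs r" "j \<in> idxs r" for i j
        using that inj[OF that] T_mat_idx[OF r that(1)] by (auto simp: T_mat_def)
      have "wmat_mult r 2 M (T_mat r 2) (?W i) (?W j) = (\<Sum>k\<in>idxs r. if k = j then ?N i j * (T_norm r * T_idx r j) else 0)"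
        unfolding wmat_mult_idx[OF r] by (intro sum.cong refl) (auto simp: Te ij)
      also have "\<dots> = T_norm r * (?N i j * T_idx r j)" using ij by simp
      finally have a: "wmat_mult r 2 M (T_mat r 2) (?W i) (?W j) = T_norm r * (?N i j * T_idx r j)" .
      have "wmat_mult r 2 (T_mat r 2) M (?W i) (?W j) = (\<Sum>k\<in>idxs r. if k = i then (T_norm r * T_idx r i) * ?N i j else 0)"
        unfolding wmat_mult_idx[OF r] by (intro sum.cong refl) (auto simp: Te ij)
      also have "\<dots> = T_norm r * (?N i j * T_idx r i)" using ij by simp
      finally show ?thesis unfolding a using T_norm_nonzero[of r] r by auto
    qed
    then show ?thesis unfolding wmat_eq_idx[OF r] by simp
  qed
  have N: "(\<forall>\<mu>\<in>P_plus r 2. \<forall>\<nu>\<in>P_plus r 2. M \<mu> \<nu> \<in> \<nat>) \<longleftrightarrow> (\<forall>i\<in>idxs r. \<forall>j\<in>idxs r. ?N i j \<in> \<nat>)"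
    unfolding bij_betw_imp_surj_on[OF wt_of_bij[OF r], symmetric] by simp
  show ?thesis unfolding physical_invariant_def phys_idx_def S T N vacuum_eq[OF r] ..
qed

section \<open>Folding labels onto the residues modulo n\<close>

definition fold_idx :: "nat \<Rightarrow> int \<Rightarrow> nat" where
  "fold_idx r x = (let m = nat (x mod int (2 * r + 1)) in if m \<le> r then m else 2 * r + 1 - m)"

lemma fold_idx_le: "fold_idx r x \<le> r"
  unfolding fold_idx_def Let_def by auto

lemma fold_idx_int: "a \<le> r \<Longrightarrow> fold_idx r (int a) = a"
  by (simp add: fold_idx_def flip: of_nat_mod)

lemma fold_idx_per: "per (2 * r + 1) (fold_idx r)"
  unfolding per_def fold_idx_def by (simp only: mod_eq_dvd_iff[symmetric]) simp

lemma fold_idx_minus: "fold_idx r (- x) = fold_idx r x"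
proof -
  define n where "n = int (2 * r + 1)"
  have n: "n > 0" by (simp add: n_def)
  have "x mod n \<ge> 0" "x mod n < n" using n by simp_all
  then show ?thesis
    unfolding fold_idx_def n_def[symmetric] zmod_zminus1_eq_if Let_def
    by (auto simp: n_def nat_diff_distrib' split: if_splits)
qed

lemma fold_idx_cong: "int (2 * r + 1) dvd x - int (fold_idx r x) \<or> int (2 * r + 1) dvd x + int (fold_idx r x)"
proof -
  define n where "n = int (2 * r + 1)"
  define m where "m = x mod n"
  have m: "m \<ge> 0" "m < n" by (simp_all add: m_def n_def)
  have d: "n dvd x - m" by (simp add: m_def)
  show ?thesis
  proof (cases "nat m \<le> r")
    case True
    then have "int (fold_idx r x) = m" using m by (simp add: fold_idx_def m_def n_def)
    then show ?thesis using d by (simp add: n_def)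
  next
    case False
    then have "fold_idx r x = 2 * r + 1 - nat m" by (simp add: fold_idx_def Let_def m_def n_def)
    moreover have "int (2 * r + 1 - nat m) = n - m" using m by (subst of_nat_diff) (simp_all add: n_def nat_le_iff)
    ultimately have "int (fold_idx r x) = n - m" by simp
    then have "x + int (fold_idx r x) = (x - m) + n" by simp
    then have "n dvd x + int (fold_idx r x)" using dvd_add[OF d dvd_refl[of n]] by (simp only:)
    then show ?thesis by (simp add: n_def)
  qed
qed

lemma fold_idx_square: "int (2 * r + 1) dvd x\<^sup>2 - (int (fold_idx r x))\<^sup>2"
proof -
  have "x\<^sup>2 - (int (fold_idx r x))\<^sup>2 = (x - int (fold_idx r x)) * (x + int (fold_idx r x))"
    by (simp add: power2_eq_square algebra_simps)
  then show ?thesis using fold_idx_cong[of r x] by (auto simp: dvd_mult dvd_mult2)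
qed

lemma cos_fold_idx:
  "cos (2 * pi * real a * real (fold_idx r z) / real (2 * r + 1)) = cos (2 * pi * real a * real_of_int z / real (2 * r + 1))"
proof -
  define n where "n = real (2 * r + 1)"
  have n: "n > 0" by (simp add: n_def)
  obtain m where "z = int (fold_idx r z) + int (2 * r + 1) * m \<or> z = - int (fold_idx r z) + int (2 * r + 1) * m"
    using fold_idx_cong[of r z]
  proof (elim disjE)
    assume "int (2 * r + 1) dvd z - int (fold_idx r z)"
    then obtain m where "z - int (fold_idx r z) = int (2 * r + 1) * m" ..
    then show thesis using that[of m] by linarith
  next
    assume "int (2 * r + 1) dvd z + int (fold_idx r z)"
    then obtain m where "z + int (fold_idx r z) = int (2 * r + 1) * m" ..
    then show thesis using that[of m] by linarith
  qed
  then have "real_of_int z = real_of_int (int (fold_idx r z) + int (2 * r + 1) * m)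
      \<or> real_of_int z = real_of_int (- int (fold_idx r z) + int (2 * r + 1) * m)"
    by (simp only: of_int_eq_iff)
  then have "real_of_int z = real (fold_idx r z) + n * real_of_int m \<or> real_of_int z = - real (fold_idx r z) + n * real_of_int m"
    by (simp add: n_def)
  moreover have e: "2 * pi * real a * (x + n * real_of_int m) / n = 2 * pi * real a * x / n + 2 * pi * real_of_int (int a * m)" for x
    using n by (simp add: field_simps)
  ultimately show ?thesis
  proof (elim disjE)
    assume z: "real_of_int z = real (fold_idx r z) + n * real_of_int m"
    show ?thesis unfolding n_def[symmetric] z e by (simp only: cos_add cos_int_2pin sin_int_2pin mult_1_right mult_zero_right diff_zero)
  next
    assume z: "real_of_int z = - real (fold_idx r z) + n * real_of_int m"
    have "2 * pi * real a * - real (fold_idx r z) / n = - (2 * pi * real a * real (fold_idx r z) / n)" by simp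
    then show ?thesis
      unfolding n_def[symmetric] z e
      by (simp only: cos_add cos_int_2pin sin_int_2pin mult_1_right mult_zero_right diff_zero cos_minus)
  qed
qed

definition push :: "nat \<Rightarrow> (idx \<Rightarrow> complex) \<Rightarrow> int \<Rightarrow> complex" where
  "push r f x = (if fold_idx r x = 0 then f Vac + f VacJ else f (Gam (fold_idx r x)))"

lemma push_int: "a \<le> r \<Longrightarrow> push r f (int a) = (if a = 0 then f Vac + f VacJ else f (Gam a))"
  by (simp add: push_def fold_idx_int)

lemma push_cong: "(\<And>i. i \<in> idxs r \<Longrightarrow> \<not> spinor i \<Longrightarrow> f i = g i) \<Longrightarrow> push r f x = push r g x"
  using fold_idx_le[of r x] by (auto simp: push_def)

lemma push_per: "per (2 * r + 1) (push r f)"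
  using fold_idx_per[of r] unfolding per_def push_def by simp

lemma push_minus: "push r f (- x) = push r f x"
  by (simp add: push_def fold_idx_minus)

lemma push_sum: "push r (\<lambda>i. \<Sum>k\<in>A. g k i) x = (\<Sum>k\<in>A. push r (g k) x)"
  by (simp add: push_def sum.distrib)

lemma push_scale: "push r (\<lambda>i. c * f i) x = c * push r f x"
  by (simp add: push_def distrib_left)

lemma push_fourier:
  "(\<Sum>y\<in>{0..<int (2 * r + 1)}. push r f y * om (2 * r + 1) (y * z))
    = f Vac + f VacJ + (\<Sum>a = 1..r. f (Gam a) * complex_of_real (2 * cos (2 * pi * real a * real_of_int z / real (2 * r + 1))))"
proof -
  let ?n = "2 * r + 1"
  let ?g = "\<lambda>y. push r f y * om ?n (y * z)"
  have "{0..<int ?n} = int ` {..<?n}" by (simp only: lessThan_atLeast0 image_int_atLeastLessThan of_nat_0)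
  then have "(\<Sum>y\<in>{0..<int ?n}. ?g y) = (\<Sum>t<?n. ?g (int t))"
    by (simp only: sum.reindex inj_on_of_nat o_def)
  also have "\<dots> = ?g (int 0) + (\<Sum>c = 1..r. ?g (int c) + ?g (int (?n - c)))"
    by (rule sum_odd_symmetric)
  also have "(\<Sum>c = 1..r. ?g (int c) + ?g (int (?n - c)))
    = (\<Sum>a = 1..r. f (Gam a) * complex_of_real (2 * cos (2 * pi * real a * real_of_int z / real ?n)))"
  proof (rule sum.cong[OF refl])
    fix c assume c: "c \<in> {1..r}"
    have d: "int (?n - c) = int ?n + - int c" using c by (simp add: of_nat_diff)
    have "push r f (int (?n - c)) = push r f (- int c)" by (rule perD[OF push_per]) (simp only: d, simp)
    then have p: "push r f (int c) = f (Gam c)" "push r f (int (?n - c)) = f (Gam c)"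
      using c by (simp_all add: push_minus push_int)
    have "om ?n (int (?n - c) * z) = om ?n (- (int c * z))"
    proof (rule om_cong)
      have "int (?n - c) * z - - (int c * z) = int ?n * z" by (simp only: d distrib_right)
      then show "int ?n dvd int (?n - c) * z - - (int c * z)" by (simp only: dvd_triv_left)
    qed simp
    moreover have "om ?n (int c * z) + om ?n (- (int c * z)) = complex_of_real (2 * cos (2 * pi * real c * real_of_int z / real ?n))"
      by (simp add: om_def complex_eq_iff mult_ac)
    ultimately show "?g (int c) + ?g (int (?n - c)) = f (Gam c) * complex_of_real (2 * cos (2 * pi * real c * real_of_int z / real ?n))"
      unfolding p by (metis distrib_left)
  qed
  finally show ?thesis using push_int[of 0 r f] by simp
qed

text \<open>Adding the entries at 0 and J0 cancels everything that involves a spinor, since those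
  entries have opposite signs there and vanish at the \<open>Gam a\<close>. This is why the folded
  kernel meets only the Fourier part of S.\<close>

lemma push_S_idx:
  assumes "k \<in> idxs r"
  shows "push r (S_c r k) z = (if spinor k then 0 else complex_of_real (2 * mult_of k * cos (2 * pi * real (index_of k) * real_of_int z / real (2 * r + 1))))"
proof (cases "spinor k")
  case True
  then show ?thesis by (simp add: push_def S_idx_def)
next
  case False
  have "push r (S_c r k) z = complex_of_real (2 * mult_of k * cos (2 * pi * real (index_of k) * real (fold_idx r z) / real (2 * r + 1)))"
    using False by (simp add: push_def S_idx_def)
  then show ?thesis using False by (simp only: cos_fold_idx if_False)
qed

lemma push_S:
  "push r (\<lambda>j. \<Sum>k\<in>idxs r. f k * S_c r k j) z = 2 * (\<Sum>y\<in>{0..<int (2 * r + 1)}. push r f y * om (2 * r + 1) (y * z))"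
proof -
  have "push r (\<lambda>j. \<Sum>k\<in>idxs r. f k * S_c r k j) z = (\<Sum>k\<in>idxs r. f k * push r (S_c r k) z)"
    unfolding push_sum push_scale ..
  also have "\<dots> = f Vac * 2 + f VacJ * 2 + (\<Sum>a = 1..r. f (Gam a) * (4 * complex_of_real (cos (2 * pi * real a * real_of_int z / real (2 * r + 1)))))"
    unfolding sum_idxs by (simp add: push_S_idx)
  also have "\<dots> = 2 * (f Vac + f VacJ + (\<Sum>a = 1..r. f (Gam a) * complex_of_real (2 * cos (2 * pi * real a * real_of_int z / real (2 * r + 1)))))"
    by (simp add: distrib_left sum_distrib_left mult_ac)
  finally show ?thesis by (simp only: push_fourier)
qed

definition fold_kernel :: "nat \<Rightarrow> (idx \<Rightarrow> idx \<Rightarrow> complex) \<Rightarrow> int \<Rightarrow> int \<Rightarrow> complex" where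
  "fold_kernel r N x y = push r (\<lambda>i. push r (N i) y) x"

lemma fold_kernel_kernel: "kernel (2 * r + 1) (fold_kernel r N)"
proof -
  have "push r (N i) y = push r (N i) y'" if "int (2 * r + 1) dvd y - y'" for i y y'
    using perD[OF push_per that] .
  then have "fold_kernel r N x y = fold_kernel r N x y'" if "int (2 * r + 1) dvd y - y'" for x y y'
    unfolding fold_kernel_def using that by presburger
  then show ?thesis unfolding kernel_def using push_per[of r] by (auto simp: per_def fold_kernel_def)
qed

lemma fold_kernel_even: "fold_kernel r N (- x) y = fold_kernel r N x y" "fold_kernel r N x (- y) = fold_kernel r N x y"
  by (simp_all add: fold_kernel_def push_minus)

lemma fold_kernel_comm:
  assumes comm: "\<And>i j. i \<in> idxs r \<Longrightarrow> j \<in> idxs r \<Longrightarrow> (\<Sum>k\<in>idxs r. N i k * S_c r k j) = (\<Sum>k\<in>idxs r. S_c r i k * N k j)"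
  shows "fourier_comm (2 * r + 1) (fold_kernel r N)"
  unfolding fourier_comm_def
proof (intro allI)
  fix x z
  let ?n = "2 * r + 1" let ?Z = "{0..<int (2 * r + 1)}"
  have "2 * (\<Sum>y\<in>?Z. fold_kernel r N x y * om ?n (y * z)) = push r (\<lambda>i. 2 * (\<Sum>y\<in>?Z. push r (N i) y * om ?n (y * z))) x"
    unfolding push_scale fold_kernel_def by (simp add: push_def sum.distrib distrib_right)
  also have "\<dots> = push r (\<lambda>i. push r (\<lambda>j. \<Sum>k\<in>idxs r. N i k * S_c r k j) z) x"
    by (simp only: push_S)
  also have "\<dots> = push r (\<lambda>i. push r (\<lambda>j. \<Sum>k\<in>idxs r. S_c r i k * N k j) z) x"
    by (intro push_cong comm)
  also have "\<dots> = push r (\<lambda>i. \<Sum>k\<in>idxs r. push r (N k) z * S_c r k i) x"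
  proof -
    have "push r (\<lambda>j. \<Sum>k\<in>idxs r. S_c r i k * N k j) z = (\<Sum>k\<in>idxs r. push r (N k) z * S_c r k i)" for i
      unfolding push_sum push_scale by (simp only: S_idx_commute[of r i] mult.commute)
    then show ?thesis by (simp only:)
  qed
  also have "\<dots> = 2 * (\<Sum>y\<in>?Z. push r (\<lambda>k. push r (N k) z) y * om ?n (y * x))"
    by (rule push_S)
  finally show "(\<Sum>y\<in>?Z. fold_kernel r N x y * om ?n (y * z)) = (\<Sum>y\<in>?Z. om ?n (x * y) * fold_kernel r N y z)"
    by (simp add: fold_kernel_def mult.commute)
qed

lemma index_of_le: "i \<in> idxs r \<Longrightarrow> index_of i \<le> r"
  by (cases i) auto

text \<open>As n is odd, one of a and n - a is even, so the exponent a(n - a)/2 is an integer and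
  the eigenvalue is an n-th root of unity.\<close>

lemma T_idx_nonspinor:
  assumes "i \<in> idxs r" "\<not> spinor i"
  obtains e where "T_idx r i = cis (2 * pi * real_of_int e / real (2 * r + 1))"
    "2 * e = int (index_of i) * (int (2 * r + 1) - int (index_of i))"
proof -
  define a where "a = index_of i"
  have a: "a \<le> r" using index_of_le[OF assms(1)] by (simp add: a_def)
  have "even (int a * (int (2 * r + 1) - int a))" by (cases "even a") auto
  then obtain e where e: "int a * (int (2 * r + 1) - int a) = 2 * e" by (elim evenE)
  have "T_idx r i = cis (pi * real (a * (2 * r + 1 - a)) / real (2 * r + 1))"
    using assms by (cases i) (auto simp: a_def)
  also have "real (a * (2 * r + 1 - a)) = real_of_int (int a * (int (2 * r + 1) - int a))" using a by (simp add: of_nat_diff)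
  also have "pi * \<dots> = 2 * pi * real_of_int e" unfolding e by simp
  finally show thesis using that e by (simp add: a_def)
qed

lemma T_idx_eq_square:
  assumes "i \<in> idxs r" "\<not> spinor i" "j \<in> idxs r" "\<not> spinor j" "T_idx r i = T_idx r j"
  shows "int (2 * r + 1) dvd (int (index_of i))\<^sup>2 - (int (index_of j))\<^sup>2"
proof -
  let ?n = "2 * r + 1" let ?a = "int (index_of i)" let ?b = "int (index_of j)"
  obtain e where e: "T_idx r i = cis (2 * pi * real_of_int e / real ?n)" "2 * e = ?a * (int ?n - ?a)"
    using T_idx_nonspinor[OF assms(1,2)] .
  obtain f where f: "T_idx r j = cis (2 * pi * real_of_int f / real ?n)" "2 * f = ?b * (int ?n - ?b)"
    using T_idx_nonspinor[OF assms(3,4)] .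
  have "cis (2 * pi * real_of_int (e - f) / real ?n) = T_idx r i / T_idx r j"
    unfolding e(1) f(1) cis_divide by (simp add: diff_divide_distrib right_diff_distrib)
  also have "\<dots> = 1" using assms(5) f(1) by simp
  finally have "int ?n dvd e - f" by (subst (asm) cis_eq_1_iff_int) auto
  then have "int ?n dvd 2 * (e - f)" by (rule dvd_mult)
  also have "2 * (e - f) = int ?n * (?a - ?b) - (?a\<^sup>2 - ?b\<^sup>2)"
    using e(2) f(2) by (simp add: algebra_simps power2_eq_square)
  finally show ?thesis by (metis dvd_diff_commute dvd_diff_right_iff dvd_triv_left)
qed

lemma fold_kernel_supp:
  assumes T: "\<And>i j. i \<in> idxs r \<Longrightarrow> j \<in> idxs r \<Longrightarrow> N i j \<noteq> 0 \<Longrightarrow> T_idx r i = T_idx r j"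
    and nz: "fold_kernel r N x y \<noteq> 0"
  shows "int (2 * r + 1) dvd x\<^sup>2 - y\<^sup>2"
proof -
  have ex: "\<exists>i\<in>idxs r. \<not> spinor i \<and> index_of i = fold_idx r x \<and> f i \<noteq> 0" if "push r f x \<noteq> 0" for f x
  proof (cases "fold_idx r x = 0")
    case True
    then have "f Vac \<noteq> 0 \<or> f VacJ \<noteq> 0" using that by (auto simp: push_def)
    then show ?thesis using True by (auto intro: bexI[of _ Vac] bexI[of _ VacJ])
  next
    case False
    then show ?thesis using that fold_idx_le[of r x] by (intro bexI[of _ "Gam (fold_idx r x)"]) (auto simp: push_def)
  qed
  obtain i where i: "i \<in> idxs r" "\<not> spinor i" "index_of i = fold_idx r x" "push r (N i) y \<noteq> 0"
    using ex nz unfolding fold_kernel_def by blast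
  obtain j where j: "j \<in> idxs r" "\<not> spinor j" "index_of j = fold_idx r y" "N i j \<noteq> 0"
    using ex i(4) by blast
  have "int (2 * r + 1) dvd (int (fold_idx r x))\<^sup>2 - (int (fold_idx r y))\<^sup>2"
    using T_idx_eq_square[OF i(1,2) j(1,2) T[OF i(1) j(1,4)]] by (simp add: i j)
  then have "int (2 * r + 1) dvd (x\<^sup>2 - (int (fold_idx r x))\<^sup>2) - (y\<^sup>2 - (int (fold_idx r y))\<^sup>2)
      + ((int (fold_idx r x))\<^sup>2 - (int (fold_idx r y))\<^sup>2)"
    by (intro dvd_add[OF dvd_diff[OF fold_idx_square fold_idx_square]])
  then show ?thesis by simp
qed

text \<open>The two spinors are ordered so that only \<open>lam r\<close> can have the eigenvalue of \<open>T\<close> at \<open>0\<close>.\<close>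

definition lam :: "nat \<Rightarrow> idx" where
  "lam r = (if 8 dvd r then Spin else SpinJ)"

definition mu :: "nat \<Rightarrow> idx" where
  "mu r = (if 8 dvd r then SpinJ else Spin)"

lemma lam_mu_simps [simp]:
  "lam r \<in> idxs r" "mu r \<in> idxs r" "spinor (lam r)" "spinor (mu r)" "lam r \<noteq> mu r" "mu r \<noteq> lam r"
  "lam r \<noteq> Vac" "lam r \<noteq> VacJ" "lam r \<noteq> Gam a" "mu r \<noteq> Vac" "mu r \<noteq> VacJ" "mu r \<noteq> Gam a"
  "Vac \<noteq> lam r" "VacJ \<noteq> lam r" "Gam a \<noteq> lam r" "Vac \<noteq> mu r" "VacJ \<noteq> mu r" "Gam a \<noteq> mu r"
  by (simp_all add: lam_def mu_def)

lemma spinor_iff: "spinor i \<longleftrightarrow> i = lam r \<or> i = mu r"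
  by (cases i) (auto simp: lam_def mu_def)

lemma idx_cases:
  assumes "i \<in> idxs r"
  obtains "i = Vac" | "i = VacJ" | "i = lam r" | "i = mu r" | a where "i = Gam a" "1 \<le> a" "a \<le> r"
  using assms by (cases i; cases "8 dvd r") (auto simp: lam_def mu_def)


lemma sum_lam_mu: "(\<Sum>k\<in>idxs r. f k) = f Vac + f VacJ + f (lam r) + f (mu r) + (\<Sum>a = 1..r. f (Gam a))"
  for f :: "idx \<Rightarrow> complex"
  unfolding sum_idxs lam_def mu_def by simp

section \<open>Separating spinors from nonspinors by S and T\<close>

definition sqrt_n :: "nat \<Rightarrow> complex" where
  "sqrt_n r = complex_of_real (sqrt (real (2 * r + 1)))"

lemma sqrt_n_nonzero: "sqrt_n r \<noteq> 0"
  by (simp add: sqrt_n_def)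

lemma S_c_spinor:
  "S_c r Vac (lam r) = sqrt_n r" "S_c r VacJ (lam r) = - sqrt_n r" "S_c r (Gam a) (lam r) = 0"
  "S_c r Vac (mu r) = sqrt_n r" "S_c r VacJ (mu r) = - sqrt_n r" "S_c r (Gam a) (mu r) = 0"
  "S_c r (lam r) (mu r) = - sqrt_n r" "S_c r (mu r) (lam r) = - sqrt_n r" "S_c r (lam r) (lam r) = sqrt_n r" "S_c r (mu r) (mu r) = sqrt_n r"
  by (auto simp: S_idx_def lam_def mu_def sqrt_n_def)

lemma S_c_charge: "\<not> spinor i \<Longrightarrow> S_c r i (mu r) = complex_of_real (charge i) * sqrt_n r"
  "\<not> spinor i \<Longrightarrow> S_c r i (lam r) = complex_of_real (charge i) * sqrt_n r"
  by (cases i; auto simp: S_idx_def lam_def mu_def sqrt_n_def)+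

text \<open>An odd n satisfies n^2 = 1 modulo 8, hence u = u^(n n) = 1.\<close>

lemma root_of_unity_one:
  fixes u :: complex
  assumes "u ^ 8 = 1" "u ^ n = 1" "odd n"
  shows "u = 1"
proof -
  have "[n * n = 1] (mod 8)" if "n mod 8 \<in> {1, 3, 5, 7}" for n :: nat
  proof -
    have "(n * n) mod 8 = ((n mod 8) * (n mod 8)) mod 8" by (simp add: mod_mult_eq)
    then show ?thesis using that by (auto simp: cong_def)
  qed
  moreover have "n mod 8 \<in> {1, 3, 5, 7}" using assms(3) by (simp, presburger)
  ultimately have "n * n mod 8 = 1" by (simp add: cong_def)
  then obtain m where m: "n * n = 8 * m + 1" by (metis mult_div_mod_eq)
  have "(u ^ n) ^ n = u ^ (8 * m + 1)" by (simp only: power_mult[symmetric] m)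
  then have "1 = (u ^ 8) ^ m * u" using assms by (simp add: power_add power_mult)
  then show ?thesis using assms by simp
qed

lemma T_idx_nonspinor_power:
  assumes "i \<in> idxs r" "\<not> spinor i"
  shows "T_idx r i ^ (2 * r + 1) = 1"
proof -
  obtain e where e: "T_idx r i = cis (2 * pi * real_of_int e / real (2 * r + 1))" using T_idx_nonspinor[OF assms] .
  have "T_idx r i ^ (2 * r + 1) = cis (real (2 * r + 1) * (2 * pi * real_of_int e / real (2 * r + 1)))"
    unfolding e by (rule DeMoivre)
  also have "real (2 * r + 1) * (2 * pi * real_of_int e / real (2 * r + 1)) = 2 * pi * real_of_int e"
    by (simp add: field_simps)
  also have "cis \<dots> = 1" using cis_eq_1_iff_int[of 1 e] by (simp only: of_nat_1 div_by_1 dvd_refl one_dvd zero_less_one simp_thms)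
  finally show ?thesis .
qed

lemma T_idx_spinor_power: "spinor i \<Longrightarrow> T_idx r i ^ 8 = 1"
proof -
  have "cis (pi * real r / 4) ^ 8 = cis (real 8 * (pi * real r / 4))" by (rule DeMoivre)
  also have "real 8 * (pi * real r / 4) = 2 * pi * real_of_int (int r) / real 1" by simp
  also have "cis \<dots> = 1" by (subst cis_eq_1_iff_int) simp_all
  finally have "cis (pi * real r / 4) ^ 8 = 1" .
  then show "spinor i \<Longrightarrow> T_idx r i ^ 8 = 1" by (cases i) simp_all
qed

lemma cis_eq_1_iff_8_dvd: "cis (pi * real r / 4) = 1 \<longleftrightarrow> 8 dvd r"
proof -
  have "cis (pi * real r / 4) = 1 \<longleftrightarrow> int 8 dvd int r"
    using cis_eq_1_iff_int[of 8 "int r"] by simp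
  then show ?thesis by (simp only: int_dvd_int_iff)
qed

lemma T_mu_ne_one: "T_idx r (mu r) \<noteq> 1"
  using cis_eq_1_iff_8_dvd[of r] by (auto simp: mu_def)

text \<open>Spinor eigenvalues are 8th roots of unity and the others n-th roots with n odd, so they
  can meet only at 1, which \<open>mu r\<close> avoids. The two spinors themselves have opposite
  eigenvalues.\<close>

lemma T_mu:
  assumes "i \<in> idxs r" "i \<noteq> mu r"
  shows "T_idx r i \<noteq> T_idx r (mu r)"
proof (cases "spinor i")
  case True
  then have "i = lam r" using assms spinor_iff[of i r] by simp
  moreover have "cis x \<noteq> - cis x" for x by (simp add: eq_neg_iff_add_eq_0)
  ultimately show ?thesis by (auto simp: lam_def mu_def eq_neg_iff_add_eq_0 add_eq_0_iff)
next
  case False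
  show ?thesis
  proof
    assume eq: "T_idx r i = T_idx r (mu r)"
    have "T_idx r i ^ 8 = 1" unfolding eq by (rule T_idx_spinor_power) simp
    then have "T_idx r i = 1"
      by (rule root_of_unity_one[OF _ T_idx_nonspinor_power[OF assms(1) False]]) simp
    then have "T_idx r (mu r) = 1" using eq by simp
    then show False using T_mu_ne_one by simp
  qed
qed

lemma T_lam:
  assumes "i \<in> idxs r" "\<not> spinor i" "T_idx r i = T_idx r (lam r)"
  shows "int (2 * r + 1) dvd (int (index_of i))\<^sup>2"
proof -
  have "T_idx r i ^ 8 = 1" unfolding assms(3) by (rule T_idx_spinor_power) simp
  then have "T_idx r i = 1"
    by (rule root_of_unity_one[OF _ T_idx_nonspinor_power[OF assms(1,2)]]) simp
  then have "int (2 * r + 1) dvd (int (index_of i))\<^sup>2 - (int (index_of Vac))\<^sup>2"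
    using assms by (intro T_idx_eq_square) auto
  then show ?thesis by simp
qed

text \<open>S is symmetric and the remaining conditions are symmetric in the two indices; every fact
  about columns thereby becomes one about rows.\<close>

lemma phys_idx_transpose:
  assumes "phys_idx r N"
  shows "phys_idx r (\<lambda>i j. N j i)"
proof -
  have "(\<Sum>k\<in>idxs r. N k i * S_c r k j) = (\<Sum>k\<in>idxs r. S_c r i k * N j k)" if "i \<in> idxs r" "j \<in> idxs r" for i j
  proof -
    have "(\<Sum>k\<in>idxs r. N k i * S_c r k j) = (\<Sum>k\<in>idxs r. S_c r j k * N k i)"
      by (intro sum.cong refl) (simp add: S_idx_commute[of r _ j] mult.commute)
    also have "\<dots> = (\<Sum>k\<in>idxs r. N j k * S_c r k i)" using assms that by (simp add: phys_idx_def)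
    also have "\<dots> = (\<Sum>k\<in>idxs r. S_c r i k * N j k)"
      by (intro sum.cong refl) (simp add: S_idx_commute[of r _ i] mult.commute)
    finally show ?thesis .
  qed
  then show ?thesis using assms by (auto simp: phys_idx_def)
qed

text \<open>The spinor \<open>mu r\<close> couples to nothing but itself since \<open>T\<close> separates it from all other
  weights.  The column of \<open>mu r\<close> in \<open>N S = S N\<close> then expresses the asymmetry between \<open>0\<close> and
  \<open>J0\<close> through the column of \<open>lam r\<close>, which pushes forward to an eigenvector of the Fourier
  transform.\<close>

lemma mu_column:
  assumes N: "phys_idx r N"
  shows column_mu: "\<And>i. i \<in> idxs r \<Longrightarrow> i \<noteq> mu r \<Longrightarrow> N i (mu r) = 0"
    and column_vac: "\<And>i. i \<in> idxs r \<Longrightarrow> \<not> spinor i \<Longrightarrow>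
      N i Vac - N i VacJ - N i (lam r) = N (mu r) (mu r) * complex_of_real (charge i)"
    and column_diff: "N Vac (lam r) - N VacJ (lam r) = N (lam r) (lam r) - N (mu r) (mu r)"
    and column_lam: "(N Vac (lam r) + N VacJ (lam r) = 0 \<and> (\<forall>a\<in>{1..r}. N (Gam a) (lam r) = 0))
      \<or> (\<exists>s. s\<^sup>2 = 2 * r + 1 \<and> (\<forall>a\<in>{1..r}. N (Gam a) (lam r) = (if s dvd a then N Vac (lam r) + N VacJ (lam r) else 0)))"
proof -
  let ?l = "lam r" and ?m = "mu r" and ?n = "2 * r + 1"
  have comm: "(\<Sum>k\<in>idxs r. N i k * S_c r k j) = (\<Sum>k\<in>idxs r. S_c r i k * N k j)" if "i \<in> idxs r" "j \<in> idxs r" for i j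
    using N that by (simp add: phys_idx_def)
  have T: "T_idx r i = T_idx r j" if "i \<in> idxs r" "j \<in> idxs r" "N i j \<noteq> 0" for i j
    using N that by (simp add: phys_idx_def)
  show M0: "N i ?m = 0" if "i \<in> idxs r" "i \<noteq> ?m" for i
    using T[of i ?m] T_mu[OF that] that by auto
  show G1: "N i Vac - N i VacJ - N i ?l = N ?m ?m * complex_of_real (charge i)" if i: "i \<in> idxs r" "\<not> spinor i" for i
  proof -
    have im: "i \<noteq> ?m" using i(2) by auto
    have "sqrt_n r * (N i Vac - N i VacJ - N i ?l) = (\<Sum>k\<in>idxs r. N i k * S_c r k ?m)"
      unfolding sum_lam_mu S_c_spinor using M0[OF i(1) im] by (simp add: algebra_simps)
    also have "\<dots> = (\<Sum>k\<in>idxs r. S_c r i k * N k ?m)" using i by (intro comm) auto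
    also have "\<dots> = S_c r i ?m * N ?m ?m" unfolding sum_lam_mu by (simp add: M0)
    also have "\<dots> = sqrt_n r * (N ?m ?m * complex_of_real (charge i))" unfolding S_c_charge(1)[OF i(2)] by simp
    finally show ?thesis using sqrt_n_nonzero[of r] by simp
  qed
  have G2: "sqrt_n r * (2 * N i ?l + N ?m ?m * complex_of_real (charge i)) = (\<Sum>k\<in>idxs r. N k ?l * S_c r k i)"
    if i: "i \<in> idxs r" "\<not> spinor i" for i
  proof -
    have im: "i \<noteq> ?m" using i(2) by auto
    have "sqrt_n r * (2 * N i ?l + N ?m ?m * complex_of_real (charge i)) = sqrt_n r * (N i Vac - N i VacJ + N i ?l)"
      unfolding G1[OF i, symmetric] by (simp add: algebra_simps)
    also have "\<dots> = (\<Sum>k\<in>idxs r. N i k * S_c r k ?l)"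
      unfolding sum_lam_mu S_c_spinor using M0[OF i(1) im] by (simp add: algebra_simps)
    also have "\<dots> = (\<Sum>k\<in>idxs r. S_c r i k * N k ?l)" using i by (intro comm) auto
    finally show ?thesis by (simp add: S_idx_commute[of r i] mult.commute)
  qed
  have ml: "N ?m ?l = 0" using T[of ?m ?l] T_mu[of ?l r] by auto
  show "N Vac ?l - N VacJ ?l = N ?l ?l - N ?m ?m"
  proof -
    \<comment> \<open>The rows of 0 and J0 in S agree on nonspinors, so only the spinor entry
      survives the difference.\<close>
    have sub: "(\<Sum>k\<in>idxs r. N k ?l * S_c r k Vac) - (\<Sum>k\<in>idxs r. N k ?l * S_c r k VacJ) = 2 * sqrt_n r * N ?l ?l"
    proof -
      have "S_c r (Gam a) Vac = S_c r (Gam a) VacJ" "S_c r Vac Vac = S_c r Vac VacJ" "S_c r VacJ Vac = S_c r VacJ VacJ" for a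
        by (simp_all add: S_idx_def)
      moreover have "S_c r ?l Vac = sqrt_n r" "S_c r ?l VacJ = - sqrt_n r"
        by (simp_all only: S_idx_commute[of r ?l] S_c_spinor)
      ultimately show ?thesis unfolding sum_lam_mu using ml by simp
    qed
    have c: "2 * sqrt_n r \<noteq> 0" using sqrt_n_nonzero[of r] by simp
    have "2 * sqrt_n r * (N Vac ?l - N VacJ ?l + N ?m ?m) = 2 * sqrt_n r * N ?l ?l"
      unfolding sub[symmetric] G2[of Vac, symmetric, simplified] G2[of VacJ, symmetric, simplified] by (simp add: algebra_simps)
    then have "N Vac ?l - N VacJ ?l + N ?m ?m = N ?l ?l" unfolding mult_left_cancel[OF c] .
    then show ?thesis by (simp add: algebra_simps)
  qed
  define f where "f = push r (\<lambda>k. N k ?l)"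
  \<comment> \<open>The charges of 0 and J0 cancel under \<open>push\<close>, which removes the
    inhomogeneous term from the preceding identity.\<close>
  have eig: "(\<Sum>y\<in>{0..<int ?n}. f y * om ?n (y * z)) = sqrt_n r * f z" for z
  proof -
    have "2 * (\<Sum>y\<in>{0..<int ?n}. f y * om ?n (y * z)) = push r (\<lambda>i. \<Sum>k\<in>idxs r. N k ?l * S_c r k i) z"
      unfolding push_S f_def ..
    also have "\<dots> = push r (\<lambda>i. sqrt_n r * (2 * N i ?l + N ?m ?m * complex_of_real (charge i))) z"
      by (rule push_cong) (rule G2[symmetric])
    also have "\<dots> = sqrt_n r * (2 * f z)"
    proof -
      have "push r (\<lambda>i. 2 * N i ?l + N ?m ?m * complex_of_real (charge i)) z = 2 * f z"
        unfolding f_def push_def by simp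
      then show ?thesis unfolding push_scale by simp
    qed
    finally show ?thesis by simp
  qed
  have supp: "int ?n dvd x\<^sup>2" if "f x \<noteq> 0" for x
  proof -
    have "\<exists>i\<in>idxs r. \<not> spinor i \<and> index_of i = fold_idx r x \<and> N i ?l \<noteq> 0"
    proof (cases "fold_idx r x = 0")
      case True
      then have "N Vac ?l \<noteq> 0 \<or> N VacJ ?l \<noteq> 0" using that by (auto simp: push_def f_def)
      then show ?thesis using True by (auto intro: bexI[of _ Vac] bexI[of _ VacJ])
    next
      case False
      then show ?thesis using that fold_idx_le[of r x] by (intro bexI[of _ "Gam (fold_idx r x)"]) (auto simp: push_def f_def)
    qed
    then obtain i where i: "i \<in> idxs r" "\<not> spinor i" "index_of i = fold_idx r x" "N i ?l \<noteq> 0" by blast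
    have "int ?n dvd (int (fold_idx r x))\<^sup>2" using T_lam[OF i(1,2) T[OF i(1) _ i(4)]] i(3) by simp
    then have "int ?n dvd (x\<^sup>2 - (int (fold_idx r x))\<^sup>2) + (int (fold_idx r x))\<^sup>2" by (intro dvd_add fold_idx_square)
    then show ?thesis by simp
  qed
  have f0: "f 0 = N Vac ?l + N VacJ ?l" using push_int[of 0 r "\<lambda>k. N k ?l"] by (simp add: f_def)
  have fa: "f (int a) = N (Gam a) ?l" if "a \<in> {1..r}" for a using that by (simp add: f_def push_int)
  show "(N Vac ?l + N VacJ ?l = 0 \<and> (\<forall>a\<in>{1..r}. N (Gam a) ?l = 0))
      \<or> (\<exists>s. s\<^sup>2 = ?n \<and> (\<forall>a\<in>{1..r}. N (Gam a) ?l = (if s dvd a then N Vac ?l + N VacJ ?l else 0)))"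
  proof (cases "\<forall>x. f x = 0")
    case True
    then show ?thesis using f0 fa by metis
  next
    case False
    then obtain x0 where "f x0 \<noteq> 0" by blast
    then obtain s where s: "s\<^sup>2 = ?n" "\<And>x. f x = (if int s dvd x then f 0 else 0)"
      using fourier_eigenvector[of ?n f "sqrt_n r" x0] push_per[of r] push_minus[of r] supp eig unfolding f_def by auto
    have "N (Gam a) ?l = (if s dvd a then N Vac ?l + N VacJ ?l else 0)" if "a \<in> {1..r}" for a
      using s(2)[of "int a"] fa[OF that] f0 by simp
    then show ?thesis using s(1) by blast
  qed
qed

section \<open>Classification\<close>

text \<open>The kernel \<open>K\<close> couples the \<open>J\<close>-symmetric combinations of nonspinors; the scalar \<open>y\<close> couples the
  antisymmetric combination of \<open>0\<close> and \<open>J0\<close>, and each spinor, with itself.\<close>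

definition kernel_mat :: "(int \<Rightarrow> int \<Rightarrow> complex) \<Rightarrow> complex \<Rightarrow> idx \<Rightarrow> idx \<Rightarrow> complex" where
  "kernel_mat K y i j = (if spinor i \<or> spinor j then if i = j then y else 0
     else K (int (index_of i)) (int (index_of j)) * complex_of_real (mult_of i * mult_of j / 4)
       + y * complex_of_real (charge i * charge j / 2))"

text \<open>For s^2 = n this vector and the next two belong to one eigenvalue of \<open>S_c\<close>,
  and on labels \<open>lam_vec\<close> is half the sum of the others. The exceptional matrices are
  assembled from products of these vectors and, for one of them, a multiple of an identity
  block.\<close>

definition lam_vec :: "nat \<Rightarrow> nat \<Rightarrow> idx \<Rightarrow> complex" where
  "lam_vec r s i = (case i of Vac \<Rightarrow> 1 | VacJ \<Rightarrow> 0 | Gam a \<Rightarrow> if s dvd a then 1 else 0 | _ \<Rightarrow> if i = lam r then 1 else 0)"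

definition square_vec :: "nat \<Rightarrow> idx \<Rightarrow> complex" where
  "square_vec s i = (case i of Vac \<Rightarrow> 1 | VacJ \<Rightarrow> 1 | Gam a \<Rightarrow> if s dvd a then 2 else 0 | _ \<Rightarrow> 0)"

definition charge_vec :: "nat \<Rightarrow> idx \<Rightarrow> complex" where
  "charge_vec r i = (case i of Vac \<Rightarrow> 1 | VacJ \<Rightarrow> -1 | Gam a \<Rightarrow> 0 | _ \<Rightarrow> if i = lam r then 2 else 0)"

text \<open>The product of \<open>lam_vec\<close> with itself, with the contribution of the charge
  direction exchanged: half the product of \<open>charge_vec\<close> is subtracted, and the identity
  on the spinors and on the antisymmetric part of 0, J0 is added. This moves the coupling of
  \<open>lam r\<close> from 0 to J0, and each term commutes with S.\<close>

definition B_i_idx :: "nat \<Rightarrow> nat \<Rightarrow> idx \<Rightarrow> idx \<Rightarrow> complex" where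
  "B_i_idx r s i j = lam_vec r s i * lam_vec r s j - charge_vec r i * charge_vec r j / 2 + kernel_mat (\<lambda>_ _. 0) 1 i j"

lemma vec_simps [simp]:
  "lam_vec r s Vac = 1" "lam_vec r s VacJ = 0" "lam_vec r s (Gam a) = (if s dvd a then 1 else 0)" "lam_vec r s (lam r) = 1" "lam_vec r s (mu r) = 0"
  "square_vec s Vac = 1" "square_vec s VacJ = 1" "square_vec s (Gam a) = (if s dvd a then 2 else 0)" "square_vec s (lam r) = 0" "square_vec s (mu r) = 0"
  "charge_vec r Vac = 1" "charge_vec r VacJ = -1" "charge_vec r (Gam a) = 0" "charge_vec r (lam r) = 2" "charge_vec r (mu r) = 0"
  by (simp_all add: lam_vec_def square_vec_def charge_vec_def lam_def mu_def)

lemma kernel_mat_simps [simp]: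
  "kernel_mat K y (lam r) j = (if j = lam r then y else 0)" "kernel_mat K y i (lam r) = (if i = lam r then y else 0)"
  "kernel_mat K y (mu r) j = (if j = mu r then y else 0)" "kernel_mat K y i (mu r) = (if i = mu r then y else 0)"
  "kernel_mat K y Vac Vac = K 0 0 / 4 + y / 2" "kernel_mat K y Vac VacJ = K 0 0 / 4 - y / 2"
  "kernel_mat K y VacJ Vac = K 0 0 / 4 - y / 2" "kernel_mat K y VacJ VacJ = K 0 0 / 4 + y / 2"
  "kernel_mat K y Vac (Gam a) = K 0 (int a) / 2" "kernel_mat K y VacJ (Gam a) = K 0 (int a) / 2"
  "kernel_mat K y (Gam a) Vac = K (int a) 0 / 2" "kernel_mat K y (Gam a) VacJ = K (int a) 0 / 2"
  "kernel_mat K y (Gam a) (Gam b) = K (int a) (int b)"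
  by (auto simp: kernel_mat_def)

definition same_idx :: "nat \<Rightarrow> (idx \<Rightarrow> idx \<Rightarrow> complex) \<Rightarrow> (idx \<Rightarrow> idx \<Rightarrow> complex) \<Rightarrow> bool" where
  "same_idx r A B \<longleftrightarrow> (\<forall>i\<in>idxs r. \<forall>j\<in>idxs r. A i j = B i j)"

lemma same_idxI:
  assumes "A Vac Vac = B Vac Vac" "A Vac VacJ = B Vac VacJ" "A VacJ Vac = B VacJ Vac" "A VacJ VacJ = B VacJ VacJ"
    and "A Vac (lam r) = B Vac (lam r)" "A VacJ (lam r) = B VacJ (lam r)" "A (lam r) Vac = B (lam r) Vac" "A (lam r) VacJ = B (lam r) VacJ"
    and "A (lam r) (lam r) = B (lam r) (lam r)" "A (mu r) (mu r) = B (mu r) (mu r)"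
    and "\<And>i. i \<in> idxs r \<Longrightarrow> i \<noteq> mu r \<Longrightarrow> A i (mu r) = B i (mu r) \<and> A (mu r) i = B (mu r) i"
    and "\<And>a. a \<in> {1..r} \<Longrightarrow> A Vac (Gam a) = B Vac (Gam a) \<and> A VacJ (Gam a) = B VacJ (Gam a) \<and> A (lam r) (Gam a) = B (lam r) (Gam a)"
    and "\<And>a. a \<in> {1..r} \<Longrightarrow> A (Gam a) Vac = B (Gam a) Vac \<and> A (Gam a) VacJ = B (Gam a) VacJ \<and> A (Gam a) (lam r) = B (Gam a) (lam r)"
    and "\<And>a b. a \<in> {1..r} \<Longrightarrow> b \<in> {1..r} \<Longrightarrow> A (Gam a) (Gam b) = B (Gam a) (Gam b)"
  shows "same_idx r A B"
  unfolding same_idx_def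
proof (intro ballI)
  fix i j assume i: "i \<in> idxs r" and j: "j \<in> idxs r"
  show "A i j = B i j"
  proof (cases "i = mu r \<or> j = mu r")
    case True
    then show ?thesis using assms(10,11) i j by metis
  next
    case False
    show ?thesis
      by (rule idx_cases[OF i]; rule idx_cases[OF j]) (use False assms in \<open>simp_all\<close>)
  qed
qed

lemma lag_square:
  assumes n: "odd n" and s: "s\<^sup>2 = n"
  shows "lag n s x y = (if int s dvd x \<and> int s dvd y then 1 else 0)"
proof -
  have n0: "n > 0" using n by (rule odd_pos)
  have ns: "n div s = s" using s n0 by (auto simp: power2_eq_square)
  have os: "odd s" using n s by auto
  have "int s dvd x - y \<and> int s dvd x + y \<longleftrightarrow> int s dvd x \<and> int s dvd y"
  proof
    assume h: "int s dvd x - y \<and> int s dvd x + y"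
    have "2 * x = (x - y) + (x + y)" "2 * y = (x + y) - (x - y)" by simp_all
    then have "int s dvd 2 * x" "int s dvd 2 * y" using h by (simp_all only: dvd_add dvd_diff)
    then show "int s dvd x \<and> int s dvd y" by (simp only: odd_dvd_2_mult[OF os])
  qed simp
  then show ?thesis by (simp add: lag_def ns)
qed

text \<open>Makes \<open>Gam s\<close> a label, so that the kernel can be evaluated at it.\<close>

lemma square_root_le:
  fixes r s :: nat
  assumes "r \<ge> 3" "s\<^sup>2 = 2 * r + 1"
  shows "s \<in> {1..r}"
proof -
  have "\<not> s > r"
  proof
    assume "s > r"
    then have "r + 1 \<le> s" by simp
    then have "(r + 1)\<^sup>2 \<le> s\<^sup>2" by (rule power_mono) simp
    then show False using assms by (simp add: power2_eq_square)
  qed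
  moreover have "s \<noteq> 0" using assms by (intro notI) simp
  ultimately show ?thesis by simp
qed

text \<open>Here \<open>a\<close>, \<open>b\<close>, \<open>c\<close> stand for the entries (0, J0),
  (J0, 0), (J0, J0); \<open>x0\<close>, \<open>x1\<close> for the column of \<open>lam r\<close> at
  0 and J0, \<open>y0\<close>, \<open>y1\<close> for its row; \<open>z\<close> and \<open>w\<close>
  for the diagonal entries at \<open>mu r\<close> and \<open>lam r\<close>. The first two solutions
  lead to the two families, the other four to the exceptional matrices.\<close>

lemma nat_solution_cases:
  fixes z w x0 x1 y0 y1 a b c :: nat
  assumes "1 = a + x0 + z" "b + z = c + x1" "1 = b + y0 + z" "a + z = c + y1" "x0 + z = w + x1" "y0 + z = w + y1"
  shows "z = 1 \<and> w = 1 \<and> x0 = 0 \<and> x1 = 0 \<and> y0 = 0 \<and> y1 = 0 \<and> a = 0 \<and> b = 0 \<and> c = 1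
    \<or> z = 0 \<and> w = 0 \<and> x0 = 0 \<and> x1 = 0 \<and> y0 = 0 \<and> y1 = 0 \<and> a = 1 \<and> b = 1 \<and> c = 1
    \<or> z = 1 \<and> w = 0 \<and> x0 = 0 \<and> x1 = 1 \<and> y0 = 0 \<and> y1 = 1 \<and> a = 0 \<and> b = 0 \<and> c = 0
    \<or> z = 0 \<and> w = 1 \<and> x0 = 1 \<and> x1 = 0 \<and> y0 = 1 \<and> y1 = 0 \<and> a = 0 \<and> b = 0 \<and> c = 0
    \<or> z = 0 \<and> w = 0 \<and> x0 = 1 \<and> x1 = 1 \<and> y0 = 0 \<and> y1 = 0 \<and> a = 0 \<and> b = 1 \<and> c = 0
    \<or> z = 0 \<and> w = 0 \<and> x0 = 0 \<and> x1 = 0 \<and> y0 = 1 \<and> y1 = 1 \<and> a = 1 \<and> b = 0 \<and> c = 0"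
proof -
  have "z = 0 \<or> z = 1" "x0 = 0 \<or> x0 = 1" "y0 = 0 \<or> y0 = 1" "w = 0 \<or> w = 1 \<or> w \<ge> 2" using assms by linarith+
  then show ?thesis using assms by (elim disjE) simp_all
qed

lemma lag_sum_zero: "n > 0 \<Longrightarrow> (\<Sum>g | g dvd n. c g) = (0::nat) \<Longrightarrow> (\<Sum>h | h dvd n. of_nat (c h) * lag n h x y) = 0"
  by (intro sum.neutral) simp

text \<open>A single unit of coefficient must sit on a divisor fixed by g -> n/g, which is the
  square root of n.\<close>

lemma lag_sum_one:
  assumes n: "n > 0" and sym: "\<And>g. g dvd n \<Longrightarrow> c (n div g) = c g" and total: "(\<Sum>g | g dvd n. c g) = (1::nat)"
    and s: "s\<^sup>2 = n"
  shows "(\<Sum>h | h dvd n. of_nat (c h) * lag n h x y) = lag n s x y"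
proof -
  have fin: "finite {g. g dvd n}" using n by simp
  obtain g where g: "g dvd n" "c g = 1" "\<forall>h. h dvd n \<longrightarrow> g \<noteq> h \<longrightarrow> c h = 0"
    using total sum_eq_1_iff[OF fin, of c] by auto
  have "g = n div g" using g(3) sym[OF g(1)] g(2) codivisor(5)[OF n g(1)] by (metis zero_neq_one)
  then have "g * g = n" using codivisor(1)[OF n g(1)] by simp
  then have "g = s" using s power2_eq_imp_eq[of g s] by (simp add: power2_eq_square)
  have "(\<Sum>h | h dvd n. of_nat (c h) * lag n h x y) = (\<Sum>h | h dvd n. if h = g then lag n g x y else 0)"
    by (intro sum.cong) (use g in auto)
  then show ?thesis using fin g \<open>g = s\<close> by simp
qed

text \<open>A value of at least 2 on an axis at distance s means that both indicators hold there, so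
  g and n/g divide s; their product being s^2, both equal s.\<close>

lemma lag2_square:
  assumes n: "odd n" and s: "s\<^sup>2 = n" and g: "g dvd n" and max: "lag2 n g x0 y0 = of_nat (2 + k)"
    and xy: "x0 = int s \<and> y0 = 0 \<or> x0 = 0 \<and> y0 = int s"
  shows "lag2 n g x y = (if int s dvd x \<and> int s dvd y then 2 else 0)"
proof -
  have n0: "n > 0" using n by (rule odd_pos)
  have s0: "s > 0" using s n0 by (auto intro: Nat.gr0I)
  have le: "lag n h x y = 0 \<or> lag n h x y = 1" for h x y by (simp add: lag_def)
  have "lag n g x0 y0 = 1 \<and> lag n (n div g) x0 y0 = 1"
    using max le[of g x0 y0] le[of "n div g" x0 y0]
    by (auto simp: lag2_def add_eq_0_iff complex_eq_iff)
  then have "int g dvd x0 - y0" "int (n div g) dvd x0 + y0" by (auto simp: lag_def split: if_splits)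
  then have "g dvd s" "n div g dvd s" using xy by auto
  then have le: "g \<le> s" "n div g \<le> s" using s0 by (auto intro: dvd_imp_le)
  have "g = s"
  proof (rule ccontr)
    assume "g \<noteq> s"
    then have "g < s" using le by simp
    then have "g * (n div g) < s * s"
      by (rule mult_less_le_imp_less) (use le codivisor[OF n0 g] in auto)
    then show False using codivisor(1)[OF n0 g] s by (simp add: power2_eq_square)
  qed
  moreover have "n div s = s" using s s0 by (auto simp: power2_eq_square)
  ultimately show ?thesis by (simp add: lag2_def lag_square[OF n s])
qed

lemma push_Nats: "(\<And>i. i \<in> idxs r \<Longrightarrow> f i \<in> \<nat>) \<Longrightarrow> push r f x \<in> \<nat>"
  using fold_idx_le[of r x] by (auto simp: push_def intro!: Nats_add)

text \<open>The corner entries over 0, J0 and the spinors have six possible values. In each case the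
  corner gives the total coefficient 1, 2 or 4 of the folded kernel, and the remaining entries
  follow from that kernel and from the row and column of \<open>lam r\<close>.\<close>

theorem classification:
  assumes r: "r \<ge> 3" and N: "phys_idx r N"
  shows "(\<exists>g. g dvd 2 * r + 1 \<and> same_idx r N (kernel_mat (lag2 (2 * r + 1) g) 1))
    \<or> (\<exists>g h. g dvd 2 * r + 1 \<and> h dvd 2 * r + 1 \<and> same_idx r N (kernel_mat (\<lambda>x y. lag2 (2 * r + 1) g x y + lag2 (2 * r + 1) h x y) 0))
    \<or> (\<exists>s. s\<^sup>2 = 2 * r + 1 \<and> (same_idx r N (B_i_idx r s) \<or> same_idx r N (\<lambda>i j. lam_vec r s i * lam_vec r s j)
        \<or> same_idx r N (\<lambda>i j. lam_vec r s i * square_vec s j) \<or> same_idx r N (\<lambda>i j. square_vec s i * lam_vec r s j)))"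
proof -
  define n where "n = 2 * r + 1"
  have n: "odd n" "n > 0" by (simp_all add: n_def)
  let ?l = "lam r" and ?m = "mu r"
  note C = mu_column[OF N] and R = mu_column[OF phys_idx_transpose[OF N]]
  have nat: "N i j \<in> \<nat>" if "i \<in> idxs r" "j \<in> idxs r" for i j using N that by (simp add: phys_idx_def)
  define K where "K i j = (SOME k. N i j = of_nat k)" for i j
  have K: "N i j = of_nat (K i j)" if "i \<in> idxs r" "j \<in> idxs r" for i j
    unfolding K_def by (rule someI_ex) (use nat[OF that] in \<open>auto elim: Nats_cases\<close>)
  have eqs: "1 = K Vac VacJ + K Vac ?l + K ?m ?m" "K VacJ Vac + K ?m ?m = K VacJ VacJ + K VacJ ?l"
    "1 = K VacJ Vac + K ?l Vac + K ?m ?m" "K Vac VacJ + K ?m ?m = K VacJ VacJ + K ?l VacJ"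
    "K Vac ?l + K ?m ?m = K ?l ?l + K VacJ ?l" "K ?l Vac + K ?m ?m = K ?l ?l + K ?l VacJ"
  proof -
    have v: "N Vac Vac = 1" using N by (simp add: phys_idx_def)
    have e: "of_nat x = (of_nat y :: complex) \<Longrightarrow> x = y" for x y by simp
    show "1 = K Vac VacJ + K Vac ?l + K ?m ?m"
      by (rule e) (use C(2)[of Vac] v in \<open>simp add: K algebra_simps\<close>)
    show "K VacJ Vac + K ?m ?m = K VacJ VacJ + K VacJ ?l"
      by (rule e) (use C(2)[of VacJ] in \<open>simp add: K algebra_simps\<close>)
    show "1 = K VacJ Vac + K ?l Vac + K ?m ?m"
      by (rule e) (use R(2)[of Vac] v in \<open>simp add: K algebra_simps\<close>)
    show "K Vac VacJ + K ?m ?m = K VacJ VacJ + K ?l VacJ"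
      by (rule e) (use R(2)[of VacJ] in \<open>simp add: K algebra_simps\<close>)
    show "K Vac ?l + K ?m ?m = K ?l ?l + K VacJ ?l"
      by (rule e) (use C(3) in \<open>simp add: K algebra_simps\<close>)
    show "K ?l Vac + K ?m ?m = K ?l ?l + K ?l VacJ"
      by (rule e) (use R(3) in \<open>simp add: K algebra_simps\<close>)
  qed
  define L where "L = fold_kernel r N"
  have L00: "L 0 0 = N Vac Vac + N Vac VacJ + N VacJ Vac + N VacJ VacJ"
    using push_int[of 0 r] by (simp add: L_def fold_kernel_def algebra_simps)
  have La0: "L (int a) 0 = N (Gam a) Vac + N (Gam a) VacJ" "L 0 (int a) = N Vac (Gam a) + N VacJ (Gam a)" if "a \<in> {1..r}" for a
    using push_int[of a r] push_int[of 0 r] that by (simp_all add: L_def fold_kernel_def)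
  have Lab: "L (int a) (int b) = N (Gam a) (Gam b)" if "a \<in> {1..r}" "b \<in> {1..r}" for a b
    using push_int[of a r] push_int[of b r] that by (simp add: L_def fold_kernel_def)
  obtain c where c: "\<And>x y. L x y = (\<Sum>g | g dvd n. c g * lag n g x y)"
  proof (rule commutant[OF n(1)])
    show "kernel n L" unfolding L_def n_def by (rule fold_kernel_kernel)
    show "L (- x) y = L x y" "L x (- y) = L x y" for x y unfolding L_def by (rule fold_kernel_even)+
    show "fourier_comm n L" unfolding L_def n_def by (rule fold_kernel_comm) (use N in \<open>simp add: phys_idx_def\<close>)
    show "L x y \<noteq> 0 \<Longrightarrow> int n dvd x\<^sup>2 - y\<^sup>2" for x y
      unfolding L_def n_def by (rule fold_kernel_supp[of r N]) (use N in \<open>auto simp: phys_idx_def\<close>)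
  qed blast
  obtain d where d: "\<And>x y. L x y = (\<Sum>g | g dvd n. of_nat (d g) * lag n g x y)"
    and dsym: "\<And>g. g dvd n \<Longrightarrow> d (n div g) = d g" and dsum: "L 0 0 = of_nat (\<Sum>g | g dvd n. d g)"
  proof (rule lag_coefficients_nat[OF n(1) c])
    show "L x y \<in> \<nat>" for x y unfolding L_def fold_kernel_def by (intro push_Nats nat)
    show "L x (- y) = L x y" for x y unfolding L_def by (rule fold_kernel_even)
  qed blast
  have total: "(\<Sum>g | g dvd n. d g) = 1 + K Vac VacJ + K VacJ Vac + K VacJ VacJ"
  proof -
    have "N Vac Vac = 1" using N by (simp add: phys_idx_def)
    then have "of_nat (\<Sum>g | g dvd n. d g) = (of_nat (1 + K Vac VacJ + K VacJ Vac + K VacJ VacJ) :: complex)"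
      unfolding dsum[symmetric] L00 by (simp add: K)
    then show ?thesis by (simp only: of_nat_eq_iff)
  qed
  have v: "N Vac Vac = 1" using N by (simp add: phys_idx_def)
  have M: "N i ?m = 0" "N ?m i = 0" if "i \<in> idxs r" "i \<noteq> ?m" for i using C(1) R(1) that by auto
  have G: "N (Gam a) Vac - N (Gam a) VacJ = N (Gam a) ?l" "N Vac (Gam a) - N VacJ (Gam a) = N ?l (Gam a)"
    if "a \<in> {1..r}" for a
    using C(2)[of "Gam a"] R(2)[of "Gam a"] that by simp_all
  have one: "\<exists>g. g dvd n \<and> (\<forall>x y. L x y = lag2 n g x y)" if t: "(\<Sum>g | g dvd n. d g) = 2"
  proof -
    have t': "(\<Sum>g | g dvd n. d g) = 2 * Suc 0" using t by simp
    obtain g c' where g: "g dvd n" "\<forall>g. g dvd n \<longrightarrow> c' (n div g) = c' g" "(\<Sum>g | g dvd n. c' g) = 2 * (0::nat)"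
      "\<forall>x y. (\<Sum>h | h dvd n. of_nat (d h) * lag n h x y) = (\<Sum>h | h dvd n. of_nat (c' h) * lag n h x y) + lag2 n g x y"
      using pair_step_lag[OF n(2) dsym t'] by blast
    then show ?thesis using lag_sum_zero[OF n(2), of c'] by (auto simp: d)
  qed
  have kv: "N Vac VacJ = of_nat (K Vac VacJ)" "N VacJ Vac = of_nat (K VacJ Vac)" "N VacJ VacJ = of_nat (K VacJ VacJ)"
    "N Vac ?l = of_nat (K Vac ?l)" "N VacJ ?l = of_nat (K VacJ ?l)" "N ?l Vac = of_nat (K ?l Vac)" "N ?l VacJ = of_nat (K ?l VacJ)"
    "N ?l ?l = of_nat (K ?l ?l)" "N ?m ?m = of_nat (K ?m ?m)"
    by (simp_all add: K)
  have col0: "N (Gam a) ?l = 0" if "N Vac ?l + N VacJ ?l = 0" "a \<in> {1..r}" for a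
    using C(4) unfolding that(1) using that(2) by (elim disjE exE conjE) simp_all
  have row0: "N ?l (Gam a) = 0" if "N ?l Vac + N ?l VacJ = 0" "a \<in> {1..r}" for a
    using R(4) unfolding that(1) using that(2) by (elim disjE exE conjE) simp_all
  have col1: "\<exists>s. s\<^sup>2 = n \<and> (\<forall>a\<in>{1..r}. N (Gam a) ?l = (if s dvd a then c else 0))" if "N Vac ?l + N VacJ ?l = c" "c \<noteq> 0" for c
    using C(4) that(2) unfolding that(1) n_def by blast
  have row1: "\<exists>s. s\<^sup>2 = n \<and> (\<forall>a\<in>{1..r}. N ?l (Gam a) = (if s dvd a then c else 0))" if "N ?l Vac + N ?l VacJ = c" "c \<noteq> 0" for c
    using R(4) that(2) unfolding that(1) n_def by blast
  have sq_unique: "s' = s" if "s\<^sup>2 = n" "s'\<^sup>2 = n" for s s' :: nat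
    using that power2_eq_imp_eq[of s' s] by simp
  \<comment> \<open>The kernel gives the sum of the entries at 0 and J0, the row or column of
    \<open>lam r\<close> their difference; together they determine both.\<close>
  have GL: "2 * N (Gam a) Vac = L (int a) 0 + N (Gam a) ?l" "2 * N (Gam a) VacJ = L (int a) 0 - N (Gam a) ?l"
    "2 * N Vac (Gam a) = L 0 (int a) + N ?l (Gam a)" "2 * N VacJ (Gam a) = L 0 (int a) - N ?l (Gam a)" if "a \<in> {1..r}" for a
    using G[OF that, symmetric] La0[OF that] by simp_all
  have half: "x = y / 2" if "2 * x = y" for x y :: complex unfolding that[symmetric] by simp
  note GLh = GL[THEN half]
  show ?thesis
    using nat_solution_cases[OF eqs]
  proof (elim disjE conjE, goal_cases U1 U0 B1 B2 B4 B3)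
    case U1
    have x: "N (Gam a) ?l = 0" "N ?l (Gam a) = 0" if "a \<in> {1..r}" for a
      by (rule col0[OF _ that] row0[OF _ that]; simp add: kv U1)+
    obtain g where g: "g dvd n" "\<forall>x y. L x y = lag2 n g x y" using one total U1 by auto
    have "same_idx r N (kernel_mat L 1)"
      by (rule same_idxI) (simp_all add: U1 kv v M x GLh L00 Lab)
    then have "same_idx r N (kernel_mat (lag2 n g) 1)" using g(2) by (simp add: same_idx_def kernel_mat_def)
    then show ?thesis using g(1) unfolding n_def by blast
  next
    case U0
    have x: "N (Gam a) ?l = 0" "N ?l (Gam a) = 0" if "a \<in> {1..r}" for a
      by (rule col0[OF _ that] row0[OF _ that]; simp add: kv U0)+
    have t: "(\<Sum>g | g dvd n. d g) = 2 * Suc (Suc 0)" using total U0 by simp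
    obtain g c' where g: "g dvd n" "\<forall>g. g dvd n \<longrightarrow> c' (n div g) = c' g" "(\<Sum>g | g dvd n. c' g) = 2 * Suc 0"
      "\<forall>x y. (\<Sum>h | h dvd n. of_nat (d h) * lag n h x y) = (\<Sum>h | h dvd n. of_nat (c' h) * lag n h x y) + lag2 n g x y"
      using pair_step_lag[OF n(2) dsym t] by blast
    obtain h c'' where h: "h dvd n" "\<forall>g. g dvd n \<longrightarrow> c'' (n div g) = c'' g" "(\<Sum>g | g dvd n. c'' g) = 2 * (0::nat)"
      "\<forall>x y. (\<Sum>h | h dvd n. of_nat (c' h) * lag n h x y) = (\<Sum>h | h dvd n. of_nat (c'' h) * lag n h x y) + lag2 n h x y"
      using pair_step_lag[OF n(2) g(2)[rule_format] g(3)] by blast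
    have Lgh: "L x y = lag2 n g x y + lag2 n h x y" for x y
      using g(4)[rule_format, of x y] h(4)[rule_format, of x y] lag_sum_zero[OF n(2), of c'' x y] h(3) by (simp add: d)
    have "same_idx r N (kernel_mat L 0)"
      by (rule same_idxI) (simp_all add: U0 kv v M x GLh L00 Lab)
    then have "same_idx r N (kernel_mat (\<lambda>x y. lag2 n g x y + lag2 n h x y) 0)" using Lgh by (simp add: same_idx_def kernel_mat_def)
    then show ?thesis using g(1) h(1) unfolding n_def by blast
  next
    case B1
    obtain s where s: "s\<^sup>2 = n" and xs: "\<forall>a\<in>{1..r}. N (Gam a) ?l = (if s dvd a then 1 else 0)"
      using col1[of 1] by (auto simp: kv B1)
    obtain s' where s': "s'\<^sup>2 = n" and ys: "\<forall>a\<in>{1..r}. N ?l (Gam a) = (if s' dvd a then 1 else 0)"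
      using row1[of 1] by (auto simp: kv B1)
    have ss: "s' = s" by (rule sq_unique[OF s s'])
    have t: "(\<Sum>g | g dvd n. d g) = 1" using total by (simp add: B1)
    have Ls: "L x y = (if int s dvd x \<and> int s dvd y then 1 else 0)" for x y
      unfolding d lag_square[OF n(1) s, symmetric] by (rule lag_sum_one[OF n(2) dsym t s])
    have A: "N (Gam a) Vac = (if s dvd a then 1 else 0)" "N (Gam a) VacJ = 0"
      "N Vac (Gam a) = (if s dvd a then 1 else 0)" "N VacJ (Gam a) = 0" if a: "a \<in> {1..r}" for a
      using xs ys a by (simp_all add: GLh[OF a] Ls ss)
    have "same_idx r N (B_i_idx r s)"
      by (rule same_idxI) (simp_all add: B1 kv v M A xs ys ss B_i_idx_def Lab[symmetric] Ls)
    then show ?thesis using s unfolding n_def by blast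
  next
    case B2
    obtain s where s: "s\<^sup>2 = n" and xs: "\<forall>a\<in>{1..r}. N (Gam a) ?l = (if s dvd a then 1 else 0)"
      using col1[of 1] by (auto simp: kv B2)
    obtain s' where s': "s'\<^sup>2 = n" and ys: "\<forall>a\<in>{1..r}. N ?l (Gam a) = (if s' dvd a then 1 else 0)"
      using row1[of 1] by (auto simp: kv B2)
    have ss: "s' = s" by (rule sq_unique[OF s s'])
    have t: "(\<Sum>g | g dvd n. d g) = 1" using total by (simp add: B2)
    have Ls: "L x y = (if int s dvd x \<and> int s dvd y then 1 else 0)" for x y
      unfolding d lag_square[OF n(1) s, symmetric] by (rule lag_sum_one[OF n(2) dsym t s])
    have A: "N (Gam a) Vac = (if s dvd a then 1 else 0)" "N (Gam a) VacJ = 0"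
      "N Vac (Gam a) = (if s dvd a then 1 else 0)" "N VacJ (Gam a) = 0" if a: "a \<in> {1..r}" for a
      using xs ys a by (simp_all add: GLh[OF a] Ls ss)
    have "same_idx r N (\<lambda>i j. lam_vec r s i * lam_vec r s j)"
      by (rule same_idxI) (simp_all add: B2 kv v M A xs ys ss Lab[symmetric] Ls)
    then show ?thesis using s unfolding n_def by blast
  next
    case B4
    obtain s where s: "s\<^sup>2 = n" and xs: "\<forall>a\<in>{1..r}. N (Gam a) ?l = (if s dvd a then 2 else 0)"
      using col1[of 2] by (auto simp: kv B4)
    have ys: "N ?l (Gam a) = 0" if "a \<in> {1..r}" for a by (rule row0[OF _ that]) (simp add: kv B4)
    obtain g where g: "g dvd n" "\<forall>x y. L x y = lag2 n g x y" using one total B4 by auto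
    have sr: "s \<in> {1..r}" using square_root_le[OF r] s by (simp add: n_def)
    \<comment> \<open>The entry of \<open>lam r\<close> at \<open>Gam s\<close> is 2 while the
      entries of \<open>N\<close> are natural numbers, so the kernel is at least 2 at (s, 0). This
      pins the divisor pair to s.\<close>
    have "N (Gam s) Vac = 2 + N (Gam s) VacJ"
      using G(1)[OF sr] xs sr by (simp add: diff_eq_eq)
    then have "L (int s) (0) = 2 + 2 * N (Gam s) VacJ" using La0(1)[OF sr] by simp
    moreover have "N (Gam s) VacJ = of_nat (K (Gam s) VacJ)" using sr by (intro K) simp_all
    ultimately have mx: "lag2 n g (int s) (0) = of_nat (2 + 2 * K (Gam s) VacJ)" using g(2) by simp
    have Ls: "L x y = (if int s dvd x \<and> int s dvd y then 2 else 0)" for x y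
      using lag2_square[OF n(1) s g(1) mx, of x y] g(2) by simp
    have A: "N (Gam a) Vac = (if s dvd a then 2 else 0)" "N (Gam a) VacJ = (if s dvd a then 0 else 0)"
      "N Vac (Gam a) = (if s dvd a then 1 else 0)" "N VacJ (Gam a) = (if s dvd a then 1 else 0)" if a: "a \<in> {1..r}" for a
      using xs ys a by (simp_all add: GLh[OF a] Ls)
    have "same_idx r N (\<lambda>i j. square_vec s i * lam_vec r s j)"
      by (rule same_idxI) (simp_all add: B4 kv v M A xs ys Lab[symmetric] Ls)
    then show ?thesis using s unfolding n_def by blast
  next
    case B3
    obtain s where s: "s\<^sup>2 = n" and ys: "\<forall>a\<in>{1..r}. N ?l (Gam a) = (if s dvd a then 2 else 0)"
      using row1[of 2] by (auto simp: kv B3)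
    have xs: "N (Gam a) ?l = 0" if "a \<in> {1..r}" for a by (rule col0[OF _ that]) (simp add: kv B3)
    obtain g where g: "g dvd n" "\<forall>x y. L x y = lag2 n g x y" using one total B3 by auto
    have sr: "s \<in> {1..r}" using square_root_le[OF r] s by (simp add: n_def)
    have "N Vac (Gam s) = 2 + N VacJ (Gam s)"
      using G(2)[OF sr] ys sr by (simp add: diff_eq_eq)
    then have "L (0) (int s) = 2 + 2 * N VacJ (Gam s)" using La0(2)[OF sr] by simp
    moreover have "N VacJ (Gam s) = of_nat (K VacJ (Gam s))" using sr by (intro K) simp_all
    ultimately have mx: "lag2 n g (0) (int s) = of_nat (2 + 2 * K VacJ (Gam s))" using g(2) by simp
    have Ls: "L x y = (if int s dvd x \<and> int s dvd y then 2 else 0)" for x y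
      using lag2_square[OF n(1) s g(1) mx, of x y] g(2) by simp
    have A: "N (Gam a) Vac = (if s dvd a then 1 else 0)" "N (Gam a) VacJ = (if s dvd a then 1 else 0)"
      "N Vac (Gam a) = (if s dvd a then 2 else 0)" "N VacJ (Gam a) = (if s dvd a then 0 else 0)" if a: "a \<in> {1..r}" for a
      using xs ys a by (simp_all add: GLh[OF a] Ls)
    have "same_idx r N (\<lambda>i j. lam_vec r s i * square_vec s j)"
      by (rule same_idxI) (simp_all add: B3 kv v M A xs ys Lab[symmetric] Ls)
    then show ?thesis using s unfolding n_def by blast
  qed
qed

section \<open>The invariants of the list\<close>

definition commutes_S :: "nat \<Rightarrow> (idx \<Rightarrow> idx \<Rightarrow> complex) \<Rightarrow> bool" where
  "commutes_S r N \<longleftrightarrow> (\<forall>i\<in>idxs r. \<forall>j\<in>idxs r. (\<Sum>k\<in>idxs r. N i k * S_c r k j) = (\<Sum>k\<in>idxs r. S_c r i k * N k j))"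

lemma commutes_S_lincomb:
  assumes "commutes_S r A" "commutes_S r B" "commutes_S r C"
  shows "commutes_S r (\<lambda>i j. a * A i j + b * B i j + c * C i j)"
proof -
  have "(\<Sum>k\<in>idxs r. (a * A i k + b * B i k + c * C i k) * S_c r k j)
    = a * (\<Sum>k\<in>idxs r. A i k * S_c r k j) + b * (\<Sum>k\<in>idxs r. B i k * S_c r k j) + c * (\<Sum>k\<in>idxs r. C i k * S_c r k j)" for i j
    by (simp add: distrib_right sum.distrib sum_distrib_left mult.assoc)
  moreover have "(\<Sum>k\<in>idxs r. S_c r i k * (a * A k j + b * B k j + c * C k j))
    = a * (\<Sum>k\<in>idxs r. S_c r i k * A k j) + b * (\<Sum>k\<in>idxs r. S_c r i k * B k j) + c * (\<Sum>k\<in>idxs r. S_c r i k * C k j)" for i j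
    by (simp add: distrib_left sum.distrib sum_distrib_left mult.left_commute)
  ultimately show ?thesis using assms by (simp add: commutes_S_def)
qed

lemma S_apply_nonspinor:
  assumes i: "i \<in> idxs r" "\<not> spinor i"
  shows "(\<Sum>k\<in>idxs r. f k * S_c r k i)
    = complex_of_real (mult_of i) * (\<Sum>y\<in>{0..<int (2 * r + 1)}. push r f y * om (2 * r + 1) (y * int (index_of i)))
      + complex_of_real (charge i) * sqrt_n r * (f (lam r) + f (mu r))"
proof -
  let ?c = "\<lambda>a. cos (2 * pi * real a * real (index_of i) / real (2 * r + 1))"
  have S: "S_c r Vac i = complex_of_real (mult_of i)" "S_c r VacJ i = complex_of_real (mult_of i)"
    "S_c r (Gam a) i = complex_of_real (mult_of i * (2 * ?c a))" for a
    using i(2) by (simp_all add: S_idx_def)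
  have Sl: "S_c r (lam r) i = complex_of_real (charge i) * sqrt_n r" "S_c r (mu r) i = complex_of_real (charge i) * sqrt_n r"
    using S_c_charge[OF i(2), of r] by (simp_all add: S_idx_commute[of r _ i])
  have "(\<Sum>k\<in>idxs r. f k * S_c r k i)
    = complex_of_real (mult_of i) * (f Vac + f VacJ + (\<Sum>a = 1..r. f (Gam a) * complex_of_real (2 * ?c a)))
      + complex_of_real (charge i) * sqrt_n r * (f (lam r) + f (mu r))"
    unfolding sum_lam_mu S Sl by (simp add: distrib_left sum_distrib_left mult_ac)
  then show ?thesis by (simp only: push_fourier of_int_of_nat_eq)
qed

lemma S_apply_spinor:
  "(\<Sum>k\<in>idxs r. f k * S_c r k (lam r)) = sqrt_n r * (f Vac - f VacJ + f (lam r) - f (mu r))"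
  "(\<Sum>k\<in>idxs r. f k * S_c r k (mu r)) = sqrt_n r * (f Vac - f VacJ - f (lam r) + f (mu r))"
  unfolding sum_lam_mu S_c_spinor by (simp_all add: algebra_simps)

text \<open>Fixed vectors of \<open>S\<close>: the eigenvalue is not \<open>1\<close> as \<open>S_c\<close> lacks the normalisation of \<open>S\<close>.\<close>

definition S_eigenvector :: "nat \<Rightarrow> (idx \<Rightarrow> complex) \<Rightarrow> bool" where
  "S_eigenvector r x \<longleftrightarrow> (\<forall>i\<in>idxs r. (\<Sum>k\<in>idxs r. x k * S_c r k i) = 2 * sqrt_n r * x i)"

text \<open>S is symmetric, so a product of two eigenvectors for the same eigenvalue commutes with
  it.\<close>

lemma commutes_S_rank_one:
  assumes "S_eigenvector r x" "S_eigenvector r y"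
  shows "commutes_S r (\<lambda>i j. x i * y j)"
  unfolding commutes_S_def
proof (intro ballI)
  fix i j assume ij: "i \<in> idxs r" "j \<in> idxs r"
  have "(\<Sum>k\<in>idxs r. x i * y k * S_c r k j) = x i * (\<Sum>k\<in>idxs r. y k * S_c r k j)"
    by (simp add: sum_distrib_left mult.assoc)
  also have "\<dots> = x i * (2 * sqrt_n r * y j)" using assms(2) ij by (simp add: S_eigenvector_def)
  also have "\<dots> = (2 * sqrt_n r * x i) * y j" by simp
  also have "\<dots> = (\<Sum>k\<in>idxs r. x k * S_c r k i) * y j" using assms(1) ij by (simp add: S_eigenvector_def)
  also have "\<dots> = (\<Sum>k\<in>idxs r. S_c r i k * (x k * y j))"
    unfolding sum_distrib_right by (intro sum.cong refl) (simp add: S_idx_commute[of r i] mult_ac)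
  finally show "(\<Sum>k\<in>idxs r. x i * y k * S_c r k j) = (\<Sum>k\<in>idxs r. S_c r i k * (x k * y j))" .
qed

lemma S_eigenvector_charge_vec: "S_eigenvector r (charge_vec r)"
  unfolding S_eigenvector_def
proof
  fix i assume i: "i \<in> idxs r"
  have p: "push r (charge_vec r) y = 0" for y by (simp add: push_def)
  show "(\<Sum>k\<in>idxs r. charge_vec r k * S_c r k i) = 2 * sqrt_n r * charge_vec r i"
  proof (cases "spinor i")
    case True
    then have "i = lam r \<or> i = mu r" using spinor_iff by simp
    then show ?thesis by (auto simp: S_apply_spinor)
  next
    case False
    show ?thesis unfolding S_apply_nonspinor[OF i False] p using i False by (cases i) simp_all
  qed
qed

text \<open>The vector pushes forward to twice the indicator of the multiples of s, a subgroup that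
  is its own annihilator because s^2 = n. Its Fourier transform is read off from row 0 of the
  commutation of \<open>lag n s\<close>, with the count of multiples supplied by
  \<open>htrans_lag\<close> at the origin.\<close>

lemma S_eigenvector_square_vec:
  assumes s: "s\<^sup>2 = 2 * r + 1"
  shows "S_eigenvector r (square_vec s)"
  unfolding S_eigenvector_def
proof
  let ?n = "2 * r + 1" let ?Z = "{0..<int (2 * r + 1)}"
  have n: "odd ?n" by simp
  have sd: "s dvd ?n" using s by (metis dvd_power zero_less_numeral)
  have sq: "sqrt_n r = of_nat s" using s unfolding sqrt_n_def by (metis of_nat_power of_real_of_nat_eq real_sqrt_abs abs_of_nat)
  fix i assume i: "i \<in> idxs r"
  have p: "push r (square_vec s) y = 2 * lag ?n s 0 y" for y
  proof -
    have "int s dvd int (fold_idx r y) \<longleftrightarrow> int s dvd y"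
    proof -
      have "int s dvd int ?n" using sd by (simp only: int_dvd_int_iff)
      then have "int s dvd y - int (fold_idx r y) \<or> int s dvd y + int (fold_idx r y)"
        using fold_idx_cong[of r y] dvd_trans by blast
      then show ?thesis
      proof
        assume "int s dvd y - int (fold_idx r y)"
        then show ?thesis using dvd_add_right_iff[of "int s" "y - int (fold_idx r y)" "int (fold_idx r y)"] by simp
      next
        assume "int s dvd y + int (fold_idx r y)"
        then show ?thesis using dvd_diff_right_iff[of "int s" "y + int (fold_idx r y)" "int (fold_idx r y)"]
          dvd_add_right_iff[of "int s" "y + int (fold_idx r y)" "- int (fold_idx r y)"] by simp
      qed
    qed
    then show ?thesis unfolding push_def lag_square[OF n s] by (auto intro!: Nat.gr0I)
  qed
  have count: "(\<Sum>y\<in>?Z. lag ?n s y 0) = of_nat s"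
  proof -
    have "lag ?n s y 0 = lag ?n s y y" for y unfolding lag_square[OF n s] by simp
    then show ?thesis using htrans_lag[OF n sd, of 0 0] by (simp add: htrans_def)
  qed
  have sum: "(\<Sum>y\<in>?Z. push r (square_vec s) y * om ?n (y * z)) = (if int s dvd z then 2 * of_nat s else 0)" for z
  proof -
    have "(\<Sum>y\<in>?Z. push r (square_vec s) y * om ?n (y * z)) = 2 * (\<Sum>y\<in>?Z. lag ?n s 0 y * om ?n (y * z))"
      unfolding p by (simp add: sum_distrib_left mult.assoc)
    also have "(\<Sum>y\<in>?Z. lag ?n s 0 y * om ?n (y * z)) = (\<Sum>y\<in>?Z. om ?n (0 * y) * lag ?n s y z)"
      using lag_comm[OF n sd] unfolding fourier_comm_def by blast
    also have "\<dots> = (\<Sum>y\<in>?Z. lag ?n s y 0 * (if int s dvd z then 1 else 0))"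
      unfolding lag_square[OF n s] by (intro sum.cong refl) auto
    also have "\<dots> = (if int s dvd z then of_nat s else 0)"
      unfolding sum_distrib_right[symmetric] count by simp
    finally show ?thesis by simp
  qed
  show "(\<Sum>k\<in>idxs r. square_vec s k * S_c r k i) = 2 * sqrt_n r * square_vec s i"
  proof (cases "spinor i")
    case True
    then have "i = lam r \<or> i = mu r" using spinor_iff by simp
    then show ?thesis by (auto simp: S_apply_spinor)
  next
    case False
    show ?thesis unfolding S_apply_nonspinor[OF i False] sum sq using i False by (cases i) simp_all
  qed
qed

lemma lam_vec_eq: "i \<in> idxs r \<Longrightarrow> lam_vec r s i = square_vec s i / 2 + charge_vec r i / 2"
  by (erule idx_cases) simp_all

lemma S_eigenvector_lam_vec:
  assumes "s\<^sup>2 = 2 * r + 1"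
  shows "S_eigenvector r (lam_vec r s)"
  unfolding S_eigenvector_def
proof
  fix i assume i: "i \<in> idxs r"
  have "(\<Sum>k\<in>idxs r. lam_vec r s k * S_c r k i) = (\<Sum>k\<in>idxs r. (square_vec s k / 2 + charge_vec r k / 2) * S_c r k i)"
    by (intro sum.cong refl) (simp add: lam_vec_eq)
  also have "\<dots> = (\<Sum>k\<in>idxs r. square_vec s k * S_c r k i) / 2 + (\<Sum>k\<in>idxs r. charge_vec r k * S_c r k i) / 2"
    by (simp add: distrib_right sum.distrib sum_divide_distrib)
  also have "\<dots> = 2 * sqrt_n r * lam_vec r s i"
    using S_eigenvector_square_vec[OF assms] S_eigenvector_charge_vec[of r] i by (simp add: S_eigenvector_def lam_vec_eq distrib_left)
  finally show "(\<Sum>k\<in>idxs r. lam_vec r s k * S_c r k i) = 2 * sqrt_n r * lam_vec r s i" .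
qed

lemma push_kernel_mat:
  assumes "\<not> spinor i" and even: "\<And>x y. K x (- y) = K x y" and per: "\<And>x. per (2 * r + 1) (K x)"
  shows "push r (kernel_mat K y i) z = complex_of_real (mult_of i / 2) * K (int (index_of i)) z"
proof -
  have "K (int (index_of i)) (int (fold_idx r z)) = K (int (index_of i)) z"
    using fold_idx_cong[of r z]
  proof
    assume "int (2 * r + 1) dvd z - int (fold_idx r z)"
    then show ?thesis using perD[OF per] by metis
  next
    assume "int (2 * r + 1) dvd z + int (fold_idx r z)"
    then have "int (2 * r + 1) dvd z - - int (fold_idx r z)" by simp
    then show ?thesis using perD[OF per] even by metis
  qed
  moreover have "push r (kernel_mat K y i) z = complex_of_real (mult_of i / 2) * K (int (index_of i)) (int (fold_idx r z))"
    using assms(1) by (cases i) (auto simp: push_def)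
  ultimately show ?thesis by simp
qed

lemma kernel_mat_transpose: "kernel_mat K y i j = kernel_mat (\<lambda>x y. K y x) y j i"
  by (simp add: kernel_mat_def mult_ac)

text \<open>Between nonspinors the claim is the commutation of \<open>K\<close> with the Fourier
  transform. Between a spinor and a nonspinor both sides are \<open>y\<close> times the charge times
  the root of n, because the antisymmetric combination of 0 and J0 is scaled by the same
  \<open>y\<close> as the spinors.\<close>

lemma commutes_S_kernel_mat:
  assumes K: "kernel (2 * r + 1) K" and even: "\<And>x y. K (- x) y = K x y" "\<And>x y. K x (- y) = K x y"
    and comm: "fourier_comm (2 * r + 1) K"
  shows "commutes_S r (kernel_mat K y)"
  unfolding commutes_S_def
proof (intro ballI)
  let ?n = "2 * r + 1" let ?Z = "{0..<int (2 * r + 1)}"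
  fix i j assume i: "i \<in> idxs r" and j: "j \<in> idxs r"
  have p1: "push r (kernel_mat K y i) z = complex_of_real (mult_of i / 2) * K (int (index_of i)) z" if "\<not> spinor i" for i z
    using that K by (intro push_kernel_mat even(2)) (simp_all add: kernel_def)
  have p2: "push r (\<lambda>k. kernel_mat K y k j) z = complex_of_real (mult_of j / 2) * K z (int (index_of j))" if "\<not> spinor j" for j z
    unfolding kernel_mat_transpose[of K y _ j] using that K by (subst push_kernel_mat) (simp_all add: kernel_def even)
  have pz: "spinor i \<Longrightarrow> push r (kernel_mat K y i) z = 0" "spinor j \<Longrightarrow> push r (\<lambda>k. kernel_mat K y k j) z = 0" for i j z
    by (cases i; auto simp: push_def kernel_mat_def) (cases j; auto simp: push_def kernel_mat_def)
  have right: "(\<Sum>k\<in>idxs r. S_c r i k * kernel_mat K y k j) = (\<Sum>k\<in>idxs r. kernel_mat K y k j * S_c r k i)"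
    by (simp add: S_idx_commute[of r i] mult.commute)
  show "(\<Sum>k\<in>idxs r. kernel_mat K y i k * S_c r k j) = (\<Sum>k\<in>idxs r. S_c r i k * kernel_mat K y k j)"
  proof (cases "spinor i"; cases "spinor j")
    assume "\<not> spinor i" "\<not> spinor j"
    then have "(\<Sum>k\<in>idxs r. kernel_mat K y i k * S_c r k j)
      = complex_of_real (mult_of i * mult_of j / 2) * (\<Sum>z\<in>?Z. K (int (index_of i)) z * om ?n (z * int (index_of j)))"
      unfolding S_apply_nonspinor[OF j \<open>\<not> spinor j\<close>] p1[OF \<open>\<not> spinor i\<close>] sum_distrib_left
      using \<open>\<not> spinor i\<close> by (auto simp: spinor_iff mult_ac)
    also have "(\<Sum>z\<in>?Z. K (int (index_of i)) z * om ?n (z * int (index_of j))) = (\<Sum>z\<in>?Z. om ?n (int (index_of i) * z) * K z (int (index_of j)))"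
      using comm unfolding fourier_comm_def by blast
    also have "complex_of_real (mult_of i * mult_of j / 2) * \<dots> = (\<Sum>k\<in>idxs r. kernel_mat K y k j * S_c r k i)"
      unfolding S_apply_nonspinor[OF i \<open>\<not> spinor i\<close>] p2[OF \<open>\<not> spinor j\<close>] sum_distrib_left
      using \<open>\<not> spinor j\<close> by (auto simp: spinor_iff mult_ac)
    finally show ?thesis unfolding right .
  next
    assume a: "\<not> spinor i" "spinor j"
    then have "j = lam r \<or> j = mu r" using spinor_iff by simp
    then show ?thesis unfolding right S_apply_nonspinor[OF i a(1)] pz(2)[OF a(2)] using a(1)
      by (elim disjE; hypsubst; unfold S_apply_spinor; cases i; simp add: algebra_simps)
  next
    assume a: "spinor i" "\<not> spinor j"
    then have "i = lam r \<or> i = mu r" using spinor_iff by simp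
    then show ?thesis unfolding right S_apply_nonspinor[OF j a(2)] pz(1)[OF a(1)] using a(2)
      by (elim disjE; hypsubst; unfold S_apply_spinor; cases j; simp add: algebra_simps)
  next
    assume "spinor i" "spinor j"
    then have "i = lam r \<or> i = mu r" "j = lam r \<or> j = mu r" using spinor_iff by simp_all
    then show ?thesis unfolding right by (auto simp: S_apply_spinor)
  qed
qed

section \<open>Compatibility with T and integrality of the listed matrices\<close>

lemma T_idx_of_square:
  assumes i: "i \<in> idxs r" "\<not> spinor i" and j: "j \<in> idxs r" "\<not> spinor j"
    and sq: "int (2 * r + 1) dvd (int (index_of i))\<^sup>2 - (int (index_of j))\<^sup>2"
  shows "T_idx r i = T_idx r j"
proof -
  let ?n = "2 * r + 1" let ?a = "int (index_of i)" let ?b = "int (index_of j)"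
  obtain e where e: "T_idx r i = cis (2 * pi * real_of_int e / real ?n)" "2 * e = ?a * (int ?n - ?a)"
    using T_idx_nonspinor[OF i] .
  obtain f where f: "T_idx r j = cis (2 * pi * real_of_int f / real ?n)" "2 * f = ?b * (int ?n - ?b)"
    using T_idx_nonspinor[OF j] .
  have "2 * (e - f) = int ?n * (?a - ?b) - (?a\<^sup>2 - ?b\<^sup>2)"
    using e(2) f(2) by (simp add: algebra_simps power2_eq_square)
  then have "int ?n dvd 2 * (e - f)" using sq by (metis dvd_diff dvd_triv_left)
  then have "int ?n dvd e - f" by (subst (asm) odd_dvd_2_mult) auto
  then have "om ?n e = om ?n f" by (intro om_cong) simp_all
  then show ?thesis unfolding e(1) f(1) om_def .
qed

text \<open>With s = 2t + 1 one finds r = 2t(t + 1), a multiple of 4. If 8 does not divide r, the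
  eigenvalue at \<open>Spin\<close> is -1 and the choice of \<open>SpinJ\<close> as
  \<open>lam r\<close> restores 1.\<close>

lemma T_lam_one:
  assumes s: "s\<^sup>2 = 2 * r + 1"
  shows "T_idx r (lam r) = 1"
proof (cases "8 dvd r")
  case True
  then show ?thesis using cis_eq_1_iff_8_dvd[of r] by (simp add: lam_def)
next
  case False
  have "odd (s\<^sup>2)" unfolding s by simp
  then have "odd s" by simp
  then obtain t where t: "s = 2 * t + 1" by (elim oddE)
  have "2 * r = 4 * (t * (t + 1))" using s unfolding t by (simp add: power2_eq_square algebra_simps)
  moreover obtain u where "t * (t + 1) = 2 * u" by (metis evenE even_mult_iff odd_even_add odd_one)
  ultimately have u: "r = 4 * u" by simp
  then have "odd u" using False by auto
  then obtain v where v: "u = 2 * v + 1" by (elim oddE)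
  have "pi * real r / 4 = 2 * pi * real_of_int (int v) / real 1 + pi" by (simp add: u v algebra_simps)
  then have "cis (pi * real r / 4) = cis (2 * pi * real_of_int (int v) / real 1) * cis pi" by (simp only: cis_mult)
  also have "cis (2 * pi * real_of_int (int v) / real 1) = 1" by (subst cis_eq_1_iff_int) simp_all
  finally show ?thesis using False by (simp add: lam_def)
qed

lemma T_vec_support:
  assumes s: "s\<^sup>2 = 2 * r + 1" and i: "i \<in> idxs r" and nz: "lam_vec r s i \<noteq> 0 \<or> square_vec s i \<noteq> 0 \<or> charge_vec r i \<noteq> 0"
  shows "T_idx r i = 1"
  using i
proof (cases rule: idx_cases)
  case 3
  then show ?thesis using T_lam_one[OF s] by simp
next
  case (5 a)
  then have "s dvd a" using nz by (auto split: if_splits)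
  then have "s\<^sup>2 dvd a\<^sup>2" by (rule dvd_power_same)
  then have "int (2 * r + 1) dvd int (a\<^sup>2)" unfolding s by (simp only: int_dvd_int_iff)
  then have "T_idx r i = T_idx r Vac" using i 5 by (intro T_idx_of_square) simp_all
  then show ?thesis by simp
qed (use nz in auto)

lemma kernel_mat_T:
  assumes supp: "\<And>x y. K x y \<noteq> 0 \<Longrightarrow> int (2 * r + 1) dvd x\<^sup>2 - y\<^sup>2"
    and ij: "i \<in> idxs r" "j \<in> idxs r" and nz: "kernel_mat K y i j \<noteq> 0"
  shows "T_idx r i = T_idx r j"
proof (cases "spinor i \<or> spinor j")
  case True
  then show ?thesis using nz by (auto simp: kernel_mat_def split: if_splits)
next
  case False
  show ?thesis
  proof (cases "K (int (index_of i)) (int (index_of j)) = 0")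
    case True
    then have "charge i \<noteq> 0" "charge j \<noteq> 0" using nz False by (auto simp: kernel_mat_def)
    then show ?thesis using False by (cases i; cases j) simp_all
  next
    case nz: False
    show ?thesis using supp[OF nz] False ij by (intro T_idx_of_square) auto
  qed
qed

text \<open>On the axes the two indicators coincide, so the values there are even; this is what
  makes the halved entries of \<open>kernel_mat\<close> in the rows and columns of 0 and J0
  integral.\<close>

lemma lag2_properties:
  assumes g: "g dvd 2 * r + 1"
  shows "kernel (2 * r + 1) (lag2 (2 * r + 1) g)" "lag2 (2 * r + 1) g (- x) y = lag2 (2 * r + 1) g x y"
    "lag2 (2 * r + 1) g x (- y) = lag2 (2 * r + 1) g x y" "fourier_comm (2 * r + 1) (lag2 (2 * r + 1) g)"
    "lag2 (2 * r + 1) g x y \<noteq> 0 \<Longrightarrow> int (2 * r + 1) dvd x\<^sup>2 - y\<^sup>2"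
    "lag2 (2 * r + 1) g x y \<in> \<nat>" "lag2 (2 * r + 1) g 0 0 = 2" "lag2 (2 * r + 1) g 0 y / 2 \<in> \<nat>" "lag2 (2 * r + 1) g x 0 / 2 \<in> \<nat>"
proof -
  let ?n = "2 * r + 1"
  have n: "odd ?n" "?n > 0" by simp_all
  note c = codivisor[OF n(2) g]
  show "kernel ?n (lag2 ?n g)"
    using lag_kernel[OF g] lag_kernel[OF c(5)] unfolding kernel_def per_def lag2_def by metis
  show "lag2 ?n g (- x) y = lag2 ?n g x y" "lag2 ?n g x (- y) = lag2 ?n g x y"
    unfolding lag2_def lag_neg[OF n(2) g] lag_neg[OF n(2) c(5)] c(4) by (simp_all only: add.commute)
  show "fourier_comm ?n (lag2 ?n g)"
    using lag_comm[OF n(1) g] lag_comm[OF n(1) c(5)]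
    unfolding fourier_comm_def lag2_def distrib_left distrib_right sum.distrib by simp
  show "lag2 ?n g x y \<noteq> 0 \<Longrightarrow> int ?n dvd x\<^sup>2 - y\<^sup>2"
    using lag_supp[OF g, of x y] lag_supp[OF c(5), of x y] unfolding lag2_def by force
  have nat: "lag ?n h x y \<in> \<nat>" for h x y by (simp add: lag_def)
  then show "lag2 ?n g x y \<in> \<nat>" unfolding lag2_def by (intro Nats_add)
  show "lag2 ?n g 0 0 = 2" by (simp add: lag2_def lag_def)
  have "lag ?n (?n div g) 0 y = lag ?n g 0 y" "lag ?n (?n div g) x 0 = lag ?n g x 0"
    unfolding lag_def c(4) by auto
  then show "lag2 ?n g 0 y / 2 \<in> \<nat>" "lag2 ?n g x 0 / 2 \<in> \<nat>" using nat by (simp_all add: lag2_def)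
qed

lemma phys_idx_a:
  assumes g: "g dvd 2 * r + 1"
  shows "phys_idx r (kernel_mat (lag2 (2 * r + 1) g) 1)"
proof -
  define L where "L = lag2 (2 * r + 1) g"
  note P = lag2_properties[OF g, folded L_def]
  have "commutes_S r (kernel_mat L 1)" by (rule commutes_S_kernel_mat) (rule P)+
  moreover have "T_idx r i = T_idx r j" if "i \<in> idxs r" "j \<in> idxs r" "kernel_mat L 1 i j \<noteq> 0" for i j
    by (rule kernel_mat_T[OF P(5) that])
  moreover have "kernel_mat L 1 i j \<in> \<nat>" if "i \<in> idxs r" "j \<in> idxs r" for i j
    by (rule idx_cases[OF that(1)]; rule idx_cases[OF that(2)]) (simp_all add: P(6-9))
  ultimately show ?thesis unfolding phys_idx_def commutes_S_def L_def[symmetric] by (simp add: P(7))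
qed

lemma phys_idx_b:
  assumes g: "g dvd 2 * r + 1" and h: "h dvd 2 * r + 1"
  shows "phys_idx r (kernel_mat (\<lambda>x y. lag2 (2 * r + 1) g x y + lag2 (2 * r + 1) h x y) 0)"
proof -
  define L where "L = lag2 (2 * r + 1) g"
  define H where "H = lag2 (2 * r + 1) h"
  let ?n = "2 * r + 1"
  let ?K = "\<lambda>x y. L x y + H x y"
  note P = lag2_properties[OF g, folded L_def] and Q = lag2_properties[OF h, folded H_def]
  have "commutes_S r (kernel_mat ?K 0)"
  proof (rule commutes_S_kernel_mat)
    show "kernel ?n ?K" using P(1) Q(1) unfolding kernel_def per_def by metis
    show "fourier_comm ?n ?K" using P(4) Q(4) unfolding fourier_comm_def distrib_left distrib_right sum.distrib by simp
  qed (simp_all only: P(2,3) Q(2,3))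
  moreover have "T_idx r i = T_idx r j" if "i \<in> idxs r" "j \<in> idxs r" "kernel_mat ?K 0 i j \<noteq> 0" for i j
  proof (rule kernel_mat_T[OF _ that])
    fix x y assume "?K x y \<noteq> 0"
    then have "L x y \<noteq> 0 \<or> H x y \<noteq> 0" by auto
    then show "int ?n dvd x\<^sup>2 - y\<^sup>2" using P(5) Q(5) by blast
  qed
  moreover have "kernel_mat ?K 0 i j \<in> \<nat>" if "i \<in> idxs r" "j \<in> idxs r" for i j
    by (rule idx_cases[OF that(1)]; rule idx_cases[OF that(2)])
       (simp_all add: P(6-9) Q(6-9) add_divide_distrib Nats_add)
  ultimately show ?thesis unfolding phys_idx_def commutes_S_def L_def[symmetric] H_def[symmetric] by (simp add: P(7) Q(7))
qed

lemma phys_idx_c: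
  assumes s: "s\<^sup>2 = 2 * r + 1"
  shows "phys_idx r (\<lambda>i j. lam_vec r s i * lam_vec r s j)" "phys_idx r (\<lambda>i j. lam_vec r s i * square_vec s j)"
    "phys_idx r (\<lambda>i j. square_vec s i * lam_vec r s j)" "phys_idx r (B_i_idx r s)"
proof -
  have X: "lam_vec r s i \<in> \<nat>" "square_vec s i \<in> \<nat>" if "i \<in> idxs r" for i
    using that by (cases rule: idx_cases; simp)+
  have rank1: "phys_idx r (\<lambda>i j. x i * y j)"
    if "x = lam_vec r s \<or> x = square_vec s" "y = lam_vec r s \<or> y = square_vec s" for x y
  proof -
    have "commutes_S r (\<lambda>i j. x i * y j)" using that S_eigenvector_lam_vec[OF s] S_eigenvector_square_vec[OF s] by (intro commutes_S_rank_one) auto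
    moreover have "T_idx r i = T_idx r j" if "i \<in> idxs r" "j \<in> idxs r" "x i * y j \<noteq> 0" for i j
      using T_vec_support[OF s that(1)] T_vec_support[OF s that(2)] that(3) \<open>x = lam_vec r s \<or> x = square_vec s\<close> \<open>y = lam_vec r s \<or> y = square_vec s\<close> by auto
    moreover have "x i * y j \<in> \<nat>" if "i \<in> idxs r" "j \<in> idxs r" for i j
      using X[OF that(1)] X[OF that(2)] \<open>x = lam_vec r s \<or> x = square_vec s\<close> \<open>y = lam_vec r s \<or> y = square_vec s\<close> by (auto intro: Nats_mult)
    moreover have "x Vac * y Vac = 1" using that by auto
    ultimately show ?thesis unfolding phys_idx_def commutes_S_def by blast
  qed
  show "phys_idx r (\<lambda>i j. lam_vec r s i * lam_vec r s j)" "phys_idx r (\<lambda>i j. lam_vec r s i * square_vec s j)"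
    "phys_idx r (\<lambda>i j. square_vec s i * lam_vec r s j)" by (rule rank1; simp)+
  have "commutes_S r (\<lambda>i j. 1 * (lam_vec r s i * lam_vec r s j) + (- 1 / 2) * (charge_vec r i * charge_vec r j) + 1 * kernel_mat (\<lambda>_ _. 0) 1 i j)"
    by (intro commutes_S_lincomb commutes_S_rank_one S_eigenvector_lam_vec[OF s] S_eigenvector_charge_vec commutes_S_kernel_mat)
       (simp_all add: kernel_def per_def fourier_comm_def)
  then have "commutes_S r (B_i_idx r s)" by (simp add: commutes_S_def B_i_idx_def)
  moreover have "T_idx r i = T_idx r j" if ij: "i \<in> idxs r" "j \<in> idxs r" "B_i_idx r s i j \<noteq> 0" for i j
  proof (cases "kernel_mat (\<lambda>_ _. 0) 1 i j = 0")
    case True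
    then have "lam_vec r s i * lam_vec r s j \<noteq> 0 \<or> charge_vec r i * charge_vec r j \<noteq> 0" using ij(3) by (auto simp: B_i_idx_def)
    then show ?thesis using T_vec_support[OF s ij(1)] T_vec_support[OF s ij(2)] by auto
  next
    case False
    then show ?thesis by (intro kernel_mat_T[OF _ ij(1,2)]) auto
  qed
  moreover have "B_i_idx r s i j \<in> \<nat>" if "i \<in> idxs r" "j \<in> idxs r" for i j
    unfolding B_i_idx_def by (rule idx_cases[OF that(1)]; rule idx_cases[OF that(2)]) simp_all
  moreover have "B_i_idx r s Vac Vac = 1" by (simp add: B_i_idx_def)
  ultimately show "phys_idx r (B_i_idx r s)" unfolding phys_idx_def commutes_S_def by blast
qed

lemma phys_idx_same:
  assumes "same_idx r A B" "phys_idx r B"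
  shows "phys_idx r A"
proof -
  have eq: "A i j = B i j" if "i \<in> idxs r" "j \<in> idxs r" for i j using assms(1) that by (simp add: same_idx_def)
  have "(\<Sum>k\<in>idxs r. A i k * S_c r k j) = (\<Sum>k\<in>idxs r. B i k * S_c r k j)"
    "(\<Sum>k\<in>idxs r. S_c r i k * A k j) = (\<Sum>k\<in>idxs r. S_c r i k * B k j)" if "i \<in> idxs r" "j \<in> idxs r" for i j
    using that by (auto intro!: sum.cong simp: eq)
  then show ?thesis using assms(2) by (simp add: phys_idx_def eq)
qed

section \<open>Divisor pairs and the parameters of the families\<close>

text \<open>The invariant of the divisor pair \<open>{g, n / g}\<close> has the parameters \<open>d = lcm g (n / g)\<close> and
  \<open>l \<equiv> 1\<close>, \<open>l \<equiv> -1\<close> modulo the two coprime parts of \<open>g\<close> and \<open>n / g\<close>; here \<open>D = gcd g (n / g)\<close>.\<close>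

definition splitting :: "nat \<Rightarrow> nat \<Rightarrow> int \<Rightarrow> nat \<Rightarrow> bool" where
  "splitting n d l g \<longleftrightarrow> (\<exists>D g1 g2. g = D * g1 \<and> n = (D * g1) * (D * g2) \<and> d = D * (g1 * g2)
     \<and> coprime g1 g2 \<and> int g1 dvd l - 1 \<and> int g2 dvd l + 1)"

text \<open>D divides 2x and 2y, hence x and y as D is odd. After division by D, y agrees with l x
  modulo g1, where l is 1, and modulo g2, where l is -1; coprimality joins the two
  congruences.\<close>

lemma divisor_pair_iff:
  fixes D g1 g2 :: nat and x y l :: int
  assumes D: "odd D" and co: "coprime g1 g2" and l: "int g1 dvd l - 1" "int g2 dvd l + 1"
  shows "int (D * g1) dvd x - y \<and> int (D * g2) dvd x + y \<longleftrightarrow> int D dvd x \<and> int (D * (g1 * g2)) dvd y - l * x"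
proof -
  have D0: "D > 0" using D by (rule odd_pos)
  have key: "int (D * g1) dvd int D * x' - int D * y' \<and> int (D * g2) dvd int D * x' + int D * y'
    \<longleftrightarrow> int (D * (g1 * g2)) dvd int D * y' - l * (int D * x')" for x' y'
  proof -
    have "int (D * g1) dvd int D * x' - int D * y' \<longleftrightarrow> int g1 dvd x' - y'"
      using D0 by (simp add: right_diff_distrib[symmetric])
    also have "\<dots> \<longleftrightarrow> int g1 dvd y' - l * x'"
    proof -
      have "y' - l * x' = - (x' - y') - (l - 1) * x'" by (simp add: algebra_simps)
      then show ?thesis using l(1) by (metis dvd_mult2 dvd_diff_left_iff dvd_minus_iff)
    qed
    finally have 1: "int (D * g1) dvd int D * x' - int D * y' \<longleftrightarrow> int g1 dvd y' - l * x'" .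
    have "int (D * g2) dvd int D * x' + int D * y' \<longleftrightarrow> int g2 dvd x' + y'"
      using D0 by (simp add: distrib_left[symmetric])
    also have "\<dots> \<longleftrightarrow> int g2 dvd y' - l * x'"
    proof -
      have "y' - l * x' = (x' + y') - (l + 1) * x'" by (simp add: algebra_simps)
      then show ?thesis using l(2) by (metis dvd_mult2 dvd_diff_left_iff)
    qed
    finally have 2: "int (D * g2) dvd int D * x' + int D * y' \<longleftrightarrow> int g2 dvd y' - l * x'" .
    have "int (D * (g1 * g2)) dvd int D * y' - l * (int D * x') \<longleftrightarrow> int (D * (g1 * g2)) dvd int D * (y' - l * x')"
      by (simp add: algebra_simps)
    also have "\<dots> \<longleftrightarrow> int g1 * int g2 dvd y' - l * x'" using D0 by simp
    also have "\<dots> \<longleftrightarrow> int g1 dvd y' - l * x' \<and> int g2 dvd y' - l * x'"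
      using co by (meson coprime_int_iff divides_mult dvd_mult_left dvd_mult_right)
    finally show ?thesis using 1 2 by simp
  qed
  show ?thesis
  proof
    assume A: "int (D * g1) dvd x - y \<and> int (D * g2) dvd x + y"
    then have "int D dvd x - y" "int D dvd x + y" by (auto elim: dvd_mult_left)
    then have "int D dvd (x - y) + (x + y)" "int D dvd (x + y) - (x - y)" by (blast intro: dvd_add dvd_diff)+
    then have xy: "int D dvd x" "int D dvd y" using odd_dvd_2_mult[OF D] by simp_all
    then obtain x' y' where "x = int D * x'" "y = int D * y'" by (elim dvdE)
    then show "int D dvd x \<and> int (D * (g1 * g2)) dvd y - l * x" using A key[of x' y'] by simp
  next
    assume A: "int D dvd x \<and> int (D * (g1 * g2)) dvd y - l * x"
    then have "int D dvd y - l * x" "int D dvd l * x" by (auto elim: dvd_mult_left)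
    then have "int D dvd y" using dvd_diff_left_iff by blast
    then obtain x' y' where "x = int D * x'" "y = int D * y'" using A by (elim conjE dvdE)
    then show "int (D * g1) dvd x - y \<and> int (D * g2) dvd x + y" using A key[of x' y'] by simp
  qed
qed

text \<open>The second member of the pair is described by the same criterion with g1, g2 exchanged
  and l replaced by -l.\<close>

lemma lag2_splitting:
  assumes n: "odd n" and sp: "n = (D * g1) * (D * g2)" "coprime g1 g2" "int g1 dvd l - 1" "int g2 dvd l + 1"
  shows "lag2 n (D * g1) x y = (if int D dvd x then
    of_bool (int (D * (g1 * g2)) dvd y - l * x) + of_bool (int (D * (g1 * g2)) dvd y + l * x) else 0)"
proof -
  have D: "odd D" and n0: "D * g1 > 0" "D * g2 > 0" using n sp(1) by (auto intro: Nat.gr0I)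
  have k: "n div (D * g1) = D * g2" "n div (D * g2) = D * g1" unfolding sp(1) using n0 by simp_all
  have "int g2 dvd - (l + 1)" "int g1 dvd - (l - 1)" using sp(3,4) by (simp_all only: dvd_minus_iff)
  then have "int g2 dvd - l - 1" "int g1 dvd - l + 1" by simp_all
  then have "int (D * g2) dvd x - y \<and> int (D * g1) dvd x + y \<longleftrightarrow> int D dvd x \<and> int (D * (g2 * g1)) dvd y - (- l) * x"
    using sp(2) by (intro divisor_pair_iff D) (simp_all add: coprime_commute)
  then show ?thesis
    using divisor_pair_iff[OF D sp(2-4), of x y] by (simp add: lag2_def lag_def k mult.commute[of g2])
qed

text \<open>The entry 2 occurs exactly when both congruences b = +-a l hold and neither index is 0.
  If a or b is 0 the congruences coincide while the entry counts them once, hence the division by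
  2.\<close>

lemma B_entry_lag2:
  assumes n: "odd n" and sp: "splitting n d l g"
  shows "B_entry n d l a b = lag2 n g (int a) (int b) / (if a = 0 \<or> b = 0 then 2 else 1)"
proof -
  obtain D g1 g2 where g: "g = D * g1" "n = (D * g1) * (D * g2)" "d = D * (g1 * g2)"
    and co: "coprime g1 g2" "int g1 dvd l - 1" "int g2 dvd l + 1"
    using sp unfolding splitting_def by blast
  have d: "odd d" "n = D * d" using n g by (auto simp: mult_ac)
  have d0: "d > 0" using d(1) by (rule odd_pos)
  have L: "lag2 n g (int a) (int b) = (if D dvd a then of_bool (int d dvd int b - l * int a) + of_bool (int d dvd int b + l * int a) else 0)"
    unfolding g(1) g(3) lag2_splitting[OF n g(2) co] by simp
  have nd: "n dvd d * a \<longleftrightarrow> D dvd a" using d0 unfolding d(2) by (simp add: mult.commute[of D])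
  have cong: "[int b = int a * l] (mod int d) \<longleftrightarrow> int d dvd int b - l * int a"
    "[int b = - (int a * l)] (mod int d) \<longleftrightarrow> int d dvd int b + l * int a"
    by (simp_all add: cong_iff_dvd_diff mult.commute)
  have both: "d dvd a \<and> d dvd b \<longleftrightarrow> D dvd a \<and> int d dvd int b - l * int a \<and> int d dvd int b + l * int a"
  proof
    assume A: "d dvd a \<and> d dvd b"
    then have "D dvd a" unfolding g(3) by (metis dvd_mult_left)
    then show "D dvd a \<and> int d dvd int b - l * int a \<and> int d dvd int b + l * int a" using A by simp
  next
    assume A: "D dvd a \<and> int d dvd int b - l * int a \<and> int d dvd int b + l * int a"
    then have "int d dvd (int b - l * int a) + (int b + l * int a)" "int d dvd (int b + l * int a) - (int b - l * int a)"
      by (blast intro: dvd_add dvd_diff)+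
    then have "int d dvd 2 * int b" "int d dvd 2 * (l * int a)" by simp_all
    then have b: "int d dvd int b" and la: "int d dvd l * int a" using odd_dvd_2_mult[OF d(1)] by blast+
    have "int (g1 * g2) dvd (l - 1) * (l + 1)" using co(2,3) by (simp add: mult_dvd_mono)
    then have "int D * int (g1 * g2) dvd int a * ((l - 1) * (l + 1))" using A by (intro mult_dvd_mono) auto
    moreover have "int a * ((l - 1) * (l + 1)) = l * (l * int a) - int a" by (simp add: algebra_simps)
    ultimately have "int d dvd l * (l * int a) - int a" using g(3) by simp
    then have "int d dvd int a" using dvd_diff_right_iff[OF dvd_mult[OF la, of l], of "int a"] by simp
    then show "d dvd a \<and> d dvd b" using b by simp
  qed
  show ?thesis
  proof (cases "a = 0 \<or> b = 0")
    case True
    moreover have "int d dvd int b - l * int a \<longleftrightarrow> int d dvd int b + l * int a" using True by auto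
    ultimately show ?thesis unfolding L B_entry_def cong nd by auto
  next
    case False
    then show ?thesis unfolding L B_entry_def cong nd using both by auto
  qed
qed

text \<open>With D = n/d one has d^2/n = d/D =: m, and m divides (l - 1)(l + 1). Taking g1 = gcd(m,
  l - 1), the cofactor divides l + 1; a common divisor of the two parts divides 2 and the odd number
  m, so they are coprime.\<close>

lemma admissible_splitting:
  assumes n: "odd n" and a: "admissible n d l"
  obtains g where "g dvd n" "splitting n d l g"
proof -
  have n0: "n > 0" using n by (rule odd_pos)
  from a have "d dvd n" "n dvd d\<^sup>2" unfolding admissible_def by auto
  then obtain D m where D: "n = d * D" and m: "d\<^sup>2 = n * m" by (elim dvdE)
  have "d > 0" using D n0 by (auto intro: Nat.gr0I)
  then have d: "d = D * m" using m unfolding D by (simp add: power2_eq_square mult.assoc)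
  have m_odd: "odd m" using n unfolding D d by simp
  have "d\<^sup>2 div n = m" using m n0 by simp
  then have "[l\<^sup>2 = 1] (mod int m)" using a unfolding admissible_def by simp
  then have ml: "int m dvd (l - 1) * (l + 1)" by (simp add: cong_iff_dvd_diff power2_eq_square algebra_simps)
  define g1 where "g1 = nat (gcd (int m) (l - 1))"
  have g1: "int g1 = gcd (int m) (l - 1)" by (simp add: g1_def)
  then have "int g1 dvd int m" "int g1 dvd l - 1" by simp_all
  then have "g1 dvd m" by simp
  then obtain g2 where g2: "m = g1 * g2" ..
  have "m > 0" using m_odd by (rule odd_pos)
  then have g1_pos: "int g1 \<noteq> 0" using g2 by (auto intro: Nat.gr0I)
  obtain t where t: "l - 1 = int g1 * t" using \<open>int g1 dvd l - 1\<close> ..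
  have "int g1 * gcd (int g2) t = int g1" using g1 unfolding t g2 by (simp add: gcd_mult_distrib_int[symmetric])
  then have "coprime (int g2) t" using g1_pos by (simp add: coprime_iff_gcd_eq_1)
  moreover have "int g2 dvd t * (l + 1)" using ml g1_pos unfolding t g2 by (simp add: mult.assoc)
  ultimately have l2: "int g2 dvd l + 1" using coprime_dvd_mult_right_iff by blast
  have "coprime (int g1) (int g2)"
  proof (rule coprimeI)
    fix c assume c: "c dvd int g1" "c dvd int g2"
    then have "c dvd (l + 1) - (l - 1)" using l2 \<open>int g1 dvd l - 1\<close> by (meson dvd_diff dvd_trans)
    then have "c dvd 2" by simp
    moreover have "coprime c 2"
    proof -
      have "c dvd int m" using c(1) unfolding g2 by simp
      then have "odd c" using m_odd by (metis dvd_trans even_of_nat)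
      then show ?thesis by simp
    qed
    ultimately show "is_unit c" by (metis coprime_common_divisor dvd_refl)
  qed
  then have "splitting n d l (D * g1)"
    unfolding splitting_def D d g2 using l2 \<open>int g1 dvd l - 1\<close>
    by (intro exI[of _ D] exI[of _ g1] exI[of _ g2]) (simp add: mult_ac)
  moreover have "D * g1 dvd n" unfolding D d g2 by simp
  ultimately show thesis using that by blast
qed

lemma splitting_admissible:
  assumes n: "odd n" and D: "n = (D * g1) * (D * g2)" and co: "coprime g1 g2"
    and l: "0 \<le> l" "2 * l < int (g1 * g2)" "int g1 dvd l - 1" "int g2 dvd l + 1"
  shows "admissible n (D * (g1 * g2)) l"
proof -
  have n0: "n > 0" using n by (rule odd_pos)
  have sq: "(D * (g1 * g2))\<^sup>2 = n * (g1 * g2)" by (simp add: D power2_eq_square mult_ac)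
  have "real_of_int l < real (g1 * g2) / 2" using l(2) by linarith
  also have "real (g1 * g2) / 2 = (real (D * (g1 * g2)))\<^sup>2 / (2 * real n)"
    using n0 arg_cong[OF sq, of real] by (simp add: field_simps)
  finally have "real_of_int l < (real (D * (g1 * g2)))\<^sup>2 / (2 * real n)" .
  moreover have "(D * (g1 * g2))\<^sup>2 div n = g1 * g2" unfolding sq using n0 by simp
  moreover have "[l\<^sup>2 = 1] (mod int (g1 * g2))"
  proof -
    have "int g1 * int g2 dvd (l - 1) * (l + 1)" using l(3,4) by (rule mult_dvd_mono)
    then show ?thesis by (simp add: cong_iff_dvd_diff power2_eq_square algebra_simps)
  qed
  moreover have "D * (g1 * g2) dvd n" unfolding D by (simp add: mult_ac)
  ultimately show ?thesis unfolding admissible_def using l(1) sq by simp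
qed

text \<open>The Chinese remainder theorem gives l modulo g1 g2, which is odd, so l is never exactly
  half of it. A representative above the half is replaced by its negative, which exchanges g and n/g
  and leaves the pair unchanged.\<close>

lemma divisor_admissible:
  assumes n: "odd n" and g: "g dvd n"
  obtains d l h where "admissible n d l" "splitting n d l h" "lag2 n h = lag2 n g"
proof -
  have n0: "n > 0" using n by (rule odd_pos)
  note c = codivisor[OF n0 g]
  define D where "D = gcd g (n div g)"
  have "D \<noteq> 0" using c by (simp add: D_def)
  then obtain g1 g2 where g12: "g = D * g1" "n div g = D * g2" "coprime g1 g2"
    unfolding D_def by (metis gcd_coprime_exists mult.commute)
  have nD: "n = (D * g1) * (D * g2)" using c(1) g12(1,2) by simp
  have m: "odd (g1 * g2)" "g1 * g2 > 0" using n unfolding nD by (auto intro: Nat.gr0I)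
  obtain x where x: "[x = 1] (mod int g1)" "[x = -1] (mod int g2)"
    using binary_chinese_remainder_int[of "int g1" "int g2" 1 "-1"] g12(3) by auto
  define l where "l = x mod int (g1 * g2)"
  have "[l = x] (mod int (g1 * g2))" by (simp add: l_def cong_def)
  then have "[l = x] (mod int g1)" "[l = x] (mod int g2)" by (auto intro: cong_dvd_modulus)
  then have "[l = 1] (mod int g1)" "[l = -1] (mod int g2)" using x by (blast intro: cong_trans)+
  then have l: "int g1 dvd l - 1" "int g2 dvd l + 1" by (simp_all add: cong_iff_dvd_diff)
  have lb: "0 \<le> l" "l < int (g1 * g2)" using m(2) by (simp_all only: l_def of_nat_0_less_iff pos_mod_sign pos_mod_bound)
  show thesis
  proof (cases "2 * l < int (g1 * g2)")
    case True
    have "splitting n (D * (g1 * g2)) l g"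
      unfolding splitting_def using g12 nD l by blast
    then show thesis using that splitting_admissible[OF n nD g12(3) lb(1) True l] by blast
  next
    case False
    let ?l = "int (g2 * g1) - l"
    have nD': "n = (D * g2) * (D * g1)" and co: "coprime g2 g1" using nD g12(3) by (simp_all add: mult_ac coprime_commute)
    have "2 * l \<noteq> int (g1 * g2)" using m(1) by presburger
    then have b: "0 \<le> ?l" "2 * ?l < int (g2 * g1)" using lb False by (simp_all add: mult.commute[of g2])
    have "int g2 dvd int (g2 * g1) - (l + 1)" "int g1 dvd int (g2 * g1) - (l - 1)" using l by (auto intro!: dvd_diff)
    then have l': "int g2 dvd ?l - 1" "int g1 dvd ?l + 1" by (simp_all add: algebra_simps)
    have "splitting n (D * (g2 * g1)) ?l (D * g2)"
      unfolding splitting_def using co nD' l' by blast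
    moreover have "lag2 n (D * g2) = lag2 n g"
      unfolding g12(2)[symmetric] lag2_def c(4) by (simp add: add.commute)
    ultimately show thesis using that splitting_admissible[OF n nD' co b l'] by blast
  qed
qed

section \<open>The matrices of the list over labels\<close>

fun current_idx :: "idx \<Rightarrow> idx" where
  "current_idx Vac = VacJ" | "current_idx VacJ = Vac" | "current_idx Spin = SpinJ" | "current_idx SpinJ = Spin" | "current_idx (Gam a) = Gam a"

lemma current_idx_simps [simp]:
  "current_idx (current_idx i) = i" "current_idx i \<in> idxs r \<longleftrightarrow> i \<in> idxs r" "spinor (current_idx i) \<longleftrightarrow> spinor i"
  "index_of (current_idx i) = index_of i" "mult_of (current_idx i) = mult_of i" "charge (current_idx i) = - charge i"
  by (cases i; force)+

lemma current_idx_eq_iff: "current_idx i = j \<longleftrightarrow> i = current_idx j"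
  by auto

definition gamma_idx :: "nat \<Rightarrow> idx" where
  "gamma_idx a = (if a = 0 then Vac else Gam a)"

lemma gamma_idx_idxs: "a \<le> r \<Longrightarrow> gamma_idx a \<in> idxs r"
  by (simp add: gamma_idx_def)

lemma wt_of_gamma_idx: "wt_of r (gamma_idx a) = gamma_wt r a"
  by (simp add: gamma_idx_def)

lemma wt_of_eq_iff: "r \<ge> 3 \<Longrightarrow> i \<in> idxs r \<Longrightarrow> j \<in> idxs r \<Longrightarrow> wt_of r i = wt_of r j \<longleftrightarrow> i = j"
  using wt_of_bij[of r] by (auto simp: bij_betw_def inj_on_def)

lemma simple_current_wt_of:
  assumes "r \<ge> 3" "i \<in> idxs r"
  shows "simple_current (wt_of r i) = wt_of r (current_idx i)"
proof -
  have "current_idx i \<in> idxs r" using assms(2) by simp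
  then show ?thesis unfolding wt_of_labels[OF assms] wt_of_labels[OF assms(1) \<open>current_idx i \<in> idxs r\<close>]
    using assms by (cases i) (auto simp: simple_current_def fun_eq_iff)
qed

lemma orbit_eq:
  assumes r: "r \<ge> 3" and x: "x \<in> idxs r" and a: "a \<le> r"
  shows "wt_of r x = gamma_wt r a \<longleftrightarrow> x = gamma_idx a" "wt_of r x = simple_current (gamma_wt r a) \<longleftrightarrow> x = current_idx (gamma_idx a)"
  unfolding wt_of_gamma_idx[symmetric] simple_current_wt_of[OF r gamma_idx_idxs[OF a]]
  using wt_of_eq_iff[OF r x] gamma_idx_idxs[OF a] by simp_all

lemma eq_gamma_idx_iff:
  assumes "x \<in> idxs r"
  shows "x = gamma_idx a \<longleftrightarrow> \<not> spinor x \<and> x \<noteq> VacJ \<and> a = index_of x" "x = current_idx (gamma_idx a) \<longleftrightarrow> \<not> spinor x \<and> x \<noteq> Vac \<and> a = index_of x"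
  using assms by (cases x; force simp: gamma_idx_def)+

lemma gamma_index_wt_of:
  assumes r: "r \<ge> 3" and x: "x \<in> idxs r" "\<not> spinor x"
  shows "gamma_index r (wt_of r x) = index_of x"
proof -
  have "a \<le> r \<and> (\<exists>i\<in>{0, 1}. wt_of r x = (simple_current ^^ i) (gamma_wt r a)) \<longleftrightarrow> a = index_of x" for a
  proof -
    have "a \<le> r \<and> (\<exists>i\<in>{0, 1}. wt_of r x = (simple_current ^^ i) (gamma_wt r a)) \<longleftrightarrow> a \<le> r \<and> (x = gamma_idx a \<or> x = current_idx (gamma_idx a))"
      using orbit_eq[OF r x(1), of a] by auto
    then show ?thesis unfolding eq_gamma_idx_iff[OF x(1)] using x(2) index_of_le[OF x(1)] by auto
  qed
  then show ?thesis unfolding gamma_index_def by simp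
qed

text \<open>J fixes \<gamma>^a for a > 0, so demanding the same power of J on both sides excludes,
  among nonspinors, only the pairings of 0 with J0.\<close>

lemma B_mat_wt_of:
  assumes r: "r \<ge> 3" and x: "x \<in> idxs r" and y: "y \<in> idxs r"
  shows "B_mat r d l (wt_of r x) (wt_of r y) =
    (if \<not> spinor x \<and> \<not> spinor y \<and> \<not> (x = Vac \<and> y = VacJ) \<and> \<not> (x = VacJ \<and> y = Vac)
     then B_entry (2 * r + 1) d l (index_of x) (index_of y) else if spinor x \<and> x = y then 1 else 0)"
proof -
  have E: "(\<exists>a\<le>r. x = gamma_idx a) \<longleftrightarrow> \<not> spinor x \<and> x \<noteq> VacJ" "(\<exists>a\<le>r. x = current_idx (gamma_idx a)) \<longleftrightarrow> \<not> spinor x \<and> x \<noteq> Vac"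
    if "x \<in> idxs r" for x unfolding eq_gamma_idx_iff[OF that] using index_of_le[OF that] by auto
  have orbit: "(\<exists>a\<le>r. z = gamma_idx a) \<longleftrightarrow> (\<exists>a\<le>r. wt_of r z = gamma_wt r a)"
    "(\<exists>a\<le>r. z = current_idx (gamma_idx a)) \<longleftrightarrow> (\<exists>a\<le>r. wt_of r z = simple_current (gamma_wt r a))" if "z \<in> idxs r" for z
    using orbit_eq[OF r that] by blast+
  have split: "(\<exists>i\<in>{0, 1}. \<exists>a\<le>r. \<exists>b\<le>r. P i a \<and> Q i b) \<longleftrightarrow>
    (\<exists>a\<le>r. P 0 a) \<and> (\<exists>b\<le>r. Q 0 b) \<or> (\<exists>a\<le>r. P 1 a) \<and> (\<exists>b\<le>r. Q 1 b)" for P Q :: "nat \<Rightarrow> nat \<Rightarrow> bool"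
    by blast
  have "(\<exists>i\<in>{0, 1}. \<exists>a\<le>r. \<exists>b\<le>r. wt_of r x = (simple_current ^^ i) (gamma_wt r a) \<and> wt_of r y = (simple_current ^^ i) (gamma_wt r b))
    \<longleftrightarrow> (\<exists>a\<le>r. x = gamma_idx a) \<and> (\<exists>b\<le>r. y = gamma_idx b) \<or> (\<exists>a\<le>r. x = current_idx (gamma_idx a)) \<and> (\<exists>b\<le>r. y = current_idx (gamma_idx b))"
    unfolding split orbit[OF x] orbit[OF y] by simp
  also have "\<dots> \<longleftrightarrow> \<not> spinor x \<and> \<not> spinor y \<and> \<not> (x = Vac \<and> y = VacJ) \<and> \<not> (x = VacJ \<and> y = Vac)"
    unfolding E[OF x] E[OF y] by (cases x; cases y; simp)
  finally have 1: "(\<exists>i\<in>{0, 1}. \<exists>a\<le>r. \<exists>b\<le>r. wt_of r x = (simple_current ^^ i) (gamma_wt r a) \<and> wt_of r y = (simple_current ^^ i) (gamma_wt r b))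
    \<longleftrightarrow> \<not> spinor x \<and> \<not> spinor y \<and> \<not> (x = Vac \<and> y = VacJ) \<and> \<not> (x = VacJ \<and> y = Vac)" .
  have S: "wt_of r z = spinor_wt r \<longleftrightarrow> z = Spin" "wt_of r z = simple_current (spinor_wt r) \<longleftrightarrow> z = SpinJ" if "z \<in> idxs r" for z
    using wt_of_eq_iff[OF r that, of Spin] wt_of_eq_iff[OF r that, of SpinJ] by simp_all
  have 2: "(\<exists>i\<in>{0, 1}. wt_of r x = (simple_current ^^ i) (spinor_wt r) \<and> wt_of r y = (simple_current ^^ i) (spinor_wt r))
    \<longleftrightarrow> spinor x \<and> x = y"
    using S[OF x] S[OF y] by (cases x) auto
  show ?thesis unfolding B_mat_def 1 2 using gamma_index_wt_of[OF r x] gamma_index_wt_of[OF r y] by auto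
qed

abbreviation on_idx :: "nat \<Rightarrow> wmat \<Rightarrow> idx \<Rightarrow> idx \<Rightarrow> complex" where
  "on_idx r A i j \<equiv> A (wt_of r i) (wt_of r j)"

lemma splitting_dvd: "splitting n d l g \<Longrightarrow> g dvd n"
  by (auto simp: splitting_def)

lemma B_mat_same:
  assumes r: "r \<ge> 3" and sp: "splitting (2 * r + 1) d l g"
  shows "same_idx r (on_idx r (B_mat r d l)) (kernel_mat (lag2 (2 * r + 1) g) 1)"
  unfolding same_idx_def
proof (intro ballI)
  fix i j assume ij: "i \<in> idxs r" "j \<in> idxs r"
  have n: "odd (2 * r + 1)" by simp
  define L where "L = lag2 (2 * r + 1) g"
  have L: "L 0 0 = 2" using lag2_properties(7)[OF splitting_dvd[OF sp]] by (simp add: L_def)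
  show "on_idx r (B_mat r d l) i j = kernel_mat (lag2 (2 * r + 1) g) 1 i j"
    unfolding B_mat_wt_of[OF r ij] B_entry_lag2[OF n sp] L_def[symmetric]
    using ij by (cases i; cases j) (auto simp: kernel_mat_def L)
qed

lemma wt_of_label_r:
  assumes "r \<ge> 3" "x \<in> idxs r"
  shows "wt_of r x r = (if spinor x then 1 else if x = Gam r then 2 else 0)"
  unfolding wt_of_labels[OF assms] using assms by (cases x) auto

text \<open>The label at position r is odd exactly for the spinors, whose rows are therefore killed;
  elsewhere both powers of J contribute.\<close>

lemma I_J_wt_of:
  assumes r: "r \<ge> 3" and x: "x \<in> idxs r" and y: "y \<in> idxs r"
  shows "I_J r (wt_of r x) (wt_of r y) = (if spinor x then 0 else (if x = current_idx y then 1 else 0) + (if x = y then 1 else 0))"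
proof -
  have half: "1 / 2 + real l \<notin> \<int>" for l
  proof
    assume "1 / 2 + real l \<in> \<int>"
    then obtain k where "1 / 2 + real l = of_int k" by (elim Ints_cases)
    then have "1 + 2 * int l = 2 * k" by linarith
    then show False by presburger
  qed
  have "real (wt_of r x r) / 2 + real l \<in> \<int> \<longleftrightarrow> \<not> spinor x" for l
    unfolding wt_of_label_r[OF r x] using half[of l] by (auto intro: Ints_add)
  moreover have "simple_current (wt_of r x) = wt_of r y \<longleftrightarrow> x = current_idx y"
    using x y by (simp add: simple_current_wt_of[OF r] wt_of_eq_iff[OF r] current_idx_eq_iff)
  moreover have "simple_current (simple_current (wt_of r x)) = wt_of r y \<longleftrightarrow> x = y"
    using x y by (simp add: simple_current_wt_of[OF r] wt_of_eq_iff[OF r])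
  moreover have "{1..2::nat} = {1, 2}" by auto
  ultimately show ?thesis by (simp add: I_J_def numeral_2_eq_2)
qed

lemma mult_I_J:
  assumes r: "r \<ge> 3" and j: "j \<in> idxs r"
  shows "wmat_mult r 2 A (I_J r) \<mu> (wt_of r j) = (if spinor j then 0 else A \<mu> (wt_of r (current_idx j)) + A \<mu> (wt_of r j))"
    "wmat_mult r 2 (I_J r) A (wt_of r j) \<mu> = (if spinor j then 0 else A (wt_of r (current_idx j)) \<mu> + A (wt_of r j) \<mu>)"
proof -
  have "(\<Sum>k\<in>idxs r. A \<mu> (wt_of r k) * I_J r (wt_of r k) (wt_of r j))
    = (\<Sum>k\<in>idxs r. (if k = current_idx j then if spinor j then 0 else A \<mu> (wt_of r (current_idx j)) else 0) + (if k = j then if spinor j then 0 else A \<mu> (wt_of r j) else 0))"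
    using j by (intro sum.cong refl) (auto simp: I_J_wt_of[OF r])
  then show "wmat_mult r 2 A (I_J r) \<mu> (wt_of r j) = (if spinor j then 0 else A \<mu> (wt_of r (current_idx j)) + A \<mu> (wt_of r j))"
    unfolding wmat_mult_idx[OF r] using j by (simp add: sum.distrib)
  have "(\<Sum>k\<in>idxs r. I_J r (wt_of r j) (wt_of r k) * A (wt_of r k) \<mu>)
    = (\<Sum>k\<in>idxs r. (if k = current_idx j then if spinor j then 0 else A (wt_of r (current_idx j)) \<mu> else 0) + (if k = j then if spinor j then 0 else A (wt_of r j) \<mu> else 0))"
    using j by (intro sum.cong refl) (auto simp: I_J_wt_of[OF r])
  then show "wmat_mult r 2 (I_J r) A (wt_of r j) \<mu> = (if spinor j then 0 else A (wt_of r (current_idx j)) \<mu> + A (wt_of r j) \<mu>)"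
    unfolding wmat_mult_idx[OF r] using j by (simp add: sum.distrib)
qed

text \<open>J reverses the charge and fixes the index, so summing over its orbit removes the
  antisymmetric part. This is the origin of the scalar 0 in the second family.\<close>

lemma kernel_mat_current_idx:
  "\<not> spinor j \<Longrightarrow> kernel_mat K y i (current_idx j) + kernel_mat K y i j = 2 * kernel_mat K 0 i j"
  by (auto simp: kernel_mat_def)

lemma B2_mat_same:
  assumes r: "r \<ge> 3" and sp: "splitting (2 * r + 1) d1 l1 g" "splitting (2 * r + 1) d2 l2 h"
  shows "same_idx r (on_idx r (B2_mat r d1 l1 d2 l2)) (kernel_mat (\<lambda>x y. lag2 (2 * r + 1) g x y + lag2 (2 * r + 1) h x y) 0)"
  unfolding same_idx_def
proof (intro ballI)
  fix i j assume ij: "i \<in> idxs r" "j \<in> idxs r"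
  define G where "G = lag2 (2 * r + 1) g"
  define H where "H = lag2 (2 * r + 1) h"
  have e: "on_idx r (B_mat r d1 l1) i k = kernel_mat G 1 i k" "on_idx r (B_mat r d2 l2) i k = kernel_mat H 1 i k" if "k \<in> idxs r" for k
    using B_mat_same[OF r sp(1)] B_mat_same[OF r sp(2)] ij(1) that by (simp_all add: same_idx_def G_def H_def)
  show "on_idx r (B2_mat r d1 l1 d2 l2) i j = kernel_mat (\<lambda>x y. lag2 (2 * r + 1) g x y + lag2 (2 * r + 1) h x y) 0 i j"
  proof (cases "spinor j")
    case True
    then show ?thesis unfolding B2_mat_def mult_I_J[OF r ij(2)] by (simp add: kernel_mat_def)
  next
    case False
    have "on_idx r (B2_mat r d1 l1 d2 l2) i j = ((kernel_mat G 1 i (current_idx j) + kernel_mat G 1 i j) + (kernel_mat H 1 i (current_idx j) + kernel_mat H 1 i j)) / 2"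
      unfolding B2_mat_def mult_I_J[OF r ij(2)] using False ij(2) by (simp add: e field_simps)
    also have "\<dots> = kernel_mat G 0 i j + kernel_mat H 0 i j" unfolding kernel_mat_current_idx[OF False] by simp
    also have "\<dots> = kernel_mat (\<lambda>x y. G x y + H x y) 0 i j" by (simp add: kernel_mat_def distrib_right)
    finally show ?thesis unfolding G_def H_def .
  qed
qed

lemma special_weights:
  assumes r: "r \<ge> 3" and s: "s\<^sup>2 = 2 * r + 1" and x: "x \<in> idxs r"
  shows "wt_of r x = gamma_wt r 0 \<longleftrightarrow> x = Vac" "wt_of r x = simple_current (gamma_wt r 0) \<longleftrightarrow> x = VacJ"
    "wt_of r x = lambda_r r \<longleftrightarrow> x = lam r" "wt_of r x = mu_r r \<longleftrightarrow> x = mu r"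
    "wt_of r x \<in> C_set r \<longleftrightarrow> (\<exists>a. x = Gam a \<and> s dvd a)"
proof -
  show "wt_of r x = gamma_wt r 0 \<longleftrightarrow> x = Vac" "wt_of r x = simple_current (gamma_wt r 0) \<longleftrightarrow> x = VacJ"
    using orbit_eq[OF r x, of 0] by (simp_all add: gamma_idx_def)
  have "lambda_r r = wt_of r (lam r)" "mu_r r = wt_of r (mu r)"
    by (simp_all add: lambda_r_def mu_r_def lam_def mu_def)
  then show "wt_of r x = lambda_r r \<longleftrightarrow> x = lam r" "wt_of r x = mu_r r \<longleftrightarrow> x = mu r"
    using wt_of_eq_iff[OF r x] by simp_all
  have "s' = s" if "s'\<^sup>2 = 2 * r + 1" for s' using that unfolding s[symmetric] by simp
  then have "(\<exists>s'. s'\<^sup>2 = 2 * r + 1 \<and> s' dvd a) \<longleftrightarrow> s dvd a" for a using s by blast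
  then have "C_set r = {gamma_wt r a | a. a \<le> r \<and> gamma_wt r a \<noteq> gamma_wt r 0 \<and> s dvd a}"
    by (simp only: C_set_def)
  moreover have "gamma_wt r a = gamma_wt r 0 \<longleftrightarrow> a = 0" if "a \<le> r" for a
    using wt_of_eq_iff[OF r gamma_idx_idxs[OF that] gamma_idx_idxs[of 0 r]] unfolding wt_of_gamma_idx by (simp add: gamma_idx_def)
  ultimately have "wt_of r x \<in> C_set r \<longleftrightarrow> (\<exists>a. wt_of r x = gamma_wt r a \<and> a \<le> r \<and> a \<noteq> 0 \<and> s dvd a)" by auto
  also have "\<dots> \<longleftrightarrow> (\<exists>a. x = gamma_idx a \<and> a \<le> r \<and> a \<noteq> 0 \<and> s dvd a)"
    using orbit_eq(1)[OF r x] by blast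
  also have "\<dots> \<longleftrightarrow> (\<exists>a. x = Gam a \<and> s dvd a)"
    unfolding eq_gamma_idx_iff(1)[OF x] using x by (cases x) simp_all
  finally show "wt_of r x \<in> C_set r \<longleftrightarrow> (\<exists>a. x = Gam a \<and> s dvd a)" .
qed

text \<open>For the third and fourth matrix, summing over a J-orbit of nonspinors cancels the charge
  and identity terms of \<open>B_i_idx\<close> and turns \<open>lam_vec\<close> into
  \<open>square_vec\<close>.\<close>

lemma B_exceptional_same:
  assumes r: "r \<ge> 3" and s: "s\<^sup>2 = 2 * r + 1"
  shows "same_idx r (on_idx r (B_i r)) (B_i_idx r s)"
    "same_idx r (on_idx r (B_ii r)) (\<lambda>i j. lam_vec r s i * lam_vec r s j)"
    "same_idx r (on_idx r (B_iii r)) (\<lambda>i j. lam_vec r s i * square_vec s j)"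
    "same_idx r (on_idx r (B_iv r)) (\<lambda>i j. square_vec s i * lam_vec r s j)"
proof -
  note sw = special_weights[OF r s]
  show i: "same_idx r (on_idx r (B_i r)) (B_i_idx r s)"
    unfolding same_idx_def B_i_def Let_def B_i_idx_def
  proof (intro ballI)
    fix i j assume ij: "i \<in> idxs r" "j \<in> idxs r"
    show "(if (wt_of r i, wt_of r j) \<in> {(gamma_wt r 0, gamma_wt r 0)} \<union> {gamma_wt r 0} \<times> C_set r \<union> C_set r \<times> {gamma_wt r 0}
        \<union> C_set r \<times> C_set r \<union> {lambda_r r} \<times> C_set r \<union> C_set r \<times> {lambda_r r}
        \<union> {(mu_r r, mu_r r), (lambda_r r, simple_current (gamma_wt r 0)), (simple_current (gamma_wt r 0), lambda_r r)}
      then 1 else 0) = lam_vec r s i * lam_vec r s j - charge_vec r i * charge_vec r j / 2 + kernel_mat (\<lambda>_ _. 0) 1 i j"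
      unfolding Un_iff mem_Times_iff fst_conv snd_conv insert_iff empty_iff prod.inject sw[OF ij(1)] sw[OF ij(2)]
      by (rule idx_cases[OF ij(1)]; rule idx_cases[OF ij(2)]) simp_all
  qed
  show "same_idx r (on_idx r (B_ii r)) (\<lambda>i j. lam_vec r s i * lam_vec r s j)"
    unfolding same_idx_def B_ii_def Let_def
  proof (intro ballI)
    fix i j assume ij: "i \<in> idxs r" "j \<in> idxs r"
    show "(if (wt_of r i, wt_of r j) \<in> {(gamma_wt r 0, gamma_wt r 0)} \<union> {gamma_wt r 0} \<times> C_set r \<union> C_set r \<times> {gamma_wt r 0}
        \<union> C_set r \<times> C_set r \<union> {(gamma_wt r 0, lambda_r r), (lambda_r r, gamma_wt r 0), (lambda_r r, lambda_r r)}
        \<union> {lambda_r r} \<times> C_set r \<union> C_set r \<times> {lambda_r r}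
      then 1 else 0) = lam_vec r s i * lam_vec r s j"
      unfolding Un_iff mem_Times_iff fst_conv snd_conv insert_iff empty_iff prod.inject sw[OF ij(1)] sw[OF ij(2)]
      by (rule idx_cases[OF ij(1)]; rule idx_cases[OF ij(2)]) simp_all
  qed
  have e: "on_idx r (B_i r) i j = B_i_idx r s i j" if "i \<in> idxs r" "j \<in> idxs r" for i j
    using i that by (simp add: same_idx_def)
  show "same_idx r (on_idx r (B_iii r)) (\<lambda>i j. lam_vec r s i * square_vec s j)" "same_idx r (on_idx r (B_iv r)) (\<lambda>i j. square_vec s i * lam_vec r s j)"
    unfolding same_idx_def
  proof (intro ballI)
    fix i j assume ij: "i \<in> idxs r" "j \<in> idxs r"
    have "on_idx r (B_iii r) i j = (if spinor j then 0 else B_i_idx r s i (current_idx j) + B_i_idx r s i j)"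
      unfolding B_iii_def mult_I_J[OF r ij(2)] using ij by (simp add: e)
    also have "\<dots> = lam_vec r s i * square_vec s j"
      unfolding B_i_idx_def by (rule idx_cases[OF ij(1)]; rule idx_cases[OF ij(2)]) simp_all
    finally show "on_idx r (B_iii r) i j = lam_vec r s i * square_vec s j" .
  next
    show "\<forall>i\<in>idxs r. \<forall>j\<in>idxs r. on_idx r (B_iv r) i j = square_vec s i * lam_vec r s j"
    proof (intro ballI)
    fix i j assume ij: "i \<in> idxs r" "j \<in> idxs r"
    have "on_idx r (B_iv r) i j = (if spinor i then 0 else B_i_idx r s (current_idx i) j + B_i_idx r s i j)"
      unfolding B_iv_def mult_I_J[OF r ij(1)] using ij by (simp add: e)
    also have "\<dots> = square_vec s i * lam_vec r s j"
      unfolding B_i_idx_def by (rule idx_cases[OF ij(1)]; rule idx_cases[OF ij(2)]) simp_all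
    finally show "on_idx r (B_iv r) i j = square_vec s i * lam_vec r s j" .
    qed
  qed
qed

lemma same_idx_trans_iff: "same_idx r B C \<Longrightarrow> same_idx r A B \<longleftrightarrow> same_idx r A C"
  by (simp add: same_idx_def)

text \<open>Parameters and divisor pairs determine the same matrices; on the way back from g the
  parameters may split n/g instead, which has the same even kernel.\<close>

lemma family_a_iff:
  assumes r: "r \<ge> 3"
  shows "family_a r M \<longleftrightarrow> (\<exists>g. g dvd 2 * r + 1 \<and> same_idx r (on_idx r M) (kernel_mat (lag2 (2 * r + 1) g) 1))"
proof -
  have n: "odd (2 * r + 1)" by simp
  show ?thesis
  proof
    assume "family_a r M"
    then obtain d l where a: "admissible (2 * r + 1) d l" and M: "wmat_eq r 2 M (B_mat r d l)" unfolding family_a_def by blast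
    obtain g where "g dvd 2 * r + 1" and sp: "splitting (2 * r + 1) d l g" using admissible_splitting[OF n a] .
    then show "\<exists>g. g dvd 2 * r + 1 \<and> same_idx r (on_idx r M) (kernel_mat (lag2 (2 * r + 1) g) 1)"
      using M same_idx_trans_iff[OF B_mat_same[OF r sp]] by (auto simp: wmat_eq_idx[OF r] same_idx_def)
  next
    assume "\<exists>g. g dvd 2 * r + 1 \<and> same_idx r (on_idx r M) (kernel_mat (lag2 (2 * r + 1) g) 1)"
    then obtain g where g: "g dvd 2 * r + 1" and M: "same_idx r (on_idx r M) (kernel_mat (lag2 (2 * r + 1) g) 1)" by blast
    obtain d l h where a: "admissible (2 * r + 1) d l" and sp: "splitting (2 * r + 1) d l h" and h: "lag2 (2 * r + 1) h = lag2 (2 * r + 1) g"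
      using divisor_admissible[OF n g] .
    have "wmat_eq r 2 M (B_mat r d l)"
      using M same_idx_trans_iff[OF B_mat_same[OF r sp]] unfolding h wmat_eq_idx[OF r] same_idx_def by simp
    then show "family_a r M" unfolding family_a_def using a by blast
  qed
qed

lemma family_b_iff:
  assumes r: "r \<ge> 3"
  shows "family_b r M \<longleftrightarrow> (\<exists>g h. g dvd 2 * r + 1 \<and> h dvd 2 * r + 1
    \<and> same_idx r (on_idx r M) (kernel_mat (\<lambda>x y. lag2 (2 * r + 1) g x y + lag2 (2 * r + 1) h x y) 0))"
    (is "_ \<longleftrightarrow> ?R")
proof -
  have n: "odd (2 * r + 1)" by simp
  show ?thesis
  proof
    assume "family_b r M"
    then obtain d1 l1 d2 l2 where a: "admissible (2 * r + 1) d1 l1" "admissible (2 * r + 1) d2 l2"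
      and M: "wmat_eq r 2 M (B2_mat r d1 l1 d2 l2)" unfolding family_b_def by blast
    obtain g where g: "g dvd 2 * r + 1" "splitting (2 * r + 1) d1 l1 g" using admissible_splitting[OF n a(1)] .
    obtain h where h: "h dvd 2 * r + 1" "splitting (2 * r + 1) d2 l2 h" using admissible_splitting[OF n a(2)] .
    have "same_idx r (on_idx r M) (on_idx r (B2_mat r d1 l1 d2 l2))" using M by (simp add: wmat_eq_idx[OF r] same_idx_def)
    then show ?R using g(1) h(1) same_idx_trans_iff[OF B2_mat_same[OF r g(2) h(2)]] by blast
  next
    assume ?R
    then obtain g h where g: "g dvd 2 * r + 1" and h: "h dvd 2 * r + 1"
      and M: "same_idx r (on_idx r M) (kernel_mat (\<lambda>x y. lag2 (2 * r + 1) g x y + lag2 (2 * r + 1) h x y) 0)" by blast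
    obtain d1 l1 g' where a: "admissible (2 * r + 1) d1 l1" "splitting (2 * r + 1) d1 l1 g'" "lag2 (2 * r + 1) g' = lag2 (2 * r + 1) g"
      using divisor_admissible[OF n g] .
    obtain d2 l2 h' where b: "admissible (2 * r + 1) d2 l2" "splitting (2 * r + 1) d2 l2 h'" "lag2 (2 * r + 1) h' = lag2 (2 * r + 1) h"
      using divisor_admissible[OF n h] .
    have "same_idx r (on_idx r M) (on_idx r (B2_mat r d1 l1 d2 l2))"
      using M same_idx_trans_iff[OF B2_mat_same[OF r a(2) b(2)]] unfolding a(3) b(3) by blast
    then have "wmat_eq r 2 M (B2_mat r d1 l1 d2 l2)" by (simp add: wmat_eq_idx[OF r] same_idx_def)
    then show "family_b r M" unfolding family_b_def using a(1) b(1) by blast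
  qed
qed

theorem theorem2p1:
  fixes r n :: nat
  assumes r: "r \<ge> 3" and n: "n = 2 * r + 1"
  shows "(\<forall>M. physical_invariant r 2 M \<longleftrightarrow>
             family_a r M \<or> family_b r M
             \<or> ((\<exists>s. s\<^sup>2 = n) \<and> (\<exists>X\<in>{B_i r, B_ii r, B_iii r, B_iv r}. wmat_eq r 2 M X)))
    \<and> ((\<exists>s. s\<^sup>2 = n) \<longrightarrow>
         (\<forall>X\<in>{B_i r, B_ii r, B_iii r, B_iv r}.
            physical_invariant r 2 X \<and> \<not> family_a r X \<and> \<not> family_b r X)
         \<and> \<not> wmat_eq r 2 (B_i r) (B_ii r) \<and> \<not> wmat_eq r 2 (B_i r) (B_iii r)
         \<and> \<not> wmat_eq r 2 (B_i r) (B_iv r) \<and> \<not> wmat_eq r 2 (B_ii r) (B_iii r)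
         \<and> \<not> wmat_eq r 2 (B_ii r) (B_iv r) \<and> \<not> wmat_eq r 2 (B_iii r) (B_iv r))"
proof (intro conjI allI impI)
  fix M
  have eq: "wmat_eq r 2 M X \<longleftrightarrow> same_idx r (on_idx r M) (on_idx r X)" for X
    by (simp add: wmat_eq_idx[OF r] same_idx_def)
  have ex: "(\<exists>X\<in>{B_i r, B_ii r, B_iii r, B_iv r}. wmat_eq r 2 M X)
    \<longleftrightarrow> same_idx r (on_idx r M) (B_i_idx r s) \<or> same_idx r (on_idx r M) (\<lambda>i j. lam_vec r s i * lam_vec r s j)
      \<or> same_idx r (on_idx r M) (\<lambda>i j. lam_vec r s i * square_vec s j) \<or> same_idx r (on_idx r M) (\<lambda>i j. square_vec s i * lam_vec r s j)"
    if "s\<^sup>2 = n" for s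
    using B_exceptional_same[OF r that[unfolded n], THEN same_idx_trans_iff] by (simp add: eq)
  show "physical_invariant r 2 M \<longleftrightarrow>
             family_a r M \<or> family_b r M
             \<or> ((\<exists>s. s\<^sup>2 = n) \<and> (\<exists>X\<in>{B_i r, B_ii r, B_iii r, B_iv r}. wmat_eq r 2 M X))"
    (is "_ \<longleftrightarrow> ?R")
  proof
    assume "physical_invariant r 2 M"
    then have "phys_idx r (on_idx r M)" using physical_invariant_idx[OF r] by blast
    note cl = classification[OF r this]
    then show ?R
    proof (elim disjE)
      assume "\<exists>s. s\<^sup>2 = 2 * r + 1 \<and> (same_idx r (on_idx r M) (B_i_idx r s) \<or> same_idx r (on_idx r M) (\<lambda>i j. lam_vec r s i * lam_vec r s j)
        \<or> same_idx r (on_idx r M) (\<lambda>i j. lam_vec r s i * square_vec s j) \<or> same_idx r (on_idx r M) (\<lambda>i j. square_vec s i * lam_vec r s j))"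
      then obtain s where s: "s\<^sup>2 = n" and "same_idx r (on_idx r M) (B_i_idx r s) \<or> same_idx r (on_idx r M) (\<lambda>i j. lam_vec r s i * lam_vec r s j)
        \<or> same_idx r (on_idx r M) (\<lambda>i j. lam_vec r s i * square_vec s j) \<or> same_idx r (on_idx r M) (\<lambda>i j. square_vec s i * lam_vec r s j)"
        unfolding n by blast
      then show ?R using ex[OF s] by blast
    qed (simp_all only: family_a_iff[OF r] family_b_iff[OF r], blast+)
  next
    assume ?R
    then have "phys_idx r (on_idx r M)"
    proof (elim disjE conjE exE)
      fix s assume s: "s\<^sup>2 = n" and X: "\<exists>X\<in>{B_i r, B_ii r, B_iii r, B_iv r}. wmat_eq r 2 M X"
      note c = phys_idx_c[OF s[unfolded n]]
      from X[unfolded ex[OF s]] show ?thesis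
        by (elim disjE) (erule phys_idx_same; rule c)+
    qed (auto simp only: family_a_iff[OF r] family_b_iff[OF r] intro: phys_idx_same phys_idx_a phys_idx_b)
    then show "physical_invariant r 2 M" using physical_invariant_idx[OF r] by blast
  qed
next
  assume "\<exists>s. s\<^sup>2 = n"
  then obtain s where s: "s\<^sup>2 = 2 * r + 1" unfolding n by blast
  note B = B_exceptional_same[OF r s]
  \<comment> \<open>The entry at (J0, J0) separates the exceptional matrices from both families,
    where it is 1: as 2/4 + 1/2 in the first and 4/4 in the second.\<close>
  have corner: "on_idx r X VacJ VacJ = 0" if "X \<in> {B_i r, B_ii r, B_iii r, B_iv r}" for X
    using that B by (auto simp: same_idx_def B_i_idx_def simp del: wt_of.simps)
  show "\<forall>X\<in>{B_i r, B_ii r, B_iii r, B_iv r}. physical_invariant r 2 X \<and> \<not> family_a r X \<and> \<not> family_b r X"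
  proof (intro ballI conjI)
    fix X assume X: "X \<in> {B_i r, B_ii r, B_iii r, B_iv r}"
    have "phys_idx r (on_idx r X)"
      using X phys_idx_same[OF B(1) phys_idx_c(4)[OF s]] phys_idx_same[OF B(2) phys_idx_c(1)[OF s]]
        phys_idx_same[OF B(3) phys_idx_c(2)[OF s]] phys_idx_same[OF B(4) phys_idx_c(3)[OF s]] by blast
    then show "physical_invariant r 2 X" using physical_invariant_idx[OF r] by blast
    show "\<not> family_a r X"
    proof
      assume "family_a r X"
      then obtain g where "g dvd 2 * r + 1" "same_idx r (on_idx r X) (kernel_mat (lag2 (2 * r + 1) g) 1)" using family_a_iff[OF r] by blast
      then have "on_idx r X VacJ VacJ = 1" unfolding same_idx_def using lag2_properties(7)[of g r] by (simp del: wt_of.simps)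
      then show False using corner[OF X] by (simp del: wt_of.simps)
    qed
    show "\<not> family_b r X"
    proof
      assume "family_b r X"
      then obtain g h where "g dvd 2 * r + 1" "h dvd 2 * r + 1"
        "same_idx r (on_idx r X) (kernel_mat (\<lambda>x y. lag2 (2 * r + 1) g x y + lag2 (2 * r + 1) h x y) 0)" using family_b_iff[OF r] by blast
      then have "on_idx r X VacJ VacJ = 1" unfolding same_idx_def using lag2_properties(7)[of g r] lag2_properties(7)[of h r] by (simp del: wt_of.simps)
      then show False using corner[OF X] by (simp del: wt_of.simps)
    qed
  qed
  have entries: "on_idx r (B_i r) Vac (lam r) = 0" "on_idx r (B_ii r) Vac (lam r) = 1" "on_idx r (B_iii r) Vac (lam r) = 0"
    "on_idx r (B_i r) Vac VacJ = 0" "on_idx r (B_iii r) Vac VacJ = 1" "on_idx r (B_iv r) Vac VacJ = 0"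
    "on_idx r (B_i r) VacJ Vac = 0" "on_idx r (B_ii r) VacJ Vac = 0" "on_idx r (B_iv r) VacJ Vac = 1"
    using B by (simp_all add: same_idx_def B_i_idx_def del: wt_of.simps)
  have neq: "\<not> wmat_eq r 2 A A'" if "i \<in> idxs r" "j \<in> idxs r" "on_idx r A i j \<noteq> on_idx r A' i j" for A A' i j
    using that unfolding wmat_eq_idx[OF r] by blast
  show "\<not> wmat_eq r 2 (B_i r) (B_ii r)" "\<not> wmat_eq r 2 (B_ii r) (B_iii r)"
    by (rule neq[of Vac "lam r"]; simp add: entries del: wt_of.simps)+
  show "\<not> wmat_eq r 2 (B_i r) (B_iii r)" "\<not> wmat_eq r 2 (B_iii r) (B_iv r)"
    by (rule neq[of Vac VacJ]; simp add: entries del: wt_of.simps)+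
  show "\<not> wmat_eq r 2 (B_i r) (B_iv r)" "\<not> wmat_eq r 2 (B_ii r) (B_iv r)"
    by (rule neq[of VacJ Vac]; simp add: entries del: wt_of.simps)+
qed

end
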